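(* Let $\mathfrak{T}=\mathfrak{sl}_2\otimes\mathbb{C}[x]/(x^2)$ be the Takiff Lie algebra of $\mathfrak{sl}_2(\mathbb{C})$ and $U=U(\mathfrak{T})$. Let $n\in\mathbb{Z}$ and $\lambda_2\in\mathbb{C}$, $\lambda_2\neq 0$. Then the annihilators in $U$ \[ \operatorname{Ann}(V(n,\lambda_2))=\operatorname{Ann}(\Delta(n-2,\lambda_2))=\operatorname{Ann}(\Delta(-n-2,-\lambda_2)) \] are centrally generated. More precisely, they are equal to the ideal $U\cdot\operatorname{Ker}\chi$, where $\chi\colon Z(\mathfrak{T})=\mathbb{C}[C,\bar C]\to\mathbb{C}$ is the homomorphism of algebras defined on the generators by $C\mapsto n\lambda_2$ and $\bar C\mapsto\lambda_2^2$.
   Context: Everything is over $\mathbb{C}$. $\mathfrak{sl}_2$ has standard basis $f,h,e$; the bracket on $\mathfrak{T}$ is $[v\otimes x^i,w\otimes x^j]=[v,w]\otimes x^{i+j}$; $v$ is identified with $v\otimes 1$ and $\bar v:=v\otimes x$. The center $Z(\mathfrak{T})$ of $U$ is the polynomial algebra in the two algebraically independent elements $C=\bar h h+2\bar f e+2\bar e f$ and $\bar C=\bar h^2+4\bar f\bar e$. Verma modules: for $(\lambda_1,\lambda_2)\in\mathbb{C}^2$, $\Delta(\lambda_1,\lambda_2)=U\otimes_{U(\tilde{\mathfrak{b}})}\mathbb{C}_\lambda$, where $\tilde{\mathfrak{b}}=\mathrm{span}\{h,\bar h,e,\bar e\}$ and on the one-dimensional module $\mathbb{C}_\lambda$ the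 elements $e,\bar e$ act by $0$, $h$ by $\lambda_1$, $\bar h$ by $\lambda_2$. Completion functor: let $U_{(f)}$ be the Ore localization of $U$ at the powers of $f$, and $S_f:=U_{(f)}/U$, a $U$-$U$-bimodule. For a $\mathfrak{T}$-module $M$, $\mathbf{EA}(M)$ is the submodule of $S_f\otimes_U M$ consisting of all $m$ with $\dim\mathbb{C}[e]m<\infty$. For $n\in\mathbb{Z}$ and $\lambda_2\neq 0$, $V(n,\lambda_2):=\mathbf{EA}(\Delta(n-2,\lambda_2))$. *)

theory Defs
  imports Complex_Main "HOL-Library.Poly_Mapping" "HOL-Library.Set_Algebras"
begin

section \<open>Additive subgroups, associative algebras and Lie algebras over the complex numbers\<close>

inductive_set add_span :: "'a::ab_group_add set \<Rightarrow> 'a set" for S where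
  zero: "0 \<in> add_span S"
| base: "x \<in> S \<Longrightarrow> x \<in> add_span S"
| diff: "x \<in> add_span S \<Longrightarrow> y \<in> add_span S \<Longrightarrow> x - y \<in> add_span S"

lemma add_span_uminus: "x \<in> add_span S \<Longrightarrow> - x \<in> add_span S"
  using add_span.diff[OF add_span.zero, of x S] by simp

lemma add_span_add: "x \<in> add_span S \<Longrightarrow> y \<in> add_span S \<Longrightarrow> x + y \<in> add_span S"
  using add_span.diff[of x S "- y"] add_span_uminus[of y S] by simp

lemma add_span_map:
  assumes x: "x \<in> add_span S" and g0: "g 0 = 0"
    and gd: "\<And>x y. g (x - y) = g x - g y"
    and gS: "\<And>x. x \<in> S \<Longrightarrow> g x \<in> add_span T"
  shows "g x \<in> add_span T"
  using x by induction (auto simp: g0 gd gS intro: add_span.intros)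

definition two_sided_ideal :: "'a::ring_1 set \<Rightarrow> 'a set" where
  "two_sided_ideal S = add_span {a * s * b | a s b. s \<in> S}"

lemma two_sided_ideal_mult:
  assumes "x \<in> two_sided_ideal S"
  shows "a * x \<in> two_sided_ideal S" "x * a \<in> two_sided_ideal S"
proof -
  show "a * x \<in> two_sided_ideal S"
    using assms unfolding two_sided_ideal_def
  proof (rule add_span_map)
    fix x assume "x \<in> {a * s * b | a s b. s \<in> S}"
    then obtain c s b where "x = c * s * b" "s \<in> S" by blast
    then have "a * x = (a * c) * s * b" "s \<in> S" by (simp_all add: mult.assoc)
    then show "a * x \<in> add_span {a * s * b | a s b. s \<in> S}"
      by (blast intro: add_span.base)
  qed (simp_all add: right_diff_distrib)
  show "x * a \<in> two_sided_ideal S"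
    using assms unfolding two_sided_ideal_def
  proof (rule add_span_map)
    fix x assume "x \<in> {a * s * b | a s b. s \<in> S}"
    then obtain c s b where "x = c * s * b" "s \<in> S" by blast
    then have "x * a = c * s * (b * a)" "s \<in> S" by (simp_all add: mult.assoc)
    then show "x * a \<in> add_span {a * s * b | a s b. s \<in> S}"
      by (blast intro: add_span.base)
  qed (simp_all add: left_diff_distrib)
qed

lemma two_sided_ideal_base: "s \<in> S \<Longrightarrow> s \<in> two_sided_ideal S"
  unfolding two_sided_ideal_def
  by (rule add_span.base) (metis (mono_tags, lifting) mem_Collect_eq mult_1_left mult_1_right)

class complex_algebra_1 = ring_1 +
  fixes of_cx :: "complex \<Rightarrow> 'a"
  assumes of_cx_one: "of_cx 1 = 1"
    and of_cx_add: "of_cx (a + b) = of_cx a + of_cx b"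
    and of_cx_mult: "of_cx (a * b) = of_cx a * of_cx b"
    and of_cx_central: "of_cx a * x = x * of_cx a"

lemma of_cx_zero [simp]: "of_cx 0 = 0"
  using of_cx_add[of 0 0] by simp

lemma of_cx_uminus: "of_cx (- a) = - of_cx a"
  using of_cx_add[of a "- a"] by (simp add: eq_neg_iff_add_eq_0 add.commute)

lemma of_cx_diff: "of_cx (a - b) = of_cx a - of_cx b"
  using of_cx_add[of a "- b"] by (simp add: of_cx_uminus)

instantiation complex :: complex_algebra_1
begin
definition of_cx_complex :: "complex \<Rightarrow> complex" where "of_cx_complex c = c"
instance by standard (simp_all add: of_cx_complex_def)
end

class complex_lie_algebra = ab_group_add +
  fixes cscale :: "complex \<Rightarrow> 'a \<Rightarrow> 'a"
    and bracket :: "'a \<Rightarrow> 'a \<Rightarrow> 'a"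
  assumes cscale_add_right: "cscale c (x + y) = cscale c x + cscale c y"
    and cscale_add_left: "cscale (c + d) x = cscale c x + cscale d x"
    and cscale_cscale: "cscale c (cscale d x) = cscale (c * d) x"
    and cscale_one: "cscale 1 x = x"
    and bracket_add_left: "bracket (x + y) z = bracket x z + bracket y z"
    and bracket_add_right: "bracket x (y + z) = bracket x y + bracket x z"
    and bracket_cscale_left: "bracket (cscale c x) y = cscale c (bracket x y)"
    and bracket_cscale_right: "bracket x (cscale c y) = cscale c (bracket x y)"
    and bracket_self: "bracket x x = 0"
    and jacobi: "bracket x (bracket y z) + bracket y (bracket z x) + bracket z (bracket x y) = 0"

section \<open>The universal enveloping algebra\<close>

datatype 'a fword = FWord (letters: "'a list")

instantiation fword :: (type) monoid_add
begin
definition zero_fword :: "'a fword" where "zero_fword = FWord []"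
definition plus_fword :: "'a fword \<Rightarrow> 'a fword \<Rightarrow> 'a fword" where
  "plus_fword v w = FWord (letters v @ letters w)"
instance by standard (simp_all add: zero_fword_def plus_fword_def)
end

text \<open>Monoid algebra of words with letters in \<open>'a\<close>: the free complex algebra on the set \<open>'a\<close>.\<close>

type_synonym 'a free_algebra = "'a fword \<Rightarrow>\<^sub>0 complex"

definition free_gen :: "'a \<Rightarrow> 'a free_algebra" where
  "free_gen x = Poly_Mapping.single (FWord [x]) 1"

definition free_const :: "complex \<Rightarrow> 'a free_algebra" where
  "free_const c = Poly_Mapping.single 0 c"

definition free_eval :: "('a \<Rightarrow> 'b::complex_algebra_1) \<Rightarrow> 'a free_algebra \<Rightarrow> 'b" where
  "free_eval \<phi> p =
     (\<Sum>w\<in>Poly_Mapping.keys p. of_cx (Poly_Mapping.lookup p w) * prod_list (map \<phi> (letters w)))"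

lemma free_eval_superset:
  assumes "finite K" "Poly_Mapping.keys p \<subseteq> K"
  shows "free_eval \<phi> p =
     (\<Sum>w\<in>K. of_cx (Poly_Mapping.lookup p w) * prod_list (map \<phi> (letters w)))"
  unfolding free_eval_def
  by (rule sum.mono_neutral_left) (use assms in \<open>auto simp: in_keys_iff\<close>)

lemma free_eval_zero [simp]: "free_eval \<phi> 0 = 0"
  by (simp add: free_eval_def)

lemma free_eval_add: "free_eval \<phi> (p + q) = free_eval \<phi> p + free_eval \<phi> q"
proof -
  let ?K = "Poly_Mapping.keys p \<union> Poly_Mapping.keys q"
  have "Poly_Mapping.keys (p + q) \<subseteq> ?K" by (rule keys_add)
  then show ?thesis
    by (simp add: free_eval_superset[of ?K] lookup_add of_cx_add distrib_right sum.distrib)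
qed

lemma free_eval_uminus: "free_eval \<phi> (- p) = - free_eval \<phi> p"
  using free_eval_add[of \<phi> p "- p"] by (simp add: eq_neg_iff_add_eq_0 add.commute)

lemma free_eval_diff: "free_eval \<phi> (p - q) = free_eval \<phi> p - free_eval \<phi> q"
  using free_eval_add[of \<phi> p "- q"] by (simp add: free_eval_uminus)

lemma free_eval_single:
  "free_eval \<phi> (Poly_Mapping.single w c) = of_cx c * prod_list (map \<phi> (letters w))"
  by (simp add: free_eval_def)

lemma free_algebra_induct [case_names zero single add]:
  assumes "P 0" "\<And>w c. P (Poly_Mapping.single w c)" "\<And>p q. P p \<Longrightarrow> P q \<Longrightarrow> P (p + q)"
  shows "P (p :: 'a free_algebra)"
proof (induction p rule: update_induct)
  case const
  show ?case by (rule assms(1))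
next
  case (update f a b)
  have "Poly_Mapping.update a b f = f + Poly_Mapping.single a b"
    by (rule poly_mapping_eqI)
      (use update(1) in \<open>auto simp: lookup_update lookup_add lookup_single in_keys_iff when_def\<close>)
  then show ?case using assms(2,3) update by metis
qed

lemma free_eval_mult: "free_eval \<phi> (p * q) = free_eval \<phi> p * free_eval \<phi> q"
proof (induction p rule: free_algebra_induct)
  case (single w c)
  show ?case
  proof (induction q rule: free_algebra_induct)
    case (single v d)
    have "of_cx (c * d) * (prod_list (map \<phi> (letters w)) * prod_list (map \<phi> (letters v)))
        = of_cx c * (of_cx d * prod_list (map \<phi> (letters w))) * prod_list (map \<phi> (letters v))"
      by (simp add: of_cx_mult mult.assoc)
    also have "\<dots> = of_cx c * (prod_list (map \<phi> (letters w)) * of_cx d) * prod_list (map \<phi> (letters v))"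
      by (simp only: of_cx_central)
    finally show ?case
      by (simp add: mult_single free_eval_single plus_fword_def mult.assoc)
  qed (simp_all add: free_eval_add distrib_left)
qed (simp_all add: free_eval_add distrib_right)

lemma free_eval_gen [simp]: "free_eval \<phi> (free_gen x) = \<phi> x"
  by (simp add: free_gen_def free_eval_single of_cx_one)

lemma free_eval_const [simp]: "free_eval \<phi> (free_const c) = of_cx c"
  by (simp add: free_const_def free_eval_single zero_fword_def)

lemma free_const_one: "free_const 1 = 1"
  by (simp add: free_const_def)

lemma free_const_add: "free_const (a + b) = free_const a + free_const b"
  by (simp add: free_const_def single_add)

lemma free_const_mult: "free_const (a * b) = free_const a * free_const b"
  by (simp add: free_const_def mult_single)

lemma free_const_central: "free_const c * p = p * free_const c"
  by (induction p rule: free_algebra_induct)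
    (simp_all add: free_const_def mult_single mult.commute distrib_left distrib_right)

text \<open>The first two families turn the free algebra on the set \<open>'g\<close> into the tensor algebra of
  the vector space \<open>'g\<close>.\<close>

definition uea_relators :: "'g::complex_lie_algebra free_algebra set" where
  "uea_relators =
     {free_gen (x + y) - free_gen x - free_gen y | x y. True} \<union>
     {free_gen (cscale c x) - free_const c * free_gen x | c x. True} \<union>
     {free_gen x * free_gen y - free_gen y * free_gen x - free_gen (bracket x y) | x y. True}"

lemma free_eval_ideal:
  assumes p: "p \<in> two_sided_ideal uea_relators"
    and add: "\<And>x y. \<phi> (x + y) = \<phi> x + \<phi> y"
    and scale: "\<And>c x. \<phi> (cscale c x) = of_cx c * \<phi> x"
    and brack: "\<And>x y. \<phi> (bracket x y) = \<phi> x * \<phi> y - \<phi> y * \<phi> x"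
  shows "free_eval \<phi> p = 0"
proof -
  have *: "free_eval \<phi> s = 0" if "s \<in> uea_relators" for s
    using that unfolding uea_relators_def
    by (auto simp: free_eval_diff free_eval_mult add scale brack)
  show ?thesis
    using p unfolding two_sided_ideal_def
    by induction (auto simp: free_eval_diff free_eval_mult *)
qed

lemma one_notin_uea_ideal: "1 \<notin> two_sided_ideal (uea_relators :: 'g::complex_lie_algebra free_algebra set)"
proof
  assume "1 \<in> two_sided_ideal (uea_relators :: 'g free_algebra set)"
  then have "free_eval (\<lambda>_::'g. 0 :: complex) 1 = 0"
    by (rule free_eval_ideal) simp_all
  then show False
    using free_eval_const[of "\<lambda>_::'g. 0 :: complex" 1] by (simp add: free_const_one of_cx_one)
qed

definition uea_rel :: "'g::complex_lie_algebra free_algebra \<Rightarrow> 'g free_algebra \<Rightarrow> bool" where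
  "uea_rel p q \<longleftrightarrow> p - q \<in> two_sided_ideal uea_relators"

quotient_type (overloaded) 'g uea = "'g::complex_lie_algebra free_algebra" / uea_rel
proof (rule equivpI)
  show "reflp (uea_rel :: 'g free_algebra \<Rightarrow> _)"
    by (rule reflpI) (simp add: uea_rel_def two_sided_ideal_def add_span.zero)
  show "symp (uea_rel :: 'g free_algebra \<Rightarrow> _)"
  proof (rule sympI)
    fix p q :: "'g free_algebra"
    assume "uea_rel p q"
    then have "- (p - q) \<in> two_sided_ideal uea_relators"
      unfolding uea_rel_def two_sided_ideal_def by (rule add_span_uminus)
    then show "uea_rel q p" by (simp add: uea_rel_def)
  qed
  show "transp (uea_rel :: 'g free_algebra \<Rightarrow> _)"
  proof (rule transpI)
    fix p q r :: "'g free_algebra"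
    assume "uea_rel p q" "uea_rel q r"
    then have "(p - q) + (q - r) \<in> two_sided_ideal uea_relators"
      unfolding uea_rel_def two_sided_ideal_def by (rule add_span_add)
    then show "uea_rel p r" by (simp add: uea_rel_def)
  qed
qed

instantiation uea :: (complex_lie_algebra) complex_algebra_1
begin

lift_definition zero_uea :: "'a uea" is 0 .
lift_definition one_uea :: "'a uea" is 1 .

lift_definition plus_uea :: "'a uea \<Rightarrow> 'a uea \<Rightarrow> 'a uea" is "(+)"
proof -
  fix p p' q q' :: "'a free_algebra"
  assume "uea_rel p p'" "uea_rel q q'"
  then have "(p - p') + (q - q') \<in> two_sided_ideal uea_relators"
    unfolding uea_rel_def two_sided_ideal_def by (rule add_span_add)
  then show "uea_rel (p + q) (p' + q')" by (simp add: uea_rel_def algebra_simps)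
qed

lift_definition minus_uea :: "'a uea \<Rightarrow> 'a uea \<Rightarrow> 'a uea" is "(-)"
proof -
  fix p p' q q' :: "'a free_algebra"
  assume "uea_rel p p'" "uea_rel q q'"
  then have "(p - p') - (q - q') \<in> two_sided_ideal uea_relators"
    unfolding uea_rel_def two_sided_ideal_def by (rule add_span.diff)
  then show "uea_rel (p - q) (p' - q')" by (simp add: uea_rel_def algebra_simps)
qed

lift_definition uminus_uea :: "'a uea \<Rightarrow> 'a uea" is uminus
proof -
  fix p p' :: "'a free_algebra"
  assume "uea_rel p p'"
  then have "- (p - p') \<in> two_sided_ideal uea_relators"
    unfolding uea_rel_def two_sided_ideal_def by (rule add_span_uminus)
  then show "uea_rel (- p) (- p')" by (simp add: uea_rel_def)
qed

lift_definition times_uea :: "'a uea \<Rightarrow> 'a uea \<Rightarrow> 'a uea" is "(*)"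
proof -
  fix p p' q q' :: "'a free_algebra"
  assume "uea_rel p p'" "uea_rel q q'"
  then have "(p - p') * q \<in> two_sided_ideal uea_relators" "p' * (q - q') \<in> two_sided_ideal uea_relators"
    unfolding uea_rel_def by (simp_all add: two_sided_ideal_mult)
  then have "(p - p') * q + p' * (q - q') \<in> two_sided_ideal uea_relators"
    unfolding two_sided_ideal_def by (rule add_span_add)
  then show "uea_rel (p * q) (p' * q')" by (simp add: uea_rel_def algebra_simps)
qed

lift_definition of_cx_uea :: "complex \<Rightarrow> 'a uea" is free_const .

instance
proof
  show "(0 :: 'a uea) \<noteq> 1"
  proof transfer
    have "- 1 \<notin> two_sided_ideal (uea_relators :: 'a free_algebra set)"
      using one_notin_uea_ideal add_span_uminus unfolding two_sided_ideal_def by fastforce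
    then show "\<not> uea_rel (0 :: 'a free_algebra) 1"
      by (simp add: uea_rel_def)
  qed
qed (transfer; simp add: uea_rel_def two_sided_ideal_def add_span.zero algebra_simps
      free_const_one free_const_add free_const_mult; simp add: free_const_central add_span.zero)+

end

lift_definition uea_of :: "'g::complex_lie_algebra \<Rightarrow> 'g uea" is free_gen .

text \<open>The algebra homomorphism extending \<open>\<phi>\<close>. The chosen representative is irrelevant when
  \<open>\<phi>\<close> is linear and turns brackets into commutators.\<close>

definition uea_lift :: "('g::complex_lie_algebra \<Rightarrow> 'b::complex_algebra_1) \<Rightarrow> 'g uea \<Rightarrow> 'b" where
  "uea_lift \<phi> u = free_eval \<phi> (rep_uea u)"

lemma uea_of_add: "uea_of (x + y) = uea_of x + uea_of y"
  by transfer (auto simp: uea_rel_def uea_relators_def diff_diff_eq intro!: two_sided_ideal_base)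

lemma uea_of_cscale: "uea_of (cscale c x) = of_cx c * uea_of x"
  by transfer (auto simp: uea_rel_def uea_relators_def intro!: two_sided_ideal_base)

lemma uea_of_bracket: "uea_of (bracket x y) = uea_of x * uea_of y - uea_of y * uea_of x"
proof -
  have "uea_of x * uea_of y - uea_of y * uea_of x = uea_of (bracket x y)"
    by transfer (auto simp: uea_rel_def uea_relators_def intro!: two_sided_ideal_base)
  then show ?thesis by simp
qed

lemma uea_induct [case_names const gen add mult]:
  assumes const: "\<And>c. P (of_cx c)" and gen: "\<And>x. P (uea_of x)"
    and add: "\<And>u v. P u \<Longrightarrow> P v \<Longrightarrow> P (u + v)"
    and mult: "\<And>u v. P u \<Longrightarrow> P v \<Longrightarrow> P (u * v)"
  shows "P (u :: 'g::complex_lie_algebra uea)"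
proof -
  have word: "P (abs_uea (Poly_Mapping.single (FWord xs) c))" for xs :: "'g list" and c
  proof (induction xs)
    case Nil
    then show ?case
      using const[of c] by (simp add: of_cx_uea.abs_eq free_const_def zero_fword_def)
  next
    case (Cons x xs)
    have "free_gen x * Poly_Mapping.single (FWord xs) c = Poly_Mapping.single (FWord (x # xs)) c"
      by (simp add: free_gen_def mult_single plus_fword_def)
    then have "abs_uea (Poly_Mapping.single (FWord (x # xs)) c) =
        uea_of x * abs_uea (Poly_Mapping.single (FWord xs) c)"
      by (simp add: times_uea.abs_eq uea_of.abs_eq)
    then show ?case using mult[OF gen Cons] by simp
  qed
  have "P (abs_uea p)" for p :: "'g free_algebra"
  proof (induction p rule: free_algebra_induct)
    case zero
    then show ?case using const[of 0] by (simp add: zero_uea.abs_eq[symmetric])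
  next
    case (single w c)
    then show ?case using word[of "letters w" c] by simp
  next
    case (add p q)
    then show ?case using assms(3) by (simp add: plus_uea.abs_eq[symmetric])
  qed
  then show ?thesis by (metis Quotient3_abs_rep Quotient3_uea)
qed

lemma uea_lift_hom:
  assumes add: "\<And>x y. \<phi> (x + y) = \<phi> x + \<phi> y"
    and scale: "\<And>c x. \<phi> (cscale c x) = of_cx c * \<phi> x"
    and brack: "\<And>x y. \<phi> (bracket x y) = \<phi> x * \<phi> y - \<phi> y * \<phi> x"
  shows "uea_lift \<phi> (u + v) = uea_lift \<phi> u + uea_lift \<phi> v"
    and "uea_lift \<phi> (u * v) = uea_lift \<phi> u * uea_lift \<phi> v"
    and "uea_lift \<phi> (of_cx c) = of_cx c"
    and "uea_lift \<phi> (uea_of x) = \<phi> x"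
proof -
  have abs: "uea_lift \<phi> (abs_uea p) = free_eval \<phi> p" for p
  proof -
    have "uea_rel (rep_uea (abs_uea p)) p"
      by (rule Quotient3_rep_abs[OF Quotient3_uea])
        (simp add: uea_rel_def two_sided_ideal_def add_span.zero)
    then have "free_eval \<phi> (rep_uea (abs_uea p) - p) = 0"
      unfolding uea_rel_def by (rule free_eval_ideal) (fact assms)+
    then show ?thesis by (simp add: uea_lift_def free_eval_diff)
  qed
  have rep: "abs_uea (rep_uea u) = u" for u :: "'a uea"
    by (rule Quotient3_abs_rep[OF Quotient3_uea])
  show "uea_lift \<phi> (u + v) = uea_lift \<phi> u + uea_lift \<phi> v"
    using abs[of "rep_uea u + rep_uea v"]
    by (simp add: plus_uea.abs_eq[symmetric] rep free_eval_add) (simp add: uea_lift_def)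
  show "uea_lift \<phi> (u * v) = uea_lift \<phi> u * uea_lift \<phi> v"
    using abs[of "rep_uea u * rep_uea v"]
    by (simp add: times_uea.abs_eq[symmetric] rep free_eval_mult) (simp add: uea_lift_def)
  show "uea_lift \<phi> (of_cx c) = of_cx c"
    using abs[of "free_const c"] by (simp add: of_cx_uea.abs_eq)
  show "uea_lift \<phi> (uea_of x) = \<phi> x"
    using abs[of "free_gen x"] by (simp add: uea_of.abs_eq)
qed

lifting_forget uea.lifting

section \<open>The Takiff Lie algebra and its Borel subalgebra\<close>

text \<open>\<open>Sl2 a b c\<close> is \<open>a f + b h + c e\<close>, with \<open>[h,e] = 2e\<close>, \<open>[h,f] = -2f\<close>, \<open>[e,f] = h\<close>.\<close>

datatype sl2 = Sl2 (f_coord: complex) (h_coord: complex) (e_coord: complex)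

instantiation sl2 :: complex_lie_algebra
begin
definition "0 = Sl2 0 0 0"
definition "x + y = Sl2 (f_coord x + f_coord y) (h_coord x + h_coord y) (e_coord x + e_coord y)"
definition "x - y = Sl2 (f_coord x - f_coord y) (h_coord x - h_coord y) (e_coord x - e_coord y)"
definition "- x = Sl2 (- f_coord x) (- h_coord x) (- e_coord x)"
definition "cscale c x = Sl2 (c * f_coord x) (c * h_coord x) (c * e_coord x)"
definition "bracket x y =
  Sl2 (2 * (f_coord x * h_coord y - h_coord x * f_coord y))
      (e_coord x * f_coord y - f_coord x * e_coord y)
      (2 * (h_coord x * e_coord y - e_coord x * h_coord y))"
lemmas sl2_defs = zero_sl2_def plus_sl2_def minus_sl2_def uminus_sl2_def
  cscale_sl2_def bracket_sl2_def
instance by standard (simp_all add: sl2_defs algebra_simps)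
end

text \<open>\<open>Takiff v w\<close> is \<open>v \<otimes> 1 + w \<otimes> x\<close> in \<open>\<g> \<otimes> \<complex>[x]/(x\<^sup>2)\<close>.\<close>

datatype 'g takiff = Takiff (part0: 'g) (part1: 'g)

instantiation takiff :: (complex_lie_algebra) complex_lie_algebra
begin
definition "0 = Takiff 0 0"
definition "x + y = Takiff (part0 x + part0 y) (part1 x + part1 y)"
definition "x - y = Takiff (part0 x - part0 y) (part1 x - part1 y)"
definition "- x = Takiff (- part0 x) (- part1 x)"
definition "cscale c x = Takiff (cscale c (part0 x)) (cscale c (part1 x))"
definition "bracket x y = Takiff (bracket (part0 x) (part0 y))
  (bracket (part0 x) (part1 y) + bracket (part1 x) (part0 y))"
lemmas takiff_defs = zero_takiff_def plus_takiff_def minus_takiff_def uminus_takiff_def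
  cscale_takiff_def bracket_takiff_def
instance
proof
  have anti: "bracket u v + bracket v u = 0" for u v :: 'a
    using bracket_self[of "u + v"]
    unfolding bracket_add_left bracket_add_right bracket_self[of u] bracket_self[of v]
    by (simp add: add.commute)
  fix x y z :: "'a takiff"
  show "bracket x x = 0"
    by (simp add: takiff_defs bracket_self anti)
  obtain a b c d e g where xyz: "x = Takiff a b" "y = Takiff c d" "z = Takiff e g"
    by (metis takiff.exhaust)
  have "bracket a (bracket c g + bracket d e) + bracket b (bracket c e) +
    (bracket c (bracket e b + bracket g a) + bracket d (bracket e a)) +
    (bracket e (bracket a d + bracket b c) + bracket g (bracket a c)) =
    (bracket a (bracket c g) + bracket c (bracket g a) + bracket g (bracket a c)) +
    (bracket a (bracket d e) + bracket d (bracket e a) + bracket e (bracket a d)) +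
    (bracket b (bracket c e) + bracket c (bracket e b) + bracket e (bracket b c))"
    by (simp add: bracket_add_right algebra_simps)
  then show "bracket x (bracket y z) + bracket y (bracket z x) + bracket z (bracket x y) = 0"
    by (simp add: takiff_defs xyz jacobi)
qed (simp_all add: takiff_defs cscale_add_right cscale_add_left cscale_cscale cscale_one
  bracket_add_left bracket_add_right bracket_cscale_left bracket_cscale_right algebra_simps)
end

type_synonym T = "sl2 takiff"
type_synonym U = "T uea"

abbreviation "tf \<equiv> Takiff (Sl2 1 0 0) 0 :: T"
abbreviation "th \<equiv> Takiff (Sl2 0 1 0) 0 :: T"
abbreviation "te \<equiv> Takiff (Sl2 0 0 1) 0 :: T"
abbreviation "tf_bar \<equiv> Takiff 0 (Sl2 1 0 0) :: T"
abbreviation "th_bar \<equiv> Takiff 0 (Sl2 0 1 0) :: T"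
abbreviation "te_bar \<equiv> Takiff 0 (Sl2 0 0 1) :: T"

abbreviation "uf \<equiv> uea_of tf"
abbreviation "uh \<equiv> uea_of th"
abbreviation "ue \<equiv> uea_of te"
abbreviation "uf_bar \<equiv> uea_of tf_bar"
abbreviation "uh_bar \<equiv> uea_of th_bar"
abbreviation "ue_bar \<equiv> uea_of te_bar"

typedef borel =
  "{cscale a th + cscale b th_bar + cscale c te + cscale d te_bar | a b c d. True}"
  by blast

lemma borel_eq:
  "{cscale a th + cscale b th_bar + cscale c te + cscale d te_bar | a b c d. True} =
   {x. f_coord (part0 x) = 0 \<and> f_coord (part1 x) = 0}" (is "?L = ?R")
proof
  show "?L \<subseteq> ?R" by (auto simp: takiff_defs sl2_defs)
  show "?R \<subseteq> ?L"
  proof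
    fix x assume "x \<in> ?R"
    then have "x = cscale (h_coord (part0 x)) th + cscale (h_coord (part1 x)) th_bar
        + cscale (e_coord (part0 x)) te + cscale (e_coord (part1 x)) te_bar"
      by (intro takiff.expand sl2.expand conjI) (auto simp: takiff_defs sl2_defs)
    then show "x \<in> ?L" by blast
  qed
qed

setup_lifting type_definition_borel

instantiation borel :: complex_lie_algebra
begin
lift_definition zero_borel :: borel is 0
  by (auto simp: takiff_defs sl2_defs)
lift_definition plus_borel :: "borel \<Rightarrow> borel \<Rightarrow> borel" is "(+)"
  by (auto simp: takiff_defs sl2_defs)
lift_definition minus_borel :: "borel \<Rightarrow> borel \<Rightarrow> borel" is "(-)"
  by (auto simp: takiff_defs sl2_defs)
lift_definition uminus_borel :: "borel \<Rightarrow> borel" is uminus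
  by (auto simp: takiff_defs sl2_defs)
lift_definition cscale_borel :: "complex \<Rightarrow> borel \<Rightarrow> borel" is cscale
  by (auto simp: takiff_defs sl2_defs)
lift_definition bracket_borel :: "borel \<Rightarrow> borel \<Rightarrow> borel" is bracket
  by (auto simp: takiff_defs sl2_defs)
instance
  by standard (transfer; simp add: add.assoc add.commute cscale_add_right cscale_add_left
    cscale_cscale cscale_one bracket_add_left bracket_add_right bracket_cscale_left
    bracket_cscale_right bracket_self; fail | transfer; rule jacobi)+
end

definition borel_incl :: "borel uea \<Rightarrow> U" where
  "borel_incl = uea_lift (\<lambda>b. uea_of (Rep_borel b))"

definition borel_weight :: "complex \<Rightarrow> complex \<Rightarrow> borel \<Rightarrow> complex" where
  "borel_weight \<mu> \<nu> b =
     \<mu> * h_coord (part0 (Rep_borel b)) + \<nu> * h_coord (part1 (Rep_borel b))"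

lemma borel_incl_hom:
  "borel_incl (u + v) = borel_incl u + borel_incl v"
  "borel_incl (u * v) = borel_incl u * borel_incl v"
  "borel_incl (of_cx c) = of_cx c"
  "borel_incl (uea_of b) = uea_of (Rep_borel b)"
  unfolding borel_incl_def
  by (rule uea_lift_hom; simp add: plus_borel.rep_eq cscale_borel.rep_eq bracket_borel.rep_eq
      uea_of_add uea_of_cscale uea_of_bracket)+

lemma borel_weight_hom:
  "uea_lift (borel_weight \<mu> \<nu>) (u + v) =
     uea_lift (borel_weight \<mu> \<nu>) u + uea_lift (borel_weight \<mu> \<nu>) v"
  "uea_lift (borel_weight \<mu> \<nu>) (u * v) =
     uea_lift (borel_weight \<mu> \<nu>) u * uea_lift (borel_weight \<mu> \<nu>) v"
  "uea_lift (borel_weight \<mu> \<nu>) (of_cx c) = c"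
  "uea_lift (borel_weight \<mu> \<nu>) (uea_of b) = borel_weight \<mu> \<nu> b"
proof -
  have br: "borel_weight \<mu> \<nu> (bracket x y) = 0" for x y
    using Rep_borel[of x] Rep_borel[of y] unfolding borel_eq
    by (simp add: borel_weight_def bracket_borel.rep_eq takiff_defs sl2_defs)
  note hom = uea_lift_hom[where \<phi> = "borel_weight \<mu> \<nu>"]
  have add: "borel_weight \<mu> \<nu> (x + y) = borel_weight \<mu> \<nu> x + borel_weight \<mu> \<nu> y" for x y
    by (simp add: borel_weight_def plus_borel.rep_eq takiff_defs sl2_defs algebra_simps)
  have sc: "borel_weight \<mu> \<nu> (cscale c x) = of_cx c * borel_weight \<mu> \<nu> x" for c x
    by (simp add: borel_weight_def cscale_borel.rep_eq takiff_defs sl2_defs algebra_simps of_cx_complex_def)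
  have br': "borel_weight \<mu> \<nu> (bracket x y) =
      borel_weight \<mu> \<nu> x * borel_weight \<mu> \<nu> y - borel_weight \<mu> \<nu> y * borel_weight \<mu> \<nu> x" for x y
    by (simp add: br)
  show "uea_lift (borel_weight \<mu> \<nu>) (u + v) =
     uea_lift (borel_weight \<mu> \<nu>) u + uea_lift (borel_weight \<mu> \<nu>) v"
  "uea_lift (borel_weight \<mu> \<nu>) (u * v) =
     uea_lift (borel_weight \<mu> \<nu>) u * uea_lift (borel_weight \<mu> \<nu>) v"
  "uea_lift (borel_weight \<mu> \<nu>) (of_cx c) = c"
  "uea_lift (borel_weight \<mu> \<nu>) (uea_of b) = borel_weight \<mu> \<nu> b"
    using hom[OF add sc br'] by (simp_all add: of_cx_complex_def)
qed

section \<open>Ore localization at the powers of f\<close>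

lemma pow_pow_mult: "x ^ a * (x ^ b * y) = x ^ (a + b) * (y :: 'a::monoid_mult)"
  by (simp add: power_add mult.assoc)

definition ad_f :: "U \<Rightarrow> U" where "ad_f u = uf * u - u * uf"

lemma ad_f_add: "ad_f (u + v) = ad_f u + ad_f v"
  by (simp add: ad_f_def algebra_simps)

lemma ad_f_pow_add: "(ad_f ^^ n) (u + v) = (ad_f ^^ n) u + (ad_f ^^ n) v"
  by (induction n) (simp_all add: ad_f_add)

lemma ad_f_pow_zero: "(ad_f ^^ n) 0 = 0"
  by (induction n) (simp_all add: ad_f_def)

lemma ad_f_pow_mono:
  assumes "(ad_f ^^ n) u = 0" "n \<le> m"
  shows "(ad_f ^^ m) u = 0"
proof -
  have "(ad_f ^^ (m - n + n)) u = (ad_f ^^ (m - n)) ((ad_f ^^ n) u)"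
    by (simp only: funpow_add o_apply)
  then show ?thesis using assms by (simp add: ad_f_pow_zero)
qed

lemma ad_f_pow_mult:
  "(ad_f ^^ i) u = 0 \<Longrightarrow> (ad_f ^^ j) v = 0 \<Longrightarrow> (ad_f ^^ (i + j)) (u * v) = 0"
proof (induction "i + j" arbitrary: i j u v)
  case 0
  then show ?case by simp
next
  case (Suc n)
  show ?case
  proof (cases "i = 0 \<or> j = 0")
    case True
    then have "u * v = 0" using Suc.prems by auto
    then show ?thesis by (simp add: ad_f_pow_zero)
  next
    case False
    then obtain i' j' where ij: "i = Suc i'" "j = Suc j'" by (metis not0_implies_Suc)
    have "(ad_f ^^ (i' + j)) (ad_f u * v) = 0"
      using Suc.hyps(2) Suc.prems ij by (intro Suc.hyps(1)) (simp_all add: funpow_swap1)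
    moreover have "(ad_f ^^ (i + j')) (u * ad_f v) = 0"
      using Suc.hyps(2) Suc.prems ij by (intro Suc.hyps(1)) (simp_all add: funpow_swap1)
    moreover have "ad_f (u * v) = ad_f u * v + u * ad_f v"
      by (simp add: ad_f_def algebra_simps)
    moreover have "(ad_f ^^ (i + j)) (u * v) = (ad_f ^^ (i' + j)) (ad_f (u * v))"
      using ij by (simp add: funpow_swap1)
    ultimately show ?thesis using ij by (simp add: ad_f_pow_add ad_f_add)
  qed
qed

lemma ad_f_nilpotent: "\<exists>n. (ad_f ^^ n) u = 0"
proof (induction u rule: uea_induct)
  case (const c)
  have "(ad_f ^^ 1) (of_cx c) = 0" by (simp add: ad_f_def of_cx_central)
  then show ?case by blast
next
  case (gen x)
  have ad: "ad_f (uea_of y) = uea_of (bracket tf y)" for y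
    by (simp add: ad_f_def uea_of_bracket)
  have "bracket tf (bracket tf (bracket tf x)) = 0"
    by (simp add: takiff_defs sl2_defs)
  moreover have "uea_of (0 :: T) = 0"
    using uea_of_add[of "0 :: T" 0] by simp
  ultimately have "(ad_f ^^ 3) (uea_of x) = 0"
    by (simp add: numeral_3_eq_3 ad)
  then show ?case by blast
next
  case (add u v)
  then obtain i j where "(ad_f ^^ i) u = 0" "(ad_f ^^ j) v = 0" by blast
  then have "(ad_f ^^ (i + j)) (u + v) = 0"
    by (simp add: ad_f_pow_add ad_f_pow_mono)
  then show ?case by blast
next
  case (mult u v)
  then show ?case using ad_f_pow_mult by blast
qed

lemma f_ore: "\<exists>m w. uf ^ m * u = w * uf ^ l"
proof -
  have *: "(ad_f ^^ n) u = 0 \<Longrightarrow> \<exists>w. uf ^ (n + l) * u = w * uf ^ l" for n u l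
  proof (induction n arbitrary: u l)
    case 0
    then show ?case by (auto intro: exI[of _ 0])
  next
    case (Suc n)
    show ?case
    proof (induction l)
      case 0
      show ?case by simp
    next
      case (Suc l)
      then obtain w where w: "uf ^ (Suc n + l) * u = w * uf ^ l" by blast
      have "(ad_f ^^ n) (ad_f u) = 0" using Suc.prems \<open>(ad_f ^^ Suc n) u = 0\<close>
        by (simp add: funpow_swap1)
      then obtain w' where w': "uf ^ (n + Suc l) * ad_f u = w' * uf ^ Suc l"
        using \<open>\<And>u l. (ad_f ^^ n) u = 0 \<Longrightarrow> \<exists>w. uf ^ (n + l) * u = w * uf ^ l\<close> by blast
      have "uf ^ (Suc n + Suc l) * u = uf ^ (Suc n + l) * (uf * u)"
        by (simp only: add_Suc_right power_Suc2 mult.assoc)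
      also have "uf * u = u * uf + ad_f u" by (simp add: ad_f_def)
      also have "uf ^ (Suc n + l) * (u * uf + ad_f u) = w * uf ^ l * uf + w' * uf ^ Suc l"
        using w w' by (simp add: distrib_left mult.assoc[symmetric])
      also have "\<dots> = (w + w') * uf ^ Suc l"
        by (simp only: distrib_right power_Suc2 mult.assoc)
      finally show ?case by blast
    qed
  qed
  show ?thesis using ad_f_nilpotent[of u] * by blast
qed

lemma f_reversible: "u * uf ^ l = 0 \<Longrightarrow> \<exists>m. uf ^ m * u = 0"
proof (induction l arbitrary: u)
  case 0
  then show ?case by (auto intro: exI[of _ 0])
next
  case (Suc l)
  have "(u * uf ^ l) * uf = 0" using Suc.prems by (simp add: mult.assoc power_commutes)
  then have *: "uf ^ n * (u * uf ^ l) = (ad_f ^^ n) (u * uf ^ l) \<and> (ad_f ^^ n) (u * uf ^ l) * uf = 0"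
    for n
  proof (induction n)
    case (Suc n)
    let ?w = "(ad_f ^^ n) (u * uf ^ l)"
    have "?w * uf = 0" "uf ^ n * (u * uf ^ l) = ?w" using Suc by simp_all
    moreover from this have "ad_f ?w = uf * ?w" by (simp add: ad_f_def[of ?w])
    ultimately show ?case by (simp add: mult.assoc)
  qed simp
  obtain n where "(ad_f ^^ n) (u * uf ^ l) = 0" using ad_f_nilpotent by blast
  then have "(uf ^ n * u) * uf ^ l = 0" using * by (metis mult.assoc)
  from Suc.IH[OF this] obtain m where "uf ^ m * (uf ^ n * u) = 0" by blast
  then show ?case unfolding pow_pow_mult by blast
qed

text \<open>The pair \<open>(k, u)\<close> is the left fraction \<open>f\<^sup>-\<^sup>k u\<close>. To multiply
  \<open>f\<^sup>-\<^sup>k u\<close> and \<open>f\<^sup>-\<^sup>l v\<close>, the Ore condition rewrites \<open>u f\<^sup>-\<^sup>l\<close> as \<open>f\<^sup>-\<^sup>m w\<close>,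
  that is, \<open>f\<^sup>m u = w f\<^sup>l\<close>.\<close>

definition loc_rel :: "nat \<times> U \<Rightarrow> nat \<times> U \<Rightarrow> bool" where
  "loc_rel = (\<lambda>(k, u) (l, v). \<exists>m. uf ^ (m + l) * u = uf ^ (m + k) * v)"

lemma loc_relI: "uf ^ (m + l) * u = uf ^ (m + k) * v \<Longrightarrow> loc_rel (k, u) (l, v)"
  by (auto simp: loc_rel_def)

definition ore_swap :: "U \<Rightarrow> nat \<Rightarrow> nat \<times> U" where
  "ore_swap u l = (SOME (m, w). uf ^ m * u = w * uf ^ l)"

lemma ore_swap: "ore_swap u l = (m, w) \<Longrightarrow> uf ^ m * u = w * uf ^ l"
proof -
  assume a: "ore_swap u l = (m, w)"
  obtain m' w' where "uf ^ m' * u = w' * uf ^ l" using f_ore by blast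
  then have "case ore_swap u l of (m, w) \<Rightarrow> uf ^ m * u = w * uf ^ l"
    unfolding ore_swap_def
    by (intro someI[of "\<lambda>(m, w). uf ^ m * u = w * uf ^ l" "(m', w')"]) simp
  then show ?thesis using a by simp
qed

quotient_type Uf = "nat \<times> U" / loc_rel
proof (rule equivpI)
  show "reflp loc_rel" by (auto intro!: reflpI simp: loc_rel_def)
  show "symp loc_rel" by (rule sympI) (force simp: loc_rel_def intro: sym)
  show "transp loc_rel"
  proof (rule transpI, clarify)
    fix k l p :: nat and u v w :: U
    assume "loc_rel (k, u) (l, v)" "loc_rel (l, v) (p, w)"
    then obtain m m' where m: "uf ^ (m + l) * u = uf ^ (m + k) * v"
      and m': "uf ^ (m' + p) * v = uf ^ (m' + l) * w" by (auto simp: loc_rel_def)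
    have "uf ^ (m' + p) * (uf ^ (m + l) * u) = uf ^ (m + k) * (uf ^ (m' + p) * v)"
      unfolding m pow_pow_mult by (simp add: ac_simps)
    then have "uf ^ (m' + p) * (uf ^ (m + l) * u) = uf ^ (m + k) * (uf ^ (m' + l) * w)"
      unfolding m' .
    then show "loc_rel (k, u) (p, w)"
      unfolding pow_pow_mult by (intro loc_relI[where m = "m + m' + l"]) (simp add: ac_simps)
  qed
qed

lemma loc_times_respects:
  assumes "loc_rel (k, u) (k', u')" "loc_rel (l, v) (l', v')"
    and w: "uf ^ m * u = w * uf ^ l" and w': "uf ^ m' * u' = w' * uf ^ l'"
  shows "loc_rel (k + m, w * v) (k' + m', w' * v')"
proof -
  obtain a b where a: "uf ^ (a + k') * u = uf ^ (a + k) * u'"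
    and b: "uf ^ (b + l') * v = uf ^ (b + l) * v'"
    using assms(1,2) by (auto simp: loc_rel_def)
  obtain r x where r: "uf ^ r * w = x * uf ^ (b + l')" using f_ore by blast
  have 1: "x * uf ^ (b + l) * uf ^ l' = uf ^ (r + m) * u"
  proof -
    have "x * uf ^ (b + l) * uf ^ l' = x * uf ^ (b + l') * uf ^ l"
      by (simp add: mult.assoc power_add[symmetric] ac_simps)
    also have "\<dots> = uf ^ r * (uf ^ m * u)" unfolding r[symmetric] w by (simp add: mult.assoc)
    finally show ?thesis by (simp add: pow_pow_mult)
  qed
  have "uf ^ (a + k' + m') * (x * uf ^ (b + l)) * uf ^ l' = uf ^ (m' + r + m) * (uf ^ (a + k') * u)"
    by (simp add: mult.assoc 1[unfolded mult.assoc] pow_pow_mult ac_simps)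
  also have "\<dots> = uf ^ (r + m + a + k) * (uf ^ m' * u')"
    unfolding a pow_pow_mult by (simp add: ac_simps)
  also have "\<dots> = uf ^ (r + m + a + k) * w' * uf ^ l'"
    unfolding w' by (simp add: mult.assoc)
  finally have "(uf ^ (a + k' + m') * (x * uf ^ (b + l)) - uf ^ (r + m + a + k) * w') * uf ^ l' = 0"
    by (simp add: left_diff_distrib)
  from f_reversible[OF this] obtain d where
    "uf ^ d * (uf ^ (a + k' + m') * (x * uf ^ (b + l))) = uf ^ d * (uf ^ (r + m + a + k) * w')"
    by (auto simp: right_diff_distrib)
  then have "uf ^ (d + (a + k' + m')) * (x * uf ^ (b + l)) * v' = uf ^ (d + (r + m + a + k)) * w' * v'"
    unfolding pow_pow_mult by simp
  moreover have "x * uf ^ (b + l) * v' = uf ^ r * (w * v)"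
    using arg_cong[OF r, of "\<lambda>y. y * v"] b by (simp add: mult.assoc)
  ultimately have "uf ^ (d + (a + k' + m')) * (uf ^ r * (w * v)) = uf ^ (d + (r + m + a + k)) * (w' * v')"
    by (simp add: mult.assoc)
  then show ?thesis
    unfolding pow_pow_mult by (intro loc_relI[where m = "d + a + r"]) (simp add: ac_simps)
qed

instantiation Uf :: "{ring, monoid_mult}"
begin

lift_definition zero_Uf :: Uf is "(0, 0)" .
lift_definition one_Uf :: Uf is "(0, 1)" .
lift_definition uminus_Uf :: "Uf \<Rightarrow> Uf" is "\<lambda>(k, u). (k, - u)"
  by (auto simp: loc_rel_def)

lift_definition plus_Uf :: "Uf \<Rightarrow> Uf \<Rightarrow> Uf" is
  "\<lambda>(k, u) (l, v). (k + l, uf ^ l * u + uf ^ k * v)"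
proof clarsimp
  fix k k' l l' and u u' v v' :: U
  assume "loc_rel (k, u) (k', u')" "loc_rel (l, v) (l', v')"
  then obtain a b where a: "uf ^ (a + k') * u = uf ^ (a + k) * u'"
    and b: "uf ^ (b + l') * v = uf ^ (b + l) * v'" by (auto simp: loc_rel_def)
  have "uf ^ (a + b + (k' + l')) * (uf ^ l * u) = uf ^ (b + l' + l) * (uf ^ (a + k') * u)"
    unfolding pow_pow_mult by (simp add: ac_simps)
  also have "\<dots> = uf ^ (a + b + (k + l)) * (uf ^ l' * u')"
    unfolding a pow_pow_mult by (simp add: ac_simps)
  finally have 1: "uf ^ (a + b + (k' + l')) * (uf ^ l * u) = uf ^ (a + b + (k + l)) * (uf ^ l' * u')" .
  have "uf ^ (a + b + (k' + l')) * (uf ^ k * v) = uf ^ (a + k' + k) * (uf ^ (b + l') * v)"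
    unfolding pow_pow_mult by (simp add: ac_simps)
  also have "\<dots> = uf ^ (a + b + (k + l)) * (uf ^ k' * v')"
    unfolding b pow_pow_mult by (simp add: ac_simps)
  finally have 2: "uf ^ (a + b + (k' + l')) * (uf ^ k * v) = uf ^ (a + b + (k + l)) * (uf ^ k' * v')" .
  show "loc_rel (k + l, uf ^ l * u + uf ^ k * v) (k' + l', uf ^ l' * u' + uf ^ k' * v')"
    by (rule loc_relI[where m = "a + b"]) (simp only: distrib_left 1 2)
qed

definition minus_Uf :: "Uf \<Rightarrow> Uf \<Rightarrow> Uf" where "minus_Uf x y = x + - y"

lift_definition times_Uf :: "Uf \<Rightarrow> Uf \<Rightarrow> Uf" is
  "\<lambda>(k, u) (l, v). case ore_swap u l of (m, w) \<Rightarrow> (k + m, w * v)"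
  by (auto split: prod.splits intro: loc_times_respects ore_swap)

lemma Uf_times_eq:
  assumes "uf ^ m * u = w * uf ^ l"
  shows "abs_Uf (k, u) * abs_Uf (l, v) = abs_Uf (k + m, w * v)"
proof -
  obtain m' w' where mw: "ore_swap u l = (m', w')" by fastforce
  have refl: "loc_rel p p" for p by (auto simp: loc_rel_def)
  have "loc_rel (k + m', w' * v) (k + m, w * v)"
    using refl refl ore_swap[OF mw] assms by (rule loc_times_respects)
  then show ?thesis by (simp add: times_Uf.abs_eq mw Uf.abs_eq_iff)
qed

lemma Uf_eqI: "uf ^ (m + l) * u = uf ^ (m + k) * v \<Longrightarrow> abs_Uf (k, u) = abs_Uf (l, v)"
  by (auto simp: Uf.abs_eq_iff loc_rel_def)

lemma Uf_cases:
  obtains k u where "x = abs_Uf (k, u)"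
  using Quotient3_abs_rep[OF Quotient3_Uf, of x] by (metis surj_pair)

lemma Uf_common_denominator:
  obtains k u v where "x = abs_Uf (k, u)" "y = abs_Uf (k, v)"
proof -
  obtain k u where "x = abs_Uf (k, u)" by (rule Uf_cases)
  moreover obtain l v where "y = abs_Uf (l, v)" by (rule Uf_cases)
  moreover have "abs_Uf (k, u) = abs_Uf (k + l, uf ^ l * u)"
    "abs_Uf (l, v) = abs_Uf (k + l, uf ^ k * v)"
    by (rule Uf_eqI[where m = 0]; simp add: pow_pow_mult ac_simps)+
  ultimately show ?thesis using that by blast
qed

lemma Uf_add_eq: "abs_Uf (k, u) + abs_Uf (k, v) = abs_Uf (k, u + v)"
proof -
  have "abs_Uf (k, u) + abs_Uf (k, v) = abs_Uf (k + k, uf ^ k * (u + v))"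
    by (simp add: plus_Uf.abs_eq distrib_left)
  also have "\<dots> = abs_Uf (k, u + v)"
    by (rule Uf_eqI[where m = 0]) (simp add: pow_pow_mult)
  finally show ?thesis .
qed

instance
proof
  fix x y z :: Uf
  obtain k u where x: "x = abs_Uf (k, u)" by (rule Uf_cases)
  obtain l v where y: "y = abs_Uf (l, v)" by (rule Uf_cases)
  obtain p w where z: "z = abs_Uf (p, w)" by (rule Uf_cases)
  show "x + y + z = x + (y + z)"
    unfolding x y z plus_Uf.abs_eq prod.case
    by (rule arg_cong[where f = abs_Uf]) (simp add: distrib_left pow_pow_mult ac_simps)
  show "x + y = y + x"
    unfolding x y plus_Uf.abs_eq prod.case
    by (rule arg_cong[where f = abs_Uf]) (simp add: ac_simps)
  show "0 + x = x"
    unfolding x zero_Uf.abs_eq plus_Uf.abs_eq by simp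
  show "- x + x = 0"
    unfolding x zero_Uf.abs_eq uminus_Uf.abs_eq prod.case Uf_add_eq
    by (rule Uf_eqI[where m = 0]) simp
  show "x - y = x + - y" by (rule minus_Uf_def)
  show "1 * x = x"
    unfolding x one_Uf.abs_eq by (subst Uf_times_eq[where m = k and w = 1]) simp_all
  show "x * 1 = x"
    unfolding x one_Uf.abs_eq by (subst Uf_times_eq[where m = 0 and w = u]) simp_all
  show "x * y * z = x * (y * z)"
  proof -
    obtain m a where a: "uf ^ m * u = a * uf ^ l" using f_ore by blast
    obtain q b where b: "uf ^ q * v = b * uf ^ p" using f_ore by blast
    obtain r c where c: "uf ^ r * a = c * uf ^ q" using f_ore by blast
    have "uf ^ r * (a * v) = (c * b) * uf ^ p"
      by (simp only: mult.assoc[symmetric] c) (simp only: mult.assoc b)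
    then have 1: "x * y * z = abs_Uf (k + m + r, c * b * w)"
      unfolding x y z Uf_times_eq[OF a] by (rule Uf_times_eq)
    have "uf ^ (r + m) * u = uf ^ r * (uf ^ m * u)" by (simp add: pow_pow_mult)
    also have "\<dots> = c * uf ^ q * uf ^ l" unfolding a by (simp only: mult.assoc[symmetric] c)
    finally have "uf ^ (r + m) * u = c * uf ^ (l + q)"
      by (simp add: mult.assoc power_add[symmetric] add.commute)
    then have "x * (y * z) = abs_Uf (k + (r + m), c * (b * w))"
      unfolding x y z Uf_times_eq[OF b] by (rule Uf_times_eq)
    then show ?thesis unfolding 1 by (simp add: ac_simps)
  qed
  show "(x + y) * z = x * z + y * z"
  proof -
    obtain k u v where x: "x = abs_Uf (k, u)" and y: "y = abs_Uf (k, v)"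
      by (rule Uf_common_denominator)
    obtain m a where a: "uf ^ m * u = a * uf ^ p" using f_ore by blast
    obtain n b where b: "uf ^ n * v = b * uf ^ p" using f_ore by blast
    have a': "uf ^ (n + m) * u = (uf ^ n * a) * uf ^ p"
      by (simp add: a mult.assoc power_add)
    have b': "uf ^ (n + m) * v = (uf ^ m * b) * uf ^ p"
      by (subst add.commute) (simp add: b mult.assoc power_add)
    have ab': "uf ^ (n + m) * (u + v) = (uf ^ n * a + uf ^ m * b) * uf ^ p"
      by (simp only: distrib_left distrib_right a' b')
    show ?thesis
      unfolding x y z Uf_add_eq Uf_times_eq[OF a'] Uf_times_eq[OF b'] Uf_times_eq[OF ab']
      by (simp add: distrib_right)
  qed
  show "x * (y + z) = x * y + x * z"
  proof -
    obtain l v w where y: "y = abs_Uf (l, v)" and z: "z = abs_Uf (l, w)"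
      by (rule Uf_common_denominator)
    obtain m a where a: "uf ^ m * u = a * uf ^ l" using f_ore by blast
    show ?thesis
      unfolding x y z Uf_add_eq Uf_times_eq[OF a] by (simp add: distrib_left)
  qed
qed

end

lift_definition Uf_of :: "U \<Rightarrow> Uf" is "\<lambda>u. (0, u)" .

lemma Uf_of_add: "Uf_of (u + v) = Uf_of u + Uf_of v"
  by (simp add: Uf_of.abs_eq Uf_add_eq)

lemma Uf_of_mult: "Uf_of (u * v) = Uf_of u * Uf_of v"
  by (simp add: Uf_of.abs_eq Uf_times_eq[where m = 0 and w = u])

lemma Uf_of_one: "Uf_of 1 = 1"
  by (simp add: Uf_of.abs_eq one_Uf.abs_eq)

lemma Uf_of_zero: "Uf_of 0 = 0"
  by (simp add: Uf_of.abs_eq zero_Uf.abs_eq)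

lemma Uf_of_uminus: "Uf_of (- u) = - Uf_of u"
  by (simp add: Uf_of.abs_eq uminus_Uf.abs_eq)

lemma Uf_of_diff: "Uf_of (u - v) = Uf_of u - Uf_of v"
  using Uf_of_add[of u "- v"] by (simp add: Uf_of_uminus)

lemma Uf_of_f_invertible: "Uf_of uf * abs_Uf (1, 1) = 1" "abs_Uf (1, 1) * Uf_of uf = 1"
proof -
  show "Uf_of uf * abs_Uf (1, 1) = 1"
    by (simp add: Uf_of.abs_eq one_Uf.abs_eq Uf_times_eq[where m = 0 and w = 1])
  show "abs_Uf (1, 1) * Uf_of uf = 1"
    by (simp add: Uf_of.abs_eq Uf_times_eq[where m = 0 and w = 1] one_Uf.abs_eq)
      (rule Uf_eqI[where m = 0], simp)
qed

definition Sf_rel :: "Uf \<Rightarrow> Uf \<Rightarrow> bool" where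
  "Sf_rel x y \<longleftrightarrow> x - y \<in> range Uf_of"

lemma range_Uf_of:
  "x \<in> range Uf_of \<Longrightarrow> y \<in> range Uf_of \<Longrightarrow> x + y \<in> range Uf_of"
  "x \<in> range Uf_of \<Longrightarrow> y \<in> range Uf_of \<Longrightarrow> x - y \<in> range Uf_of"
  "x \<in> range Uf_of \<Longrightarrow> - x \<in> range Uf_of"
  "x \<in> range Uf_of \<Longrightarrow> Uf_of u * x \<in> range Uf_of"
  "x \<in> range Uf_of \<Longrightarrow> x * Uf_of u \<in> range Uf_of"
  by (auto simp: Uf_of_add[symmetric] Uf_of_diff[symmetric] Uf_of_uminus[symmetric]
      Uf_of_mult[symmetric])

quotient_type Sf = Uf / Sf_rel
proof (rule equivpI)
  show "reflp Sf_rel"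
    by (rule reflpI) (simp add: Sf_rel_def, metis Uf_of_zero rangeI)
  show "symp Sf_rel"
  proof (rule sympI)
    fix x y assume "Sf_rel x y"
    then show "Sf_rel y x" using range_Uf_of(3)[of "x - y"] by (simp add: Sf_rel_def)
  qed
  show "transp Sf_rel"
  proof (rule transpI)
    fix x y z assume "Sf_rel x y" "Sf_rel y z"
    then show "Sf_rel x z" using range_Uf_of(1)[of "x - y" "y - z"] by (simp add: Sf_rel_def)
  qed
qed

instantiation Sf :: ab_group_add
begin

lift_definition zero_Sf :: Sf is 0 .
lift_definition plus_Sf :: "Sf \<Rightarrow> Sf \<Rightarrow> Sf" is "(+)"
  unfolding Sf_rel_def by (drule (1) range_Uf_of(1)) (simp add: algebra_simps)
lift_definition minus_Sf :: "Sf \<Rightarrow> Sf \<Rightarrow> Sf" is "(-)"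
  unfolding Sf_rel_def by (drule (1) range_Uf_of(2)) (simp add: algebra_simps)
lift_definition uminus_Sf :: "Sf \<Rightarrow> Sf" is uminus
  unfolding Sf_rel_def by (drule range_Uf_of(3)) simp

instance
proof -
  have refl: "Sf_rel x x" for x
    by (simp add: Sf_rel_def) (metis Uf_of_zero rangeI)
  show "OFCLASS(Sf, ab_group_add_class)"
    by standard (transfer; simp add: algebra_simps refl)+
qed

end

lift_definition Sf_left :: "U \<Rightarrow> Sf \<Rightarrow> Sf" is "\<lambda>u x. Uf_of u * x"
  unfolding Sf_rel_def right_diff_distrib[symmetric] by (rule range_Uf_of(4))

lift_definition Sf_right :: "Sf \<Rightarrow> U \<Rightarrow> Sf" is "\<lambda>x u. x * Uf_of u"
  unfolding Sf_rel_def left_diff_distrib[symmetric] by (rule range_Uf_of(5))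

section \<open>Left modules and tensor products\<close>

record ('r, 'm) left_module =
  mcarrier :: "'m set"
  mzero :: 'm
  madd :: "'m \<Rightarrow> 'm \<Rightarrow> 'm"
  mact :: "'r \<Rightarrow> 'm \<Rightarrow> 'm"

definition is_left_module :: "('r::ring_1, 'm) left_module \<Rightarrow> bool" where
  "is_left_module M \<longleftrightarrow>
     mzero M \<in> mcarrier M \<and>
     (\<forall>x\<in>mcarrier M. \<forall>y\<in>mcarrier M. madd M x y \<in> mcarrier M) \<and>
     (\<forall>r. \<forall>x\<in>mcarrier M. mact M r x \<in> mcarrier M) \<and>
     (\<forall>x\<in>mcarrier M. \<forall>y\<in>mcarrier M. \<forall>z\<in>mcarrier M.
        madd M (madd M x y) z = madd M x (madd M y z)) \<and>
     (\<forall>x\<in>mcarrier M. \<forall>y\<in>mcarrier M. madd M x y = madd M y x) \<and>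
     (\<forall>x\<in>mcarrier M. madd M (mzero M) x = x) \<and>
     (\<forall>x\<in>mcarrier M. \<exists>y\<in>mcarrier M. madd M x y = mzero M) \<and>
     (\<forall>r. \<forall>x\<in>mcarrier M. \<forall>y\<in>mcarrier M. mact M r (madd M x y) = madd M (mact M r x) (mact M r y)) \<and>
     (\<forall>r s. \<forall>x\<in>mcarrier M. mact M (r + s) x = madd M (mact M r x) (mact M s x)) \<and>
     (\<forall>r s. \<forall>x\<in>mcarrier M. mact M (r * s) x = mact M r (mact M s x)) \<and>
     (\<forall>x\<in>mcarrier M. mact M 1 x = x)"

definition annihilator :: "('r, 'm) left_module \<Rightarrow> 'r set" where
  "annihilator M = {r. \<forall>x\<in>mcarrier M. mact M r x = mzero M}"

text \<open>The tensor product \<open>A \<otimes>\<^sub>R M\<close> of an \<open>S\<close>-\<open>R\<close>-bimodule \<open>A\<close> (with actions \<open>la\<close>, \<open>ra\<close>) and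
  a left \<open>R\<close>-module \<open>M\<close>: the free abelian group on \<open>A \<times> M\<close> modulo the balancing relations.
  The elements are cosets, and their sum is the elementwise sum of sets.\<close>

definition tensor_relations ::
  "('a::ab_group_add \<Rightarrow> 'r \<Rightarrow> 'a) \<Rightarrow> ('r, 'm) left_module \<Rightarrow> ('a \<times> 'm \<Rightarrow>\<^sub>0 int) set" where
  "tensor_relations ra M = add_span (
     {frag_of (a + b, x) - frag_of (a, x) - frag_of (b, x) | a b x. x \<in> mcarrier M} \<union>
     {frag_of (a, madd M x y) - frag_of (a, x) - frag_of (a, y) | a x y.
        x \<in> mcarrier M \<and> y \<in> mcarrier M} \<union>
     {frag_of (ra a r, x) - frag_of (a, mact M r x) | a r x. x \<in> mcarrier M})"

definition tensor_lmul ::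
  "('s \<Rightarrow> 'a \<Rightarrow> 'a) \<Rightarrow> 's \<Rightarrow> ('a \<times> 'm \<Rightarrow>\<^sub>0 int) \<Rightarrow> ('a \<times> 'm \<Rightarrow>\<^sub>0 int)" where
  "tensor_lmul la s = frag_extend (\<lambda>(a, x). frag_of (la s a, x))"

definition tensor ::
  "('s \<Rightarrow> 'a \<Rightarrow> 'a) \<Rightarrow> ('a::ab_group_add \<Rightarrow> 'r \<Rightarrow> 'a) \<Rightarrow> ('r, 'm) left_module
     \<Rightarrow> ('s, ('a \<times> 'm \<Rightarrow>\<^sub>0 int) set) left_module" where
  "tensor la ra M = \<lparr>
     mcarrier = {p +o tensor_relations ra M | p. Poly_Mapping.keys p \<subseteq> UNIV \<times> mcarrier M},
     mzero = tensor_relations ra M,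
     madd = (+),
     mact = (\<lambda>s X. \<Union>p\<in>X. tensor_lmul la s p +o tensor_relations ra M)\<rparr>"

lemma mem_coset: "p \<in> p +o add_span R"
  using set_plus_intro2[OF add_span.zero, of p R] by simp

lemma coset_eq_iff: "p +o add_span R = q +o add_span R \<longleftrightarrow> p - q \<in> add_span R"
proof
  assume "p +o add_span R = q +o add_span R"
  moreover have "p \<in> p +o add_span R" by (rule mem_coset)
  ultimately obtain r where "r \<in> add_span R" "p = q + r" by (auto simp: elt_set_plus_def)
  then show "p - q \<in> add_span R" by simp
next
  assume a: "p - q \<in> add_span R"
  show "p +o add_span R = q +o add_span R"
  proof (intro set_eqI iffI)
    fix x assume "x \<in> p +o add_span R"
    then obtain r where "r \<in> add_span R" "x = p + r" by (auto simp: elt_set_plus_def)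
    then have "x = q + ((p - q) + r)" "(p - q) + r \<in> add_span R"
      using add_span_add[OF a] by auto
    then show "x \<in> q +o add_span R" by (metis set_plus_intro2)
  next
    fix x assume "x \<in> q +o add_span R"
    then obtain r where "r \<in> add_span R" "x = q + r" by (auto simp: elt_set_plus_def)
    then have "x = p + (r - (p - q))" "r - (p - q) \<in> add_span R"
      using add_span.diff[OF _ a] by auto
    then show "x \<in> p +o add_span R" by (metis set_plus_intro2)
  qed
qed

lemma coset_add: "(p +o add_span R) + (q +o add_span R) = (p + q) +o add_span R"
proof (intro set_eqI iffI)
  fix x assume "x \<in> (p +o add_span R) + (q +o add_span R)"
  then obtain r s where "r \<in> add_span R" "s \<in> add_span R" "x = (p + r) + (q + s)"
    by (auto simp: elt_set_plus_def set_plus_def)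
  then have "x = (p + q) + (r + s)" "r + s \<in> add_span R" by (auto intro: add_span_add)
  then show "x \<in> (p + q) +o add_span R" by (metis set_plus_intro2)
next
  fix x assume "x \<in> (p + q) +o add_span R"
  then obtain r where "r \<in> add_span R" "x = p + q + r" by (auto simp: elt_set_plus_def)
  then have "x = (p + r) + (q + 0)" "p + r \<in> p +o add_span R" "q + 0 \<in> q +o add_span R"
    by (auto intro: mem_coset)
  then show "x \<in> (p +o add_span R) + (q +o add_span R)" by (metis set_plus_intro)
qed

lemma tensor_is_left_module:
  fixes la :: "'s::ring_1 \<Rightarrow> 'a::ab_group_add \<Rightarrow> 'a" and M :: "('r, 'm) left_module"
  assumes la_add: "\<And>s a b. la s (a + b) = la s a + la s b"
    and la_add_left: "\<And>s t a. la (s + t) a = la s a + la t a"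
    and la_mult: "\<And>s t a. la (s * t) a = la s (la t a)"
    and la_one: "\<And>a. la 1 a = a"
    and la_ra: "\<And>s a r. la s (ra a r) = ra (la s a) r"
  shows "is_left_module (tensor la ra M)"
    and "mact (tensor la ra M) s (p +o tensor_relations ra M) =
      tensor_lmul la s p +o tensor_relations ra M"
proof -
  let ?N = "tensor_relations ra M"
  let ?F = "{p. Poly_Mapping.keys p \<subseteq> UNIV \<times> mcarrier M} :: ('a \<times> 'm \<Rightarrow>\<^sub>0 int) set"
  obtain R where R: "?N = add_span R" by (simp add: tensor_relations_def)
  have diff: "tensor_lmul la s (p - q) = tensor_lmul la s p - tensor_lmul la s q" for s p q
    by (simp add: tensor_lmul_def frag_extend_diff)
  have add: "tensor_lmul la s (p + q) = tensor_lmul la s p + tensor_lmul la s q" for s p q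
    by (simp add: tensor_lmul_def frag_extend_add)
  have of: "tensor_lmul la s (frag_of (a, x)) = frag_of (la s a, x)" for s a x
    by (simp add: tensor_lmul_def)
  have N: "tensor_lmul la s p \<in> ?N" if "p \<in> ?N" for s p
    using that unfolding tensor_relations_def
  proof (rule add_span_map)
    fix p assume "p \<in> {frag_of (a + b, x) - frag_of (a, x) - frag_of (b, x) | a b x. x \<in> mcarrier M} \<union>
     {frag_of (a, madd M x y) - frag_of (a, x) - frag_of (a, y) | a x y.
        x \<in> mcarrier M \<and> y \<in> mcarrier M} \<union>
     {frag_of (ra a r, x) - frag_of (a, mact M r x) | a r x. x \<in> mcarrier M}"
    then show "tensor_lmul la s p \<in> add_span ({frag_of (a + b, x) - frag_of (a, x) - frag_of (b, x) | a b x. x \<in> mcarrier M} \<union>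
     {frag_of (a, madd M x y) - frag_of (a, x) - frag_of (a, y) | a x y.
        x \<in> mcarrier M \<and> y \<in> mcarrier M} \<union>
     {frag_of (ra a r, x) - frag_of (a, mact M r x) | a r x. x \<in> mcarrier M})"
      by (intro add_span.base) (auto simp: diff of la_add la_ra; blast)
  qed (simp_all add: diff, simp add: tensor_lmul_def)
  have act: "mact (tensor la ra M) s (p +o ?N) = tensor_lmul la s p +o ?N" for s p
  proof -
    have "tensor_lmul la s q +o ?N = tensor_lmul la s p +o ?N" if "q \<in> p +o ?N" for q
    proof -
      from that have "q - p \<in> ?N" by (auto simp: elt_set_plus_def)
      then show ?thesis using N[of "q - p" s] unfolding R coset_eq_iff by (simp add: diff)
    qed
    moreover have "p \<in> p +o ?N" unfolding R by (rule mem_coset)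
    ultimately have "(\<Union>q\<in>p +o ?N. tensor_lmul la s q +o ?N) = tensor_lmul la s p +o ?N"
      by (metis (no_types, lifting) SUP_eq_const equals0D)
    then show ?thesis by (simp add: tensor_def)
  qed
  show "mact (tensor la ra M) s (p +o ?N) = tensor_lmul la s p +o ?N" by (rule act)
  have car: "mcarrier (tensor la ra M) = (\<lambda>p. p +o ?N) ` ?F"
    by (auto simp: tensor_def)
  have madd: "madd (tensor la ra M) (p +o ?N) (q +o ?N) = (p + q) +o ?N" for p q
    by (simp add: tensor_def R coset_add)
  have zero: "mzero (tensor la ra M) = 0 +o ?N"
    by (simp add: tensor_def)
  have F: "0 \<in> ?F" "\<And>p q. p \<in> ?F \<Longrightarrow> q \<in> ?F \<Longrightarrow> p + q \<in> ?F" "\<And>p. p \<in> ?F \<Longrightarrow> - p \<in> ?F"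
    by (auto dest!: subsetD[OF keys_add])
  have Flm: "tensor_lmul la s p \<in> ?F" if "p \<in> ?F" for s p
    using that keys_frag_extend[of "\<lambda>(a, x). frag_of (la s a, x)" p]
    by (fastforce simp: tensor_lmul_def split: if_splits)
  have 1: "tensor_lmul la 1 p = p" for p :: "'a \<times> 'm \<Rightarrow>\<^sub>0 int"
  proof -
    have "(\<lambda>(a, x). frag_of (la 1 a, x)) = (frag_of :: 'a \<times> 'm \<Rightarrow> _)" by (auto simp: la_one)
    then show ?thesis by (metis tensor_lmul_def frag_expansion)
  qed
  have 2: "tensor_lmul la (s * t) p = tensor_lmul la s (tensor_lmul la t p)" for s t and p :: "'a \<times> 'm \<Rightarrow>\<^sub>0 int"
    by (rule frag_induction[of p UNIV]) (auto simp: of diff la_mult, simp add: tensor_lmul_def)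
  have 3: "tensor_lmul la (s + t) p - (tensor_lmul la s p + tensor_lmul la t p) \<in> ?N" if "p \<in> ?F" for s t p
  proof (rule frag_induction[of p "UNIV \<times> mcarrier M"])
    show "tensor_lmul la (s + t) 0 - (tensor_lmul la s 0 + tensor_lmul la t 0) \<in> ?N"
      by (simp add: tensor_lmul_def R add_span.zero)
    show "tensor_lmul la (s + t) (frag_of y) - (tensor_lmul la s (frag_of y) + tensor_lmul la t (frag_of y)) \<in> ?N"
      if "y \<in> UNIV \<times> mcarrier M" for y
      using that unfolding tensor_relations_def
      by (intro add_span.base) (auto simp: of la_add_left diff_diff_eq)
  next
    fix a b
    assume "tensor_lmul la (s + t) a - (tensor_lmul la s a + tensor_lmul la t a) \<in> ?N"
      "tensor_lmul la (s + t) b - (tensor_lmul la s b + tensor_lmul la t b) \<in> ?N"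
    then have "(tensor_lmul la (s + t) a - (tensor_lmul la s a + tensor_lmul la t a)) -
      (tensor_lmul la (s + t) b - (tensor_lmul la s b + tensor_lmul la t b)) \<in> ?N"
      unfolding R by (rule add_span.diff)
    then show "tensor_lmul la (s + t) (a - b) - (tensor_lmul la s (a - b) + tensor_lmul la t (a - b)) \<in> ?N"
      by (simp add: diff algebra_simps)
  qed (use that in simp)
  have 4: "tensor_lmul la (s + t) p +o ?N = (tensor_lmul la s p + tensor_lmul la t p) +o ?N" if "p \<in> ?F" for s t p
    using 3[OF that] unfolding R coset_eq_iff .
  have inv: "\<exists>q\<in>?F. (p + q) +o ?N = 0 +o ?N" if "p \<in> ?F" for p
    by (rule bexI[OF _ F(3)[OF that]]) simp
  define F where "F = ?F"
  note fold = F_def[symmetric]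
  note F' = F[unfolded fold] and Flm' = Flm[unfolded fold] and lin = 4[unfolded fold]
    and inv' = inv[unfolded fold]
  show "is_left_module (tensor la ra M)"
    unfolding is_left_module_def car zero ball_simps bex_simps madd act fold
  proof (intro conjI allI ballI)
    show "\<exists>q\<in>F. (p + q) +o ?N = 0 +o ?N" if "p \<in> F" for p
      by (rule inv'[OF that])
    show "0 +o ?N \<in> (\<lambda>p. p +o ?N) ` F"
      by (rule imageI) (rule F')
  qed (simp_all add: F' Flm' lin add 1 2 ac_simps)
qed

section \<open>Verma modules and the completion functor\<close>

definition weight_module :: "complex \<Rightarrow> complex \<Rightarrow> (borel uea, complex) left_module" where
  "weight_module \<mu> \<nu> = \<lparr>mcarrier = UNIV, mzero = 0, madd = (+),
     mact = (\<lambda>b z. uea_lift (borel_weight \<mu> \<nu>) b * z)\<rparr>"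

definition Verma :: "complex \<Rightarrow> complex \<Rightarrow> (U, (U \<times> complex \<Rightarrow>\<^sub>0 int) set) left_module" where
  "Verma \<mu> \<nu> = tensor (*) (\<lambda>u b. u * borel_incl b) (weight_module \<mu> \<nu>)"

inductive_set complex_span ::
  "('r::complex_algebra_1, 'm) left_module \<Rightarrow> 'm set \<Rightarrow> 'm set" for M B where
  zero: "mzero M \<in> complex_span M B"
| base: "x \<in> B \<Longrightarrow> x \<in> complex_span M B"
| add: "x \<in> complex_span M B \<Longrightarrow> y \<in> complex_span M B \<Longrightarrow> madd M x y \<in> complex_span M B"
| scale: "x \<in> complex_span M B \<Longrightarrow> mact M (of_cx c) x \<in> complex_span M B"

definition finite_dimensional :: "('r::complex_algebra_1, 'm) left_module \<Rightarrow> 'm set \<Rightarrow> bool" where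
  "finite_dimensional M W \<longleftrightarrow> (\<exists>B. finite B \<and> W = complex_span M B)"

definition polynomials_in :: "'r::complex_algebra_1 \<Rightarrow> 'r set" where
  "polynomials_in r = {\<Sum>i<n. of_cx (c i) * r ^ i | n c. True}"

definition Sf_tensor :: "(U, 'm) left_module \<Rightarrow> (U, (Sf \<times> 'm \<Rightarrow>\<^sub>0 int) set) left_module" where
  "Sf_tensor M = tensor Sf_left Sf_right M"

definition EA :: "(U, 'm) left_module \<Rightarrow> (U, (Sf \<times> 'm \<Rightarrow>\<^sub>0 int) set) left_module" where
  "EA M = (Sf_tensor M)\<lparr>mcarrier := {x \<in> mcarrier (Sf_tensor M).
     finite_dimensional (Sf_tensor M) {mact (Sf_tensor M) p x | p. p \<in> polynomials_in ue}}\<rparr>"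

definition V_module ::
  "int \<Rightarrow> complex \<Rightarrow> (U, (Sf \<times> (U \<times> complex \<Rightarrow>\<^sub>0 int) set \<Rightarrow>\<^sub>0 int) set) left_module" where
  "V_module n \<nu> = EA (Verma (of_int (n - 2)) \<nu>)"

lemma Verma_is_left_module: "is_left_module (Verma \<mu> \<nu>)"
  unfolding Verma_def by (rule tensor_is_left_module) (simp_all add: algebra_simps)

lemma Sf_tensor_is_left_module: "is_left_module (Sf_tensor M)"
proof -
  have refl: "Sf_rel x x" for x
    by (simp add: Sf_rel_def) (metis Uf_of_zero rangeI)
  show ?thesis
    unfolding Sf_tensor_def
    by (rule tensor_is_left_module;
        transfer; simp add: Uf_of_add Uf_of_mult Uf_of_one algebra_simps refl)
qed

section \<open>The center and its characters\<close>

definition center :: "'a::ring_1 set" where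
  "center = {z. \<forall>x. z * x = x * z}"

definition casimir :: U where
  "casimir = uh_bar * uh + 2 * uf_bar * ue + 2 * ue_bar * uf"

definition casimir_bar :: U where
  "casimir_bar = uh_bar ^ 2 + 4 * uf_bar * ue_bar"

text \<open>Only the restriction of \<open>\<chi>\<close> to the center matters; the clause for \<open>of_cx\<close> makes it unital
  and, together with multiplicativity, complex linear.\<close>

definition central_character :: "complex \<Rightarrow> complex \<Rightarrow> (U \<Rightarrow> complex) \<Rightarrow> bool" where
  "central_character a b \<chi> \<longleftrightarrow>
     (\<forall>z\<in>center. \<forall>w\<in>center. \<chi> (z + w) = \<chi> z + \<chi> w \<and> \<chi> (z * w) = \<chi> z * \<chi> w) \<and>
     (\<forall>c. \<chi> (of_cx c) = c) \<and>
     \<chi> casimir = a \<and> \<chi> casimir_bar = b"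

definition central_kernel :: "(U \<Rightarrow> complex) \<Rightarrow> U set" where
  "central_kernel \<chi> = {z \<in> center. \<chi> z = 0}"

definition left_ideal :: "'a::ring_1 set \<Rightarrow> 'a set" where
  "left_ideal K = add_span {u * z | u z. z \<in> K}"

definition centrally_generated :: "'a::ring_1 set \<Rightarrow> bool" where
  "centrally_generated I \<longleftrightarrow> I = two_sided_ideal (I \<inter> center)"

end

theory Submission
  imports Defs "HOL-Computational_Algebra.Polynomial"
begin

text \<open>The algebra \<open>U\<close> is spanned over \<open>\<complex>[C, C_bar]\<close> by the normal monomials
  \<open>f_bar^p f^i h^k h_bar^\<epsilon> e^q\<close> and \<open>f_bar^p e_bar^i h^k h_bar^\<epsilon> e^q\<close> with \<open>\<epsilon> \<in> {0, 1}\<close>: modulo shorter words,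
  \<open>C_bar\<close> eliminates \<open>h_bar^2\<close> and \<open>C\<close> eliminates \<open>e_bar f\<close>. On \<open>V(n, \<nu>)\<close> the center acts through \<open>\<chi>\<close>, so all
  claims follow once the normal monomials are shown to act linearly independently on \<open>V(n, \<nu>)\<close>.

  The module \<open>S_f \<otimes> \<Delta>\<close> is \<open>\<complex>[x, 1/x, y] / \<complex>[x, y]\<close> with an action by differential operators, and \<open>V(n, \<nu>)\<close>
  contains the vectors \<open>y^a v_d\<close>, where \<open>v_d\<close> is the highest weight vector of total degree \<open>- d\<close> and has top
  \<open>y\<close>-exponent \<open>d + n - 1\<close>. So in each total degree \<open>- r\<close> there are vectors of arbitrarily large top \<open>y\<close>-exponent
  \<open>m\<close>. A normal monomial shifts \<open>r\<close> and \<open>m\<close> and multiplies the leading coefficient by a polynomial in \<open>m\<close>; the two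
  shifts, the degree of this polynomial and the degree in \<open>r\<close> of its leading coefficient determine the monomial.

  For central \<open>z\<close>, which acts by a scalar on every \<open>V(n, \<nu>)\<close>, the same independence for varying \<open>n\<close> and \<open>\<nu>\<close>
  leaves only the trivial monomial, so \<open>z\<close> is a polynomial in \<open>C\<close> and \<open>C_bar\<close> and \<open>\<chi>\<close> is determined by its
  values on these generators.\<close>

section \<open>Linear combinations in the enveloping algebra\<close>

lemma of_cx_numeral: "of_cx (numeral k) = (numeral k :: 'a::complex_algebra_1)"
proof -
  have "of_cx (of_nat n) = (of_nat n :: 'a)" for n
    by (induction n) (simp_all add: of_cx_add of_cx_one)
  from this[of "numeral k"] show ?thesis by simp
qed

interpretation cx: vector_space "\<lambda>c u. of_cx c * (u :: 'a::complex_algebra_1)"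
  by standard (simp_all add: algebra_simps of_cx_add of_cx_mult of_cx_one)

lemma of_cx_sum: "of_cx (sum f A) = (\<Sum>i\<in>A. of_cx (f i))"
  by (induction A rule: infinite_finite_induct) (simp_all add: of_cx_add)

lemma of_cx_left_commute: "x * (of_cx c * y) = of_cx c * (x * (y :: 'a::complex_algebra_1))"
  by (metis mult.assoc of_cx_central)

lemma span_mult_left:
  assumes "x \<in> cx.span A" "\<And>y. y \<in> A \<Longrightarrow> g * y \<in> cx.span B"
  shows "g * x \<in> cx.span B"
  using assms(1)
proof (induction rule: cx.span_induct_alt)
  case (step c x y)
  then show ?case using assms(2)
    by (simp add: distrib_left of_cx_left_commute cx.span_add cx.span_scale)
qed (simp add: cx.span_zero)

lemma span_mult_right:
  assumes "x \<in> cx.span A" "\<And>y. y \<in> A \<Longrightarrow> y * g \<in> cx.span B"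
  shows "x * g \<in> cx.span B"
  using assms(1)
proof (induction rule: cx.span_induct_alt)
  case (step c x y)
  then show ?case using assms(2)
    by (simp add: distrib_right mult.assoc cx.span_add cx.span_scale)
qed (simp add: cx.span_zero)

section \<open>Commutation relations and the central elements\<close>

lemma uea_of_takiff:
  "uea_of (Takiff (Sl2 a b c) (Sl2 a' b' c')) =
     of_cx a * uf + of_cx b * uh + of_cx c * ue + of_cx a' * uf_bar + of_cx b' * uh_bar + of_cx c' * ue_bar"
proof -
  have "Takiff (Sl2 a b c) (Sl2 a' b' c') =
     cscale a tf + cscale b th + cscale c te + cscale a' tf_bar + cscale b' th_bar + cscale c' te_bar"
    by (simp add: takiff_defs sl2_defs)
  then show ?thesis by (simp only: uea_of_add uea_of_cscale)
qed

text \<open>Oriented as rewrite rules towards the order \<open>uf_bar\<close>, \<open>uf\<close>,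
  \<open>ue_bar\<close>, \<open>uh\<close>, \<open>uh_bar\<close>, \<open>ue\<close>, in which
  \<open>normal_mon\<close> lists its factors.\<close>

lemma uea_of_brackets:
  "ue * uf = uf * ue + uh" "uh * uf = uf * uh - 2 * uf" "ue * uh = uh * ue - 2 * ue"
  "ue_bar * uf = uf * ue_bar + uh_bar" "uh_bar * uf = uf * uh_bar - 2 * uf_bar" "uf * uf_bar = uf_bar * uf"
  "ue * uf_bar = uf_bar * ue + uh_bar" "uh * uf_bar = uf_bar * uh - 2 * uf_bar" "ue * uh_bar = uh_bar * ue - 2 * ue_bar"
  "ue_bar * uf_bar = uf_bar * ue_bar" "uh_bar * uf_bar = uf_bar * uh_bar" "uh_bar * ue_bar = ue_bar * uh_bar"
  "uh * ue_bar = ue_bar * uh + 2 * ue_bar" "uh_bar * uh = uh * uh_bar" "ue * ue_bar = ue_bar * ue"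
proof -
  have *: "uea_of x * uea_of y = uea_of y * uea_of x + uea_of (bracket x y)" for x y :: T
    by (simp add: uea_of_bracket)
  have b: "bracket te tf = th" "bracket th tf = cscale (-2) tf" "bracket te th = cscale (-2) te"
    "bracket te_bar tf = th_bar" "bracket th_bar tf = cscale (-2) tf_bar" "bracket tf tf_bar = cscale 0 tf"
    "bracket te tf_bar = th_bar" "bracket th tf_bar = cscale (-2) tf_bar" "bracket te th_bar = cscale (-2) te_bar"
    "bracket te_bar tf_bar = cscale 0 tf" "bracket th_bar tf_bar = cscale 0 tf" "bracket th_bar te_bar = cscale 0 tf"
    "bracket th te_bar = cscale 2 te_bar" "bracket th_bar th = cscale 0 tf" "bracket te te_bar = cscale 0 tf"
    by (simp_all add: takiff_defs sl2_defs)
  show "ue * uf = uf * ue + uh" "uh * uf = uf * uh - 2 * uf" "ue * uh = uh * ue - 2 * ue"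
  "ue_bar * uf = uf * ue_bar + uh_bar" "uh_bar * uf = uf * uh_bar - 2 * uf_bar" "uf * uf_bar = uf_bar * uf"
  "ue * uf_bar = uf_bar * ue + uh_bar" "uh * uf_bar = uf_bar * uh - 2 * uf_bar" "ue * uh_bar = uh_bar * ue - 2 * ue_bar"
  "ue_bar * uf_bar = uf_bar * ue_bar" "uh_bar * uf_bar = uf_bar * uh_bar" "uh_bar * ue_bar = ue_bar * uh_bar"
  "uh * ue_bar = ue_bar * uh + 2 * ue_bar" "uh_bar * uh = uh * uh_bar" "ue * ue_bar = ue_bar * ue"
    by - (rule trans[OF *], simp add: b uea_of_cscale of_cx_numeral of_cx_uminus)+
qed

text \<open>The same rules with a factor appended on the right, so that they also apply inside
  right-nested products.\<close>

lemmas uea_of_brackets_assoc = uea_of_brackets[THEN arg_cong[where f = "\<lambda>u. u * x" for x],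
    unfolded distrib_right left_diff_distrib mult.assoc]

lemma casimir_eq: "casimir = uh_bar * uh + 2 * (uf_bar * ue) + 2 * (ue_bar * uf)"
  by (simp add: casimir_def mult.assoc)

lemma casimir_bar_eq: "casimir_bar = uh_bar * uh_bar + 4 * (uf_bar * ue_bar)"
  by (simp add: casimir_bar_def mult.assoc power2_eq_square)

lemma uea_of_numeral_commute:
  "uea_of x * (numeral k * y) = numeral k * (uea_of x * y)" "uea_of x * numeral k = numeral k * uea_of x"
  using of_cx_left_commute[of "uea_of x" "numeral k" y] of_cx_central[of "numeral k" "uea_of x"]
  by (simp_all add: of_cx_numeral)

lemma takiff_decompose:
  obtains a b c a' b' c' where "uea_of x =
     of_cx a * uf + of_cx b * uh + of_cx c * ue + of_cx a' * uf_bar + of_cx b' * uh_bar + of_cx c' * ue_bar"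
  using uea_of_takiff[of "f_coord (part0 x)" "h_coord (part0 x)" "e_coord (part0 x)"
      "f_coord (part1 x)" "h_coord (part1 x)" "e_coord (part1 x)"] that
  by simp

lemma centerI:
  assumes "\<And>x. x \<in> {uf, uh, ue, uf_bar, uh_bar, ue_bar} \<Longrightarrow> z * x = x * z"
  shows "z \<in> (center :: U set)"
proof -
  have "z * u = u * z" for u
  proof (induction u rule: uea_induct)
    case (gen x)
    obtain a b c a' b' c' where "uea_of x =
       of_cx a * uf + of_cx b * uh + of_cx c * ue + of_cx a' * uf_bar + of_cx b' * uh_bar + of_cx c' * ue_bar"
      by (rule takiff_decompose)
    then show ?case using assms by (simp add: distrib_left distrib_right of_cx_left_commute mult.assoc)
  next
    case (mult u v)
    then show ?case by (metis mult.assoc)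
  qed (simp_all add: distrib_left distrib_right of_cx_central)
  then show ?thesis by (simp add: center_def)
qed

lemma span_subset_span:
  "u \<in> cx.span A \<Longrightarrow> (\<And>y. y \<in> A \<Longrightarrow> y \<in> cx.span B) \<Longrightarrow> u \<in> cx.span B"
  using span_mult_left[of u A 1 B] by simp

lemma casimir_center: "casimir \<in> center" "casimir_bar \<in> center"
proof -
  have four: "4 * x = x + x + x + x" for x :: U
    using distrib_right[of 2 2 x] by (simp add: mult_2 add.assoc)
  show "casimir \<in> center" "casimir_bar \<in> center"
  by (rule centerI; elim insertE; simp add: casimir_eq casimir_bar_eq distrib_left distrib_right mult.assoc
      uea_of_numeral_commute uea_of_brackets uea_of_brackets_assoc left_diff_distrib right_diff_distrib
      mult_2 four)+
qed

lemma casimir_commute: "x * casimir = casimir * x" "x * casimir_bar = casimir_bar * x"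
  using casimir_center by (simp_all add: center_def)

section \<open>Normal monomials span over the center\<close>

datatype gen = F | H | E | Fb | Hb | Eb

fun gen_elt :: "gen \<Rightarrow> T" where
  "gen_elt F = tf" | "gen_elt H = th" | "gen_elt E = te"
| "gen_elt Fb = tf_bar" | "gen_elt Hb = th_bar" | "gen_elt Eb = te_bar"

abbreviation ug :: "gen \<Rightarrow> U" where "ug g \<equiv> uea_of (gen_elt g)"

definition word :: "gen list \<Rightarrow> U" where "word xs = prod_list (map ug xs)"

definition words :: "nat \<Rightarrow> U set" where "words n = cx.span {word xs | xs. length xs \<le> n}"

lemma word_simps [simp]: "word [] = 1" "word (x # xs) = ug x * word xs" "word (xs @ ys) = word xs * word ys"
  by (simp_all add: word_def)

lemma word_in_words: "length xs \<le> n \<Longrightarrow> word xs \<in> words n"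
  by (auto simp: words_def intro: cx.span_base)

lemma uea_of_in_span: "uea_of x \<in> cx.span (range ug)"
proof -
  obtain a b c a' b' c' where "uea_of x =
     of_cx a * ug F + of_cx b * ug H + of_cx c * ug E + of_cx a' * ug Fb + of_cx b' * ug Hb + of_cx c' * ug Eb"
    by (rule takiff_decompose) simp
  then show ?thesis by (simp only:) (intro cx.span_add cx.span_scale cx.span_base rangeI)
qed

lemma uea_of_mult_words:
  assumes "w \<in> words n"
  shows "uea_of x * w \<in> words (Suc n)"
  unfolding words_def
proof (rule span_mult_left)
  show "w \<in> cx.span {word xs | xs. length xs \<le> n}" using assms by (simp add: words_def)
  fix y assume "y \<in> {word xs | xs. length xs \<le> n}"
  then obtain xs where xs: "y = word xs" "length xs \<le> n" by blast
  show "uea_of x * y \<in> cx.span {word xs | xs. length xs \<le> Suc n}"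
  proof (rule span_mult_right[OF uea_of_in_span])
    fix g assume "g \<in> range ug"
    then obtain a where "g * y = word (a # xs)" using xs by auto
    then show "g * y \<in> cx.span {word xs | xs. length xs \<le> Suc n}"
      using xs by (intro cx.span_base) (metis (mono_tags, lifting) length_Cons mem_Collect_eq Suc_le_mono)
  qed
qed

text \<open>Moving a letter across \<open>us\<close> costs one bracket per letter passed, and a
  bracket is a combination of single letters; so the error has one letter fewer than the
  word.\<close>

lemma word_insert_diff: "word (us @ x # vs) - word (x # us @ vs) \<in> words (length us + length vs)"
proof (induction us)
  case Nil
  then show ?case by (simp add: words_def cx.span_zero)
next
  case (Cons u us)
  have "ug u * (word (us @ x # vs) - word (x # us @ vs)) \<in> words (Suc (length us + length vs))"
    by (rule uea_of_mult_words[OF Cons])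
  moreover have "uea_of (bracket (gen_elt u) (gen_elt x)) * word (us @ vs) \<in> words (Suc (length us + length vs))"
    by (rule uea_of_mult_words) (simp add: word_in_words del: word_simps)
  moreover have "word ((u # us) @ x # vs) - word (x # (u # us) @ vs) =
      ug u * (word (us @ x # vs) - word (x # us @ vs)) + uea_of (bracket (gen_elt u) (gen_elt x)) * word (us @ vs)"
    by (simp add: uea_of_bracket algebra_simps)
  ultimately show ?case by (simp add: words_def cx.span_add del: word_simps)
qed

text \<open>The associated graded algebra is commutative. Pulling the first letter of
  \<open>xs\<close> to the front of \<open>ys\<close> reduces the claim to the tails.\<close>

lemma word_mset_diff: "mset xs = mset ys \<Longrightarrow> word xs - word ys \<in> words (length xs - 1)"
proof (induction xs arbitrary: ys)
  case Nil
  then show ?case by (simp add: words_def cx.span_zero)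
next
  case (Cons x xs)
  then have "x \<in> set ys" by (metis list.set_intros(1) set_mset_mset)
  then obtain us vs where ys: "ys = us @ x # vs" by (meson split_list)
  with Cons.prems have ms: "mset xs = mset (us @ vs)" by simp
  then have len: "length xs = length us + length vs" by (metis length_append size_mset)
  have 1: "ug x * (word xs - word (us @ vs)) \<in> words (length xs)"
  \<comment> \<open>For empty \<open>xs\<close> the truncated \<open>length xs - 1\<close> would
    make the bound one too weak; there the difference itself is 0.\<close>
  proof (cases xs)
    case Nil
    then show ?thesis using ms by (simp add: words_def cx.span_zero)
  next
    case (Cons a as)
    then show ?thesis using uea_of_mult_words[OF Cons.IH[OF ms]] by simp
  qed
  have "ug x * (word xs - word (us @ vs)) - (word (us @ x # vs) - word (x # us @ vs)) \<in> words (length xs)"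
    using 1 word_insert_diff[of us x vs] unfolding len words_def by (rule cx.span_diff)
  moreover have "ug x * (word xs - word (us @ vs)) - (word (us @ x # vs) - word (x # us @ vs)) =
      word (x # xs) - word ys"
    by (simp add: ys right_diff_distrib)
  ultimately show ?case by (simp del: word_simps)
qed

lemma uea_in_words: "\<exists>n. (u :: U) \<in> words n"
proof -
  have mono: "words m \<subseteq> words n" if "m \<le> n" for m n
    using that unfolding words_def by (intro cx.span_mono) auto
  have "u \<in> (\<Union>n. words n)"
  proof (induction u rule: uea_induct)
    case (const c)
    have "of_cx c * word [] \<in> words 0"
      unfolding words_def by (intro cx.span_scale cx.span_base) blast
    then show ?case by auto
  next
    case (gen x)
    have "uea_of x * word [] \<in> words (Suc 0)"
      by (rule uea_of_mult_words) (simp add: word_in_words del: word_simps)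
    then show ?case by auto
  next
    case (add u v)
    then obtain m n where "u \<in> words m" "v \<in> words n" by blast
    then have "u \<in> words (max m n)" "v \<in> words (max m n)"
      using mono[of m "max m n"] mono[of n "max m n"] by auto
    then have "u + v \<in> words (max m n)" unfolding words_def by (rule cx.span_add)
    then show ?case by blast
  next
    case (mult u v)
    then obtain m n where u: "u \<in> words m" and v: "v \<in> words n" by blast
    have "u * v \<in> words (m + n)"
      unfolding words_def
    proof (rule span_mult_left)
      show "v \<in> cx.span {word xs | xs. length xs \<le> n}" using v by (simp add: words_def)
      fix y assume "y \<in> {word xs | xs. length xs \<le> n}"
      then obtain ys where y: "y = word ys" "length ys \<le> n" by blast
      show "u * y \<in> cx.span {word xs | xs. length xs \<le> m + n}"
      proof (rule span_mult_right)
        show "u \<in> cx.span {word xs | xs. length xs \<le> m}" using u by (simp add: words_def)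
        fix x assume "x \<in> {word xs | xs. length xs \<le> m}"
        then obtain xs where x: "x = word xs" "length xs \<le> m" by blast
        then have "x * y = word (xs @ ys)" "length (xs @ ys) \<le> m + n" using y by auto
        then show "x * y \<in> cx.span {word xs | xs. length xs \<le> m + n}"
          by (intro cx.span_base) blast
      qed
    qed
    then show ?case by blast
  qed
  then show ?thesis by blast
qed

text \<open>In the associated graded algebra the relations \<open>casimir = a\<close>, \<open>casimir_bar = b\<close> rewrite the
  leading terms \<open>ue_bar * uf\<close> and \<open>uh_bar * uh_bar\<close>; the exponent \<open>z\<close> below encodes \<open>uf ^ z\<close> for
  \<open>z \<ge> 0\<close> and \<open>ue_bar ^ (- z)\<close> for \<open>z < 0\<close>, so that both never occur together.\<close>

type_synonym normal_index = "nat \<times> int \<times> nat \<times> bool \<times> nat"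

fun normal_mon :: "normal_index \<Rightarrow> U" where
  "normal_mon (p, z, k, \<epsilon>, q) =
     uf_bar ^ p * (uf ^ nat z * (ue_bar ^ nat (- z) * (uh ^ k * (uh_bar ^ of_bool \<epsilon> * ue ^ q))))"

fun casimir_mon :: "normal_index \<times> nat \<times> nat \<Rightarrow> U" where
  "casimir_mon (N, a, b) = normal_mon N * (casimir ^ a * casimir_bar ^ b)"

lemma span_casimir_mon:
  assumes "u \<in> cx.span (range casimir_mon)"
  shows "u * casimir \<in> cx.span (range casimir_mon)" "u * casimir_bar \<in> cx.span (range casimir_mon)"
proof -
  have 1: "casimir_mon (N, a, b) * casimir = casimir_mon (N, Suc a, b)" for N a b
  proof -
    have "casimir_mon (N, a, b) * casimir = normal_mon N * (casimir ^ a * (casimir_bar ^ b * casimir))"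
      by (simp add: mult.assoc)
    also have "\<dots> = normal_mon N * ((casimir ^ a * casimir) * casimir_bar ^ b)"
      by (simp only: casimir_commute(1)[of "casimir_bar ^ b"] mult.assoc)
    finally show ?thesis by (simp add: power_commutes)
  qed
  have 2: "casimir_mon (N, a, b) * casimir_bar = casimir_mon (N, a, Suc b)" for N a b
    by (simp add: mult.assoc power_commutes)
  show "u * casimir \<in> cx.span (range casimir_mon)" "u * casimir_bar \<in> cx.span (range casimir_mon)"
    by (rule span_mult_right[OF assms], clarify, simp only: 1 2, intro cx.span_base rangeI)+
qed

text \<open>Two rewritings, valid up to shorter words and central multiples of them:
  \<open>uh_bar * uh_bar\<close> becomes \<open>uf_bar * ue_bar\<close>, and
  \<open>ue_bar * uf\<close> becomes a combination of \<open>uh_bar * uh\<close> and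
  \<open>uf_bar * ue\<close>. When neither applies, the word is a reordered normal monomial.\<close>

lemma word_in_span_casimir_mon: "word xs \<in> cx.span (range casimir_mon)"
proof (induction "length xs" arbitrary: xs rule: less_induct)
  case less
  let ?X = "cx.span (range casimir_mon)"
  define n where "n = length xs"
  have IH: "word ys \<in> ?X" if "length ys < n" for ys using less that n_def by blast
  have FX: "w \<in> ?X" if "w \<in> words m" "m < n" for w m
    using that unfolding words_def by (elim span_subset_span) (auto intro: IH)
  \<comment> \<open>The letters may be permuted, since shorter words are covered by the induction on
    length.\<close>
  have perm: "word xs \<in> ?X" if "word ys \<in> ?X" "mset xs = mset ys" "length xs = n" for xs ys
  proof (cases "n = 0")
    case False
    then have "word xs - word ys \<in> ?X" using word_mset_diff[OF that(2)] that(3)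
      by (intro FX[of _ "n - 1"]) auto
    then show ?thesis using that(1) cx.span_add by fastforce
  qed (use that in auto)
  \<comment> \<open>Termination: each rewriting keeps the length and trades two of the counted
    letters \<open>Eb\<close>, \<open>Hb\<close>, \<open>F\<close> for at most one.\<close>
  have "length xs = n \<Longrightarrow> word xs \<in> ?X" for xs
  proof (induction "count_list xs Eb + count_list xs Hb + count_list xs F" arbitrary: xs rule: less_induct)
    case less
    have cnt: "count_list ys a = count (mset ys) a" for ys and a :: gen
      by (simp add: count_mset)
    show ?case
    proof (cases "count (mset xs) Hb \<ge> 2")
      case True
      then have "{#Hb, Hb#} \<subseteq># mset xs"
        by (auto simp: subseteq_mset_def)
      then obtain ys where ys: "mset xs = mset (Hb # Hb # ys)"
        by (metis add_mset_add_single ex_mset mset.simps(1) mset.simps(2) subset_mset.le_iff_add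
            union_mset_add_mset_left add.left_neutral)
      have len: "length ys + 2 = n" using less.prems ys by (metis length_Cons size_mset add_2_eq_Suc')
      have "word (Fb # Eb # ys) \<in> ?X"
        by (rule less.hyps) (use len ys in \<open>auto simp: cnt simp del: word_simps\<close>)
      moreover have "word ys * casimir_bar \<in> ?X"
        using len by (intro span_casimir_mon IH) simp
      moreover have "word (Hb # Hb # ys) = word ys * casimir_bar - of_cx 4 * word (Fb # Eb # ys)"
        unfolding casimir_commute(2) by (simp add: casimir_bar_eq algebra_simps of_cx_numeral)
      ultimately have "word (Hb # Hb # ys) \<in> ?X" by (simp only: cx.span_diff cx.span_scale)
      then show ?thesis using perm ys less.prems by blast
    next
      case nHb: False
      show ?thesis
      proof (cases "F \<in># mset xs \<and> Eb \<in># mset xs")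
        case True
        then have "{#Eb, F#} \<subseteq># mset xs"
          by (auto simp: subseteq_mset_def Suc_le_eq)
        then obtain ys where ys: "mset xs = mset (Eb # F # ys)"
          by (metis add_mset_add_single ex_mset mset.simps(1) mset.simps(2) subset_mset.le_iff_add
            union_mset_add_mset_left add.left_neutral)
        have len: "length ys + 2 = n" using less.prems ys by (metis length_Cons size_mset add_2_eq_Suc')
        have "word (Hb # H # ys) \<in> ?X" "word (Fb # E # ys) \<in> ?X"
          by (rule less.hyps; use len ys in \<open>auto simp: cnt simp del: word_simps\<close>)+
        moreover have "word ys * casimir \<in> ?X"
          using len by (intro span_casimir_mon IH) simp
        \<comment> \<open>The definition of \<open>casimir\<close>, solved for its summand
          \<open>ue_bar * uf\<close>.\<close>
        moreover have "word (Eb # F # ys) = of_cx (1/2) * (word ys * casimir - word (Hb # H # ys)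
            - of_cx 2 * word (Fb # E # ys))"
        proof -
          have "word ys * casimir - word (Hb # H # ys) - of_cx 2 * word (Fb # E # ys) =
              of_cx 2 * word (Eb # F # ys)"
            unfolding casimir_commute(1) by (simp add: casimir_eq algebra_simps of_cx_numeral)
          then show ?thesis by (simp add: mult.assoc[symmetric] of_cx_mult[symmetric] of_cx_one)
        qed
        ultimately have "word (Eb # F # ys) \<in> ?X" by (simp only: cx.span_diff cx.span_scale)
        then show ?thesis using perm ys less.prems by blast
      next
        case False
        \<comment> \<open>At most one of the letters \<open>F\<close>, \<open>Eb\<close> occurs and
          \<open>Hb\<close> at most once, so a single integer \<open>z\<close> records the first two
          counts and a Boolean the third.\<close>
        define p k q where "p = count (mset xs) Fb" and "k = count (mset xs) H" and "q = count (mset xs) E"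
        define z where "z = int (count (mset xs) F) - int (count (mset xs) Eb)"
        define \<epsilon> where "\<epsilon> = (Hb \<in># mset xs)"
        define ys where "ys = replicate p Fb @ replicate (nat z) F @ replicate (nat (- z)) Eb @
          replicate k H @ replicate (of_bool \<epsilon>) Hb @ replicate q E"
        have FE: "count (mset xs) F = 0 \<or> count (mset xs) Eb = 0"
          using False by (metis not_in_iff)
        have z: "nat z = count (mset xs) F" "nat (- z) = count (mset xs) Eb"
          using FE unfolding z_def by linarith+
        have e: "of_bool \<epsilon> = count (mset xs) Hb"
          using nHb unfolding \<epsilon>_def using count_greater_zero_iff[of "mset xs" Hb]
          by (auto simp del: set_mset_mset count_greater_zero_iff simp: of_bool_def not_in_iff)
        have "mset xs = mset ys"
        proof (rule multiset_eqI)
          fix a show "count (mset xs) a = count (mset ys) a"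
            unfolding ys_def z e p_def k_def q_def by (cases a) auto
        qed
        moreover have "word (replicate m g) = ug g ^ m" for m g
          by (induction m) auto
        then have "word ys = casimir_mon ((p, z, k, \<epsilon>, q), 0, 0)"
          by (simp add: ys_def)
        then have "word ys \<in> ?X" by (metis cx.span_base rangeI)
        ultimately show ?thesis using perm less.prems by blast
      qed
    qed
  qed
  then show ?case by (simp add: n_def)
qed

lemma uea_in_span_casimir_mon: "(u :: U) \<in> cx.span (range casimir_mon)"
proof -
  obtain n where "u \<in> words n" using uea_in_words by blast
  then show ?thesis
    unfolding words_def by (rule span_subset_span) (use word_in_span_casimir_mon in blast)
qed

text \<open>The exponents of the central elements run through a common square box, so that each
  normal monomial gets a polynomial in \<open>casimir\<close> and \<open>casimir_bar\<close> as
  coefficient. The trivial index is put into \<open>S\<close> for the comparison in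
  \<open>center_polynomial\<close>.\<close>

lemma uea_normal_form:
  obtains S :: "normal_index set" and B c where "finite S" "(0, 0, 0, False, 0) \<in> S"
    "(u :: U) = (\<Sum>N\<in>S. \<Sum>a<B. \<Sum>b<B. of_cx (c N a b) * casimir_mon (N, a, b))"
proof -
  obtain t r where t: "finite t" "t \<subseteq> range casimir_mon" and u: "u = (\<Sum>m\<in>t. of_cx (r m) * m)"
    using uea_in_span_casimir_mon[of u] unfolding cx.span_explicit by blast
  \<comment> \<open>A chosen index for each monomial of \<open>t\<close>, as different indices have
    not been shown to give different elements.\<close>
  define i where "i m = (SOME x. casimir_mon x = m)" for m
  have i: "casimir_mon (i m) = m" if "m \<in> t" for m
    unfolding i_def using that t(2) by (metis (mono_tags, lifting) imageE someI subsetD)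
  define I where "I = i ` t"
  have inj: "inj_on i t" by (rule inj_onI) (metis i)
  have I: "finite I" unfolding I_def using t by simp
  define S where "S = insert (0, 0, 0, False, 0) (fst ` I)"
  define B where "B = Suc (Max (insert 0 ((fst \<circ> snd) ` I \<union> (snd \<circ> snd) ` I)))"
  define c where "c N a b = (if (N, a, b) \<in> I then r (casimir_mon (N, a, b)) else 0)" for N a b
  have B: "a < B \<and> b < B" if "(N, a, b) \<in> I" for N a b
    unfolding B_def less_Suc_eq_le using I that by (intro conjI Max_ge) force+
  have fS: "finite S" unfolding S_def using I by simp
  have SB: "N \<in> S \<and> a < B \<and> b < B" if "(N, a, b) \<in> I" for N a b
    using B[OF that] that unfolding S_def by force
  have "(\<Sum>N\<in>S. \<Sum>a<B. \<Sum>b<B. of_cx (c N a b) * casimir_mon (N, a, b)) =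
      (\<Sum>x\<in>S \<times> {..<B} \<times> {..<B}. of_cx (case x of (N, a, b) \<Rightarrow> c N a b) * casimir_mon x)"
    by (simp add: sum.cartesian_product case_prod_unfold del: casimir_mon.simps)
  also have "\<dots> = (\<Sum>x\<in>I. of_cx (case x of (N, a, b) \<Rightarrow> c N a b) * casimir_mon x)"
    by (rule sum.mono_neutral_right)
      (use I fS SB in \<open>auto simp: c_def simp del: casimir_mon.simps\<close>)
  also have "\<dots> = (\<Sum>x\<in>I. of_cx (r (casimir_mon x)) * casimir_mon x)"
    by (rule sum.cong) (auto simp: c_def simp del: casimir_mon.simps)
  also have "\<dots> = u"
    unfolding I_def u by (subst sum.reindex[OF inj]) (simp add: i)
  finally show ?thesis using that[OF fS, of c B] by (simp add: S_def)
qed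

section \<open>Takiff differential operators in two variables\<close>

text \<open>\<open>uea_lift\<close> needs an algebra as its target, hence a type of linear
  operators. The indices run through all integers so that multiplication by x is invertible and the
  same formulas serve the localization at \<open>uf\<close>.\<close>

typedef operator = "{F :: (int \<Rightarrow> int \<Rightarrow> complex) \<Rightarrow> (int \<Rightarrow> int \<Rightarrow> complex).
    \<forall>c g h. F (\<lambda>k j. c * g k j + h k j) = (\<lambda>k j. c * F g k j + F h k j)}"
  by (rule exI[of _ "\<lambda>g. g"]) simp

setup_lifting type_definition_operator

instantiation operator :: complex_algebra_1
begin

lift_definition zero_operator :: operator is "\<lambda>g k j. 0" by simp
lift_definition one_operator :: operator is "\<lambda>g. g" by simp
lift_definition plus_operator :: "operator \<Rightarrow> operator \<Rightarrow> operator" is "\<lambda>F G g k j. F g k j + G g k j"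
  by (simp add: fun_eq_iff algebra_simps)
lift_definition minus_operator :: "operator \<Rightarrow> operator \<Rightarrow> operator" is "\<lambda>F G g k j. F g k j - G g k j"
  by (simp add: fun_eq_iff algebra_simps)
lift_definition uminus_operator :: "operator \<Rightarrow> operator" is "\<lambda>F g k j. - F g k j"
  by (simp add: fun_eq_iff algebra_simps)
lift_definition times_operator :: "operator \<Rightarrow> operator \<Rightarrow> operator" is "\<lambda>F G g. F (G g)"
  by simp
lift_definition of_cx_operator :: "complex \<Rightarrow> operator" is "\<lambda>c g k j. c * g k j"
  by (simp add: fun_eq_iff algebra_simps)

instance
proof
  show "(0 :: operator) \<noteq> 1"
    by transfer (auto simp: fun_eq_iff intro!: exI[of _ "\<lambda>_ _. 1"])
  fix a b c :: operator
  show "a * (b + c) = a * b + a * c"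
  proof (transfer, intro ext)
    fix a b c :: "(int \<Rightarrow> int \<Rightarrow> complex) \<Rightarrow> (int \<Rightarrow> int \<Rightarrow> complex)" and g k j
    assume "\<forall>c g h. a (\<lambda>k j. c * g k j + h k j) = (\<lambda>k j. c * a g k j + a h k j)"
    from this[rule_format, of 1 "b g" "c g"]
    show "a (\<lambda>k j. b g k j + c g k j) k j = a (b g) k j + a (c g) k j" by simp
  qed
next
  fix r and a :: operator
  show "of_cx r * a = a * of_cx r"
  proof (transfer, intro ext)
    fix r and a :: "(int \<Rightarrow> int \<Rightarrow> complex) \<Rightarrow> (int \<Rightarrow> int \<Rightarrow> complex)" and g k j
    assume a: "\<forall>c g h. a (\<lambda>k j. c * g k j + h k j) = (\<lambda>k j. c * a g k j + a h k j)"
    have "a (\<lambda>k j. 0) k j = 0" for k j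
      using a[rule_format, of 1 "\<lambda>k j. 0" "\<lambda>k j. 0"] by (simp add: fun_eq_iff)
    then show "r * a g k j = a (\<lambda>k j. r * g k j) k j"
      using a[rule_format, of r g "\<lambda>k j. 0"] by simp
  qed
qed (transfer; simp add: fun_eq_iff algebra_simps)+

end

text \<open>A function \<open>g\<close> stands for the formal series with coefficient \<open>g k j\<close> at \<open>x ^ k * y ^ j\<close>. On
  the Verma module with its basis \<open>f ^ k * f_bar ^ j\<close>, read as \<open>x ^ k * y ^ j\<close>, the six generators act
  by \<open>f = x\<close>, \<open>f_bar = y\<close>, \<open>h = \<mu> - 2 x d/dx - 2 y d/dy\<close>, \<open>h_bar = \<nu> - 2 y d/dx\<close>,
  \<open>e_bar = \<nu> d/dx - y (d/dx)^2\<close> and \<open>e = \<nu> d/dy + \<mu> d/dx - x (d/dx)^2 - 2 y (d/dx) (d/dy)\<close>.\<close>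

lift_definition takiff_op :: "complex \<Rightarrow> complex \<Rightarrow> T \<Rightarrow> operator" is
  "\<lambda>\<mu> \<nu> x g k j.
      f_coord (part0 x) * g (k - 1) j
    + h_coord (part0 x) * ((\<mu> - 2 * of_int (k + j)) * g k j)
    + e_coord (part0 x) * (\<nu> * of_int (j + 1) * g k (j + 1) + of_int (k + 1) * (\<mu> - of_int (k + 2 * j)) * g (k + 1) j)
    + f_coord (part1 x) * g k (j - 1)
    + h_coord (part1 x) * (\<nu> * g k j - 2 * of_int (k + 1) * g (k + 1) (j - 1))
    + e_coord (part1 x) * (\<nu> * of_int (k + 1) * g (k + 1) j - of_int ((k + 2) * (k + 1)) * g (k + 2) (j - 1))"
  by (simp add: fun_eq_iff algebra_simps)

lemma takiff_op_add: "takiff_op \<mu> \<nu> (x + y) = takiff_op \<mu> \<nu> x + takiff_op \<mu> \<nu> y"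
  by transfer (simp add: fun_eq_iff takiff_defs sl2_defs distrib_right)

lemma takiff_op_cscale: "takiff_op \<mu> \<nu> (cscale c x) = of_cx c * takiff_op \<mu> \<nu> x"
  by transfer (simp add: fun_eq_iff takiff_defs sl2_defs distrib_left mult.assoc)

lemma takiff_induct:
  assumes "\<And>x y. P x \<Longrightarrow> P y \<Longrightarrow> P (x + y)" "\<And>c x. P x \<Longrightarrow> P (cscale c x)"
    and "\<And>g. P (gen_elt g)"
  shows "P x"
proof -
  obtain a b c a' b' c' where x: "x = Takiff (Sl2 a b c) (Sl2 a' b' c')"
    by (metis sl2.exhaust takiff.exhaust)
  have "x = cscale a (gen_elt F) + cscale b (gen_elt H) + cscale c (gen_elt E) +
      cscale a' (gen_elt Fb) + cscale b' (gen_elt Hb) + cscale c' (gen_elt Eb)"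
    by (simp add: x takiff_defs sl2_defs)
  then show ?thesis by (simp only:) (intro assms)
qed

lemma takiff_op_bracket_gen:
  "takiff_op \<mu> \<nu> (bracket (gen_elt a) (gen_elt b)) =
     takiff_op \<mu> \<nu> (gen_elt a) * takiff_op \<mu> \<nu> (gen_elt b) - takiff_op \<mu> \<nu> (gen_elt b) * takiff_op \<mu> \<nu> (gen_elt a)"
proof -
  have eqI: "A = B" if "\<And>g k j. Rep_operator A g k j = Rep_operator B g k j" for A B
    using that by (metis Rep_operator_inject ext)
  show ?thesis
    by (rule eqI, cases a; cases b; simp add: takiff_op.rep_eq times_operator.rep_eq minus_operator.rep_eq zero_operator.rep_eq
        takiff_defs sl2_defs algebra_simps)
qed

lemma takiff_op_bracket:
  "takiff_op \<mu> \<nu> (bracket x y) = takiff_op \<mu> \<nu> x * takiff_op \<mu> \<nu> y - takiff_op \<mu> \<nu> y * takiff_op \<mu> \<nu> x"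
proof (induction x rule: takiff_induct)
  case (3 g)
  show ?case
  proof (induction y rule: takiff_induct)
    case (3 g')
    show ?case by (rule takiff_op_bracket_gen)
  qed (simp_all add: bracket_add_right bracket_cscale_right takiff_op_add takiff_op_cscale
      distrib_left distrib_right right_diff_distrib of_cx_left_commute mult.assoc)
qed (simp_all add: bracket_add_left bracket_cscale_left takiff_op_add takiff_op_cscale
      distrib_left distrib_right right_diff_distrib of_cx_left_commute mult.assoc)


section \<open>The representation of \<open>U\<close> on formal series\<close>

definition rho :: "complex \<Rightarrow> complex \<Rightarrow> U \<Rightarrow> (int \<Rightarrow> int \<Rightarrow> complex) \<Rightarrow> int \<Rightarrow> int \<Rightarrow> complex" where
  "rho \<mu> \<nu> u = Rep_operator (uea_lift (takiff_op \<mu> \<nu>) u)"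

lemmas takiff_lift = uea_lift_hom[of "takiff_op \<mu> \<nu>" for \<mu> \<nu>,
    OF takiff_op_add takiff_op_cscale takiff_op_bracket]

lemma rho_add: "rho \<mu> \<nu> (u + v) g = (\<lambda>k j. rho \<mu> \<nu> u g k j + rho \<mu> \<nu> v g k j)"
  by (simp add: rho_def takiff_lift plus_operator.rep_eq)

lemma rho_mult: "rho \<mu> \<nu> (u * v) g = rho \<mu> \<nu> u (rho \<mu> \<nu> v g)"
  by (simp add: rho_def takiff_lift times_operator.rep_eq)

lemma rho_of_cx: "rho \<mu> \<nu> (of_cx c) g = (\<lambda>k j. c * g k j)"
  by (simp add: rho_def takiff_lift of_cx_operator.rep_eq)

lemma rho_zero: "rho \<mu> \<nu> 0 g = (\<lambda>k j. 0)"
  using rho_of_cx[of \<mu> \<nu> 0 g] by simp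

lemma rho_one: "rho \<mu> \<nu> 1 g = g"
  using rho_of_cx[of \<mu> \<nu> 1 g] by (simp add: of_cx_one)

lemma rho_numeral: "rho \<mu> \<nu> (numeral n) g = (\<lambda>k j. numeral n * g k j)"
  using rho_of_cx[of \<mu> \<nu> "numeral n" g] by (simp add: of_cx_numeral)

lemma rho_diff: "rho \<mu> \<nu> (u - v) g = (\<lambda>k j. rho \<mu> \<nu> u g k j - rho \<mu> \<nu> v g k j)"
  using rho_add[of \<mu> \<nu> "u - v" v g] by (simp add: fun_eq_iff)

lemma rho_sum: "rho \<mu> \<nu> (sum f A) g = (\<lambda>k j. \<Sum>i\<in>A. rho \<mu> \<nu> (f i) g k j)"
  by (induction A rule: infinite_finite_induct) (simp_all add: rho_zero rho_add)

lemma rho_linear: "rho \<mu> \<nu> u (\<lambda>k j. c * g k j + h k j) = (\<lambda>k j. c * rho \<mu> \<nu> u g k j + rho \<mu> \<nu> u h k j)"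
  using Rep_operator[of "uea_lift (takiff_op \<mu> \<nu>) u"] unfolding rho_def by blast

lemma rho_zero_fn: "rho \<mu> \<nu> u (\<lambda>k j. 0) = (\<lambda>k j. 0)"
  using rho_linear[of \<mu> \<nu> u 1 "\<lambda>k j. 0" "\<lambda>k j. 0"] by (simp add: fun_eq_iff)

lemma rho_scale: "rho \<mu> \<nu> u (\<lambda>k j. c * g k j) = (\<lambda>k j. c * rho \<mu> \<nu> u g k j)"
  using rho_linear[of \<mu> \<nu> u c g "\<lambda>k j. 0"] by (simp add: rho_zero_fn)

lemma rho_gen:
  "rho \<mu> \<nu> uf g = (\<lambda>k j. g (k - 1) j)"
  "rho \<mu> \<nu> uh g = (\<lambda>k j. (\<mu> - 2 * of_int (k + j)) * g k j)"
  "rho \<mu> \<nu> ue g = (\<lambda>k j. \<nu> * of_int (j + 1) * g k (j + 1) + of_int (k + 1) * (\<mu> - of_int (k + 2 * j)) * g (k + 1) j)"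
  "rho \<mu> \<nu> uf_bar g = (\<lambda>k j. g k (j - 1))"
  "rho \<mu> \<nu> uh_bar g = (\<lambda>k j. \<nu> * g k j - 2 * of_int (k + 1) * g (k + 1) (j - 1))"
  "rho \<mu> \<nu> ue_bar g = (\<lambda>k j. \<nu> * of_int (k + 1) * g (k + 1) j - of_int ((k + 2) * (k + 1)) * g (k + 2) (j - 1))"
  by (simp_all add: rho_def takiff_lift takiff_op.rep_eq zero_sl2_def)

text \<open>The scalar action holds on all formal series, not only on those from the Verma module.
  For \<open>\<mu> = n - 2\<close> the scalar is \<open>n * \<nu>\<close>.\<close>

lemma rho_casimir: "rho \<mu> \<nu> casimir g = (\<lambda>k j. \<nu> * (\<mu> + 2) * g k j)"
  by (simp add: casimir_def rho_add rho_mult rho_gen rho_numeral fun_eq_iff algebra_simps)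

lemma rho_casimir_bar: "rho \<mu> \<nu> casimir_bar g = (\<lambda>k j. \<nu> ^ 2 * g k j)"
  by (simp add: casimir_bar_def power2_eq_square rho_add rho_mult rho_gen rho_numeral fun_eq_iff algebra_simps)

lemma rho_uf_power: "rho \<mu> \<nu> (uf ^ n) g = (\<lambda>k j. g (k - int n) j)"
  by (induction n arbitrary: g) (simp_all add: rho_one rho_mult rho_gen algebra_simps)

lemma rho_uf_bar_power: "rho \<mu> \<nu> (uf_bar ^ n) g = (\<lambda>k j. g k (j - int n))"
  by (induction n arbitrary: g) (simp_all add: rho_one rho_mult rho_gen algebra_simps)

lemma rho_stable:
  assumes "\<And>c g h. P g \<Longrightarrow> P h \<Longrightarrow> P (\<lambda>k j. c * g k j + h k j)" "P (\<lambda>k j. 0)"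
    and "\<And>a g. P g \<Longrightarrow> P (rho \<mu> \<nu> (ug a) g)" and "P g"
  shows "P (rho \<mu> \<nu> u g)"
  using \<open>P g\<close>
proof (induction u arbitrary: g rule: uea_induct)
  case (const c)
  then show ?case using assms(1)[of g "\<lambda>k j. 0" c] assms(2) by (simp add: rho_of_cx)
next
  case (gen x)
  then show ?case
  proof (induction x rule: takiff_induct)
    case (1 x y)
    then show ?case using assms(1)[of "rho \<mu> \<nu> (uea_of x) g" "rho \<mu> \<nu> (uea_of y) g" 1] by (simp add: uea_of_add rho_add)
  next
    case (2 c x)
    then show ?case
      using assms(1)[of "rho \<mu> \<nu> (uea_of x) g" "\<lambda>k j. 0" c] assms(2) by (simp add: uea_of_cscale rho_mult rho_of_cx)
  qed (rule assms(3))
next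
  case (add u v)
  then show ?case using assms(1)[of "rho \<mu> \<nu> u g" "rho \<mu> \<nu> v g" 1] by (simp add: rho_add)
next
  case (mult u v)
  then show ?case by (simp add: rho_mult)
qed

section \<open>Leading terms\<close>

text \<open>The value \<open>c = 0\<close> is allowed, so \<open>m\<close> is in general only a
  bound for the y-exponent. This keeps the notion stable under generators whose leading factor
  happens to vanish.\<close>

definition leading :: "int \<Rightarrow> int \<Rightarrow> complex \<Rightarrow> (int \<Rightarrow> int \<Rightarrow> complex) \<Rightarrow> bool" where
  "leading r m c g \<longleftrightarrow> (\<forall>k j. g k j \<noteq> 0 \<longrightarrow> k + j = - r \<and> j \<le> m) \<and> g (- r - m) m = c"

lemma leadingI:
  assumes "\<And>k j. \<not> (k + j = - r \<and> j \<le> m) \<Longrightarrow> g k j = 0" "g (- r - m) m = c"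
  shows "leading r m c g"
  using assms unfolding leading_def by blast

lemma leadingD: "leading r m c g \<Longrightarrow> \<not> (k + j = - r \<and> j \<le> m) \<Longrightarrow> g k j = 0"
  unfolding leading_def by blast

text \<open>Only the part of each differential operator with the highest y-shift matters, applied to
  x^(- r - m) y^m: it is \<open>- 2 y d/dx\<close> for \<open>uh_bar\<close>,
  \<open>- y (d/dx)^2\<close> for \<open>ue_bar\<close>, and everything except
  \<open>\<nu> d/dy\<close> for \<open>ue\<close>.\<close>

lemma leading_gen:
  assumes g: "leading r m c g"
  shows "leading (r - 1) m c (rho \<mu> \<nu> uf g)"
    and "leading (r - 1) (m + 1) c (rho \<mu> \<nu> uf_bar g)"
    and "leading r m ((\<mu> + 2 * of_int r) * c) (rho \<mu> \<nu> uh g)"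
    and "leading r (m + 1) (2 * of_int (m + r) * c) (rho \<mu> \<nu> uh_bar g)"
    and "leading (r + 1) (m + 1) (- of_int ((m + r) * (m + r + 1)) * c) (rho \<mu> \<nu> ue_bar g)"
    and "leading (r + 1) m (of_int (m + r) * (of_int (m - r - 1) - \<mu>) * c) (rho \<mu> \<nu> ue g)"
proof -
  have c: "g (- r - m) m = c" using g by (simp add: leading_def)
  have "- m - r = - r - m" by simp
  with c have c': "g (- m - r) m = c" by (simp only:)
  note z = leadingD[OF g]
  show "leading (r - 1) m c (rho \<mu> \<nu> uf g)"
    by (rule leadingI) (auto simp: rho_gen z c c' algebra_simps)
  show "leading (r - 1) (m + 1) c (rho \<mu> \<nu> uf_bar g)"
    using c' by (intro leadingI) (auto simp: rho_gen z algebra_simps)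
  show "leading r m ((\<mu> + 2 * of_int r) * c) (rho \<mu> \<nu> uh g)"
    by (rule leadingI) (auto simp: rho_gen z c c' algebra_simps)
  have 1: "- r - (m + 1) + 1 = - r - m" "- (r + 1) - (m + 1) + 2 = - r - m" "- (r + 1) - m + 1 = - r - m" "m + 1 - 1 = m"
    by simp_all
  show "leading r (m + 1) (2 * of_int (m + r) * c) (rho \<mu> \<nu> uh_bar g)"
    unfolding rho_gen
  proof (rule leadingI)
    show "\<nu> * g (- r - (m + 1)) (m + 1) - 2 * of_int (- r - (m + 1) + 1) * g (- r - (m + 1) + 1) (m + 1 - 1) =
        2 * of_int (m + r) * c"
      unfolding 1 c by (simp add: z algebra_simps)
  qed (auto simp: z)
  show "leading (r + 1) (m + 1) (- of_int ((m + r) * (m + r + 1)) * c) (rho \<mu> \<nu> ue_bar g)"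
    unfolding rho_gen
  proof (rule leadingI)
    show "\<nu> * of_int (- (r + 1) - (m + 1) + 1) * g (- (r + 1) - (m + 1) + 1) (m + 1) -
      of_int ((- (r + 1) - (m + 1) + 2) * (- (r + 1) - (m + 1) + 1)) * g (- (r + 1) - (m + 1) + 2) (m + 1 - 1) =
      - of_int ((m + r) * (m + r + 1)) * c"
      unfolding 1 c by (simp add: z algebra_simps)
  qed (auto simp: z)
  show "leading (r + 1) m (of_int (m + r) * (of_int (m - r - 1) - \<mu>) * c) (rho \<mu> \<nu> ue g)"
    unfolding rho_gen
  proof (rule leadingI)
    show "\<nu> * of_int (m + 1) * g (- (r + 1) - m) (m + 1) +
      of_int (- (r + 1) - m + 1) * (\<mu> - of_int (- (r + 1) - m + 2 * m)) * g (- (r + 1) - m + 1) m =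
      of_int (m + r) * (of_int (m - r - 1) - \<mu>) * c"
      unfolding 1 c by (simp add: z algebra_simps)
  qed (auto simp: z)
qed

text \<open>With \<open>r\<close> fixed, the leading factor is a polynomial \<open>P\<close> in
  \<open>m\<close>. Again \<open>l\<close> may be 0, for instance for \<open>uh\<close> when
  \<open>\<mu> + 2 * of_int r = 0\<close>, so \<open>\<delta>\<close> only bounds the
  degree.\<close>

definition leading_shift ::
  "complex \<Rightarrow> complex \<Rightarrow> U \<Rightarrow> int \<Rightarrow> int \<Rightarrow> int \<Rightarrow> nat \<Rightarrow> complex poly \<Rightarrow> complex \<Rightarrow> bool" where
  "leading_shift \<mu> \<nu> u r s d \<delta> P l \<longleftrightarrow> degree P \<le> \<delta> \<and> coeff P \<delta> = l \<and>
     (\<forall>m c g. leading r m c g \<longrightarrow> leading (r + s) (m + d) (poly P (of_int m) * c) (rho \<mu> \<nu> u g))"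

lemma coeff_pcompose_translate:
  fixes P :: "'a::idom poly"
  assumes "degree P \<le> n"
  shows "coeff (pcompose P [:a, 1:]) n = coeff P n"
proof (cases "degree P = n")
  case True
  have "degree (pcompose P [:a, 1:]) = degree P" by (simp add: degree_pcompose)
  then show ?thesis using lead_coeff_comp[of "[:a, 1:]" P] True by simp
next
  case False
  then have "degree P < n" "degree (pcompose P [:a, 1:]) < n"
    using assms by (simp_all add: degree_pcompose)
  then show ?thesis by (simp add: coeff_eq_0)
qed

lemma coeff_mult_degree_le:
  assumes "degree P \<le> m" "degree Q \<le> n"
  shows "coeff (P * Q) (m + n) = coeff P m * coeff (Q :: 'a::comm_semiring_1 poly) n"
proof -
  have "coeff (P * Q) (m + n) = (\<Sum>i\<le>m + n. coeff P i * coeff Q (m + n - i))"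
    by (rule coeff_mult)
  also have "\<dots> = (\<Sum>i\<in>{m}. coeff P i * coeff Q (m + n - i))"
  proof (rule sum.mono_neutral_right)
    show "\<forall>i\<in>{..m + n} - {m}. coeff P i * coeff Q (m + n - i) = 0"
    proof
      fix i assume "i \<in> {..m + n} - {m}"
      then have "i > m \<or> m + n - i > n" by auto
      then show "coeff P i * coeff Q (m + n - i) = 0"
        using assms by (auto simp: coeff_eq_0)
    qed
  qed auto
  finally show ?thesis by simp
qed

text \<open>The factor of \<open>u\<close> is evaluated after \<open>v\<close> has raised the
  exponent by \<open>d\<close>; this translation of the polynomial keeps its top
  coefficient.\<close>

lemma leading_shift_mult:
  assumes v: "\<exists>P. leading_shift \<mu> \<nu> v r s d \<delta> P l" and u: "\<exists>P. leading_shift \<mu> \<nu> u (r + s) s' d' \<delta>' P l'"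
  shows "\<exists>P. leading_shift \<mu> \<nu> (u * v) r (s' + s) (d' + d) (\<delta>' + \<delta>) P (l' * l)"
proof -
  obtain P P' where P: "degree P \<le> \<delta>" "coeff P \<delta> = l"
      "\<And>m c g. leading r m c g \<Longrightarrow> leading (r + s) (m + d) (poly P (of_int m) * c) (rho \<mu> \<nu> v g)"
    and P': "degree P' \<le> \<delta>'" "coeff P' \<delta>' = l'"
      "\<And>m c g. leading (r + s) m c g \<Longrightarrow> leading (r + s + s') (m + d') (poly P' (of_int m) * c) (rho \<mu> \<nu> u g)"
    using u v unfolding leading_shift_def by blast
  define Q where "Q = pcompose P' [:of_int d, 1:]"
  have "degree Q \<le> \<delta>'" "coeff Q \<delta>' = l'"
    using P'(1,2) by (simp_all add: Q_def degree_pcompose coeff_pcompose_translate)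
  moreover from this have "degree (Q * P) \<le> \<delta>' + \<delta>"
    using P(1) degree_mult_le[of Q P] by linarith
  moreover have "leading (r + (s' + s)) (m + (d' + d)) (poly (Q * P) (of_int m) * c) (rho \<mu> \<nu> (u * v) g)"
    if "leading r m c g" for m c g
    using P'(3)[OF P(3)[OF that]] by (simp add: rho_mult Q_def poly_pcompose algebra_simps)
  ultimately show ?thesis
    using P(1,2) unfolding leading_shift_def by (intro exI[of _ "Q * P"]) (auto simp: coeff_mult_degree_le)
qed

text \<open>The constant \<open>l\<close> has to be the same at every intermediate degree. For
  \<open>uh\<close>, whose constant depends on the degree, this holds because
  \<open>s = 0\<close>.\<close>

lemma leading_shift_power:
  assumes "\<And>i. \<exists>P. leading_shift \<mu> \<nu> u (r + int i * s) s d \<delta> P l"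
  shows "\<exists>P. leading_shift \<mu> \<nu> (u ^ n) r (int n * s) (int n * d) (n * \<delta>) P (l ^ n)"
proof (induction n)
  case 0
  show ?case by (rule exI[of _ 1]) (simp add: leading_shift_def rho_one)
next
  case (Suc n)
  show ?case using leading_shift_mult[OF Suc assms[of n]] by (simp add: algebra_simps)
qed

lemma leading_shift_gen:
  "\<exists>P. leading_shift \<mu> \<nu> uf r (- 1) 0 0 P 1"
  "\<exists>P. leading_shift \<mu> \<nu> uf_bar r (- 1) 1 0 P 1"
  "\<exists>P. leading_shift \<mu> \<nu> uh r 0 0 0 P (\<mu> + 2 * of_int r)"
  "\<exists>P. leading_shift \<mu> \<nu> uh_bar r 0 1 1 P 2"
  "\<exists>P. leading_shift \<mu> \<nu> ue_bar r 1 1 2 P (- 1)"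
  "\<exists>P. leading_shift \<mu> \<nu> ue r 1 0 2 P 1"
proof -
  note l = leading_gen[of r _ _ _ \<mu> \<nu>]
  show "\<exists>P. leading_shift \<mu> \<nu> uf r (- 1) 0 0 P 1"
    unfolding leading_shift_def using l(1) by (intro exI[of _ 1]) simp
  show "\<exists>P. leading_shift \<mu> \<nu> uf_bar r (- 1) 1 0 P 1"
    unfolding leading_shift_def using l(2) by (intro exI[of _ 1]) simp
  show "\<exists>P. leading_shift \<mu> \<nu> uh r 0 0 0 P (\<mu> + 2 * of_int r)"
    unfolding leading_shift_def using l(3) by (intro exI[of _ "[:\<mu> + 2 * of_int r:]"]) simp
  show "\<exists>P. leading_shift \<mu> \<nu> uh_bar r 0 1 1 P 2"
    unfolding leading_shift_def using l(4)
    by (intro exI[of _ "[:2 * of_int r, 2:]"]) (simp add: algebra_simps)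
  define P where "P = [:- of_int r * (of_int r + 1), - 2 * of_int r - 1, - 1 :: complex:]"
  have P: "poly P (of_int m) = - of_int ((m + r) * (m + r + 1))" for m
    by (simp add: P_def algebra_simps)
  show "\<exists>P. leading_shift \<mu> \<nu> ue_bar r 1 1 2 P (- 1)"
    unfolding leading_shift_def using l(5)
    by (intro exI[of _ P]) (simp only: P, simp add: P_def numeral_2_eq_2)
  define P' where "P' = [:of_int r * (- of_int r - 1 - \<mu>), - 1 - \<mu>, 1:]"
  have P': "poly P' (of_int m) = of_int (m + r) * (of_int (m - r - 1) - \<mu>)" for m
    by (simp add: P'_def algebra_simps)
  show "\<exists>P. leading_shift \<mu> \<nu> ue r 1 0 2 P 1"
    unfolding leading_shift_def using l(6)
    by (intro exI[of _ P']) (simp only: P', simp add: P'_def numeral_2_eq_2)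
qed

text \<open>\<open>uf ^ z\<close> for \<open>z \<ge> 0\<close> and \<open>ue_bar ^ (- z)\<close> for
  \<open>z < 0\<close> both change \<open>r\<close> by \<open>- z\<close>, so \<open>z\<close>
  enters linearly.\<close>

fun deg_shift :: "normal_index \<Rightarrow> int" where
  "deg_shift (p, z, k, \<epsilon>, q) = int q - z - int p"

fun exp_shift :: "normal_index \<Rightarrow> int" where
  "exp_shift (p, z, k, \<epsilon>, q) = int p + int (nat (- z)) + of_bool \<epsilon>"

text \<open>The degree in \<open>m\<close> of the leading factor; \<open>uf_bar\<close>,
  \<open>uf\<close> and \<open>uh\<close> contribute nothing to it.\<close>

fun growth :: "normal_index \<Rightarrow> nat" where
  "growth (p, z, k, \<epsilon>, q) = 2 * q + of_bool \<epsilon> + 2 * nat (- z)"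

fun h_exp :: "normal_index \<Rightarrow> nat" where
  "h_exp (p, z, k, \<epsilon>, q) = k"

text \<open>The powers of \<open>uh\<close> act after \<open>ue ^ q\<close>, hence in total degree
  \<open>- (r + q)\<close>; this is the only place where \<open>r\<close> enters.\<close>

fun lead_const :: "complex \<Rightarrow> int \<Rightarrow> normal_index \<Rightarrow> complex" where
  "lead_const \<mu> r (p, z, k, \<epsilon>, q) = (- 1) ^ nat (- z) * (\<mu> + 2 * of_int (r + int q)) ^ k * 2 ^ of_bool \<epsilon>"

lemma leading_shift_normal_mon:
  "\<exists>P. leading_shift \<mu> \<nu> (normal_mon N) r (deg_shift N) (exp_shift N) (growth N) P (lead_const \<mu> r N)"
proof -
  obtain p z k \<epsilon> q where N: "N = (p, z, k, \<epsilon>, q)" by (metis prod_cases5)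
  have e: "\<exists>P. leading_shift \<mu> \<nu> (ue ^ q) r (int q * 1) (int q * 0) (q * 2) P (1 ^ q)"
    by (rule leading_shift_power) (rule leading_shift_gen)
  have hb: "\<exists>P. leading_shift \<mu> \<nu> (uh_bar ^ n) r (int n * 0) (int n * 1) (n * 1) P (2 ^ n)" for r n
    by (rule leading_shift_power) (rule leading_shift_gen)
  have h: "\<exists>P. leading_shift \<mu> \<nu> (uh ^ k) r (int k * 0) (int k * 0) (k * 0) P ((\<mu> + 2 * of_int r) ^ k)" for r
    by (rule leading_shift_power) (use leading_shift_gen(3)[of \<mu> \<nu> r] in simp)
  have eb: "\<exists>P. leading_shift \<mu> \<nu> (ue_bar ^ n) r (int n * 1) (int n * 1) (n * 2) P ((- 1) ^ n)" for r n
    by (rule leading_shift_power) (rule leading_shift_gen)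
  have f: "\<exists>P. leading_shift \<mu> \<nu> (uf ^ n) r (int n * - 1) (int n * 0) (n * 0) P (1 ^ n)" for r n
    by (rule leading_shift_power) (rule leading_shift_gen)
  have fb: "\<exists>P. leading_shift \<mu> \<nu> (uf_bar ^ n) r (int n * - 1) (int n * 1) (n * 0) P (1 ^ n)" for r n
    by (rule leading_shift_power) (rule leading_shift_gen)
  note * = leading_shift_mult[OF leading_shift_mult[OF leading_shift_mult[OF leading_shift_mult[OF
      leading_shift_mult[OF e hb[of "of_bool \<epsilon>"]] h] eb[of "nat (- z)"]] f[of "nat z"]] fb[of p]]
  have eqs: "deg_shift N = int p * - 1 + (int (nat z) * - 1 + (int (nat (- z)) * 1 + (int k * 0 + (int (of_bool \<epsilon>) * 0 + int q * 1))))"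
    "exp_shift N = int p * 1 + (int (nat z) * 0 + (int (nat (- z)) * 1 + (int k * 0 + (int (of_bool \<epsilon>) * 1 + int q * 0))))"
    "growth N = p * 0 + (nat z * 0 + (nat (- z) * 2 + (k * 0 + (of_bool \<epsilon> * 1 + q * 2))))"
    "lead_const \<mu> r N = 1 ^ p * (1 ^ nat z * ((- 1) ^ nat (- z) *
        ((\<mu> + 2 * of_int (r + (int (of_bool \<epsilon>) * 0 + int q * 1))) ^ k * (2 ^ of_bool \<epsilon> * 1 ^ q))))"
    by (auto simp: N)
  show ?thesis unfolding eqs unfolding N normal_mon.simps by (rule *)
qed

text \<open>The parity of the growth gives \<open>\<epsilon>\<close>. What is left of the exponent
  shift and of half the growth differ by \<open>q - p\<close>, which together with the degree shift
  yields \<open>z\<close>; then \<open>p\<close> and \<open>q\<close> follow.\<close>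

lemma normal_index_eqI:
  assumes "deg_shift N = deg_shift N'" "exp_shift N = exp_shift N'" "growth N = growth N'" "h_exp N = h_exp N'"
  shows "N = N'"
proof -
  obtain p z k \<epsilon> q where N: "N = (p, z, k, \<epsilon>, q)" by (metis prod_cases5)
  obtain p' z' k' \<epsilon>' q' where N': "N' = (p', z', k', \<epsilon>', q')" by (metis prod_cases5)
  define e e' where "e = (of_bool \<epsilon> :: nat)" and "e' = (of_bool \<epsilon>' :: nat)"
  have e: "e \<le> 1" "e' \<le> 1" "(of_bool \<epsilon> :: int) = int e" "(of_bool \<epsilon>' :: int) = int e'" "\<epsilon> = \<epsilon>' \<longleftrightarrow> e = e'"
    by (auto simp: e_def e'_def of_bool_def)
  have "k = k'" using assms(4) by (simp add: N N')
  moreover have 1: "int q - z - int p = int q' - z' - int p'"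
    and 2: "int p + int (nat (- z)) + int e = int p' + int (nat (- z')) + int e'"
    and 3: "2 * q + e + 2 * nat (- z) = 2 * q' + e' + 2 * nat (- z')"
    using assms(1-3) by (simp_all add: N N' e(3,4) flip: e_def e'_def)
  have "e = e'" if "2 * q + e + 2 * x = 2 * q' + e' + 2 * x'" for x x'
    using that e(1,2) by presburger
  from this[OF 3] have "e = e'" .
  moreover have "p = p' \<and> z = z' \<and> q = q'"
  proof -
    have "z \<ge> 0 \<and> int (nat (- z)) = 0 \<or> z < 0 \<and> int (nat (- z)) = - z"
      "z' \<ge> 0 \<and> int (nat (- z')) = 0 \<or> z' < 0 \<and> int (nat (- z')) = - z'"
      by auto
    then show ?thesis
      using 1 2 3 \<open>e = e'\<close> by (intro conjI; elim disjE conjE; linarith)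
  qed
  ultimately show ?thesis using e by (simp add: N N')
qed

text \<open>In a nontrivial relation a degree shift, the largest exponent shift and the largest
  growth are singled out in turn. The survivors differ only in the power of \<open>uh\<close>, and
  varying \<open>r\<close> separates these. Only coefficients with \<open>k < 0\<close> are tested,
  because the others are lost in the quotient by regular series.\<close>

lemma normal_mon_independent:
  assumes fin: "finite S"
    and dense: "\<And>r a. \<exists>m\<ge>a. \<exists>l g. l \<noteq> 0 \<and> leading r m l g \<and>
      (\<forall>k<0. \<forall>j. (\<Sum>N\<in>S. c N * rho \<mu> \<nu> (normal_mon N) g k j) = 0)"
    and N: "N0 \<in> S"
  shows "c N0 = 0"
proof (rule ccontr)
  assume nz: "c N0 \<noteq> 0"
  \<comment> \<open>Monomials with another degree shift land in another total degree and cannot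
    interfere.\<close>
  define S0 where "S0 = {N\<in>S. c N \<noteq> 0 \<and> deg_shift N = deg_shift N0}"
  have S0: "finite S0" "N0 \<in> S0" using fin N nz by (auto simp: S0_def)
  define d where "d = Max (exp_shift ` S0)"
  define S1 where "S1 = {N\<in>S0. exp_shift N = d}"
  have "d \<in> exp_shift ` S0" unfolding d_def using S0 by (intro Max_in) auto
  then obtain N where "N \<in> S0" "d = exp_shift N" by blast
  then have "N \<in> S1" by (simp add: S1_def)
  then have S1: "finite S1" "S1 \<noteq> {}" using S0 unfolding S1_def by (simp, blast)
  define \<delta> where "\<delta> = Max (growth ` S1)"
  define S2 where "S2 = {N\<in>S1. growth N = \<delta>}"
  have "\<delta> \<in> growth ` S1" unfolding \<delta>_def using S1 by (intro Max_in) auto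
  then obtain N where "N \<in> S1" "\<delta> = growth N" by blast
  then have "N \<in> S2" by (simp add: S2_def)
  then have S2: "finite S2" "S2 \<noteq> {}" using S1 unfolding S2_def by (simp, blast)
  have le_d: "exp_shift N \<le> d" if "N \<in> S0" for N unfolding d_def using S0 that by simp
  have le_\<delta>: "growth N \<le> \<delta>" if "N \<in> S1" for N unfolding \<delta>_def using S1 that by simp
  have lead: "(\<Sum>N\<in>S2. c N * lead_const \<mu> r N) = 0" for r
  proof -
    have "\<forall>N. \<exists>P. leading_shift \<mu> \<nu> (normal_mon N) r (deg_shift N) (exp_shift N) (growth N) P (lead_const \<mu> r N)"
      by (intro allI leading_shift_normal_mon)
    from choice[OF this] obtain P where P: "leading_shift \<mu> \<nu> (normal_mon N) r (deg_shift N) (exp_shift N) (growth N) (P N) (lead_const \<mu> r N)" for N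
      by blast
    define Q where "Q = (\<Sum>N\<in>S1. smult (c N) (P N))"
    have root: "\<exists>m\<ge>a. poly Q (of_int m) = 0" for a :: int
    proof -
      \<comment> \<open>The second bound in the maximum makes the tested index \<open>k\<close>
        below negative.\<close>
      obtain m l g where m: "m \<ge> max a (- r - deg_shift N0 - d + 1)" and l: "l \<noteq> 0" and g: "leading r m l g"
        and z: "\<And>k j. k < 0 \<Longrightarrow> (\<Sum>N\<in>S. c N * rho \<mu> \<nu> (normal_mon N) g k j) = 0"
        using dense by blast
      define k j where "k = - (r + deg_shift N0) - (m + d)" and "j = m + d"
      have lN: "leading (r + deg_shift N) (m + exp_shift N) (poly (P N) (of_int m) * l) (rho \<mu> \<nu> (normal_mon N) g)" for N
        using P[of N] g unfolding leading_shift_def by blast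
      have "0 = (\<Sum>N\<in>S. c N * rho \<mu> \<nu> (normal_mon N) g k j)"
        using z[of k j] m by (simp add: k_def)
      also have "\<dots> = (\<Sum>N\<in>S1. c N * rho \<mu> \<nu> (normal_mon N) g k j)"
      proof (rule sum.mono_neutral_right)
        show "\<forall>N\<in>S - S1. c N * rho \<mu> \<nu> (normal_mon N) g k j = 0"
        proof
          fix N assume N: "N \<in> S - S1"
          show "c N * rho \<mu> \<nu> (normal_mon N) g k j = 0"
          proof (cases "N \<in> S0")
            case True
            then have "exp_shift N < d" using N le_d[of N] by (auto simp: S1_def)
            then have "rho \<mu> \<nu> (normal_mon N) g k j = 0"
              by (intro leadingD[OF lN]) (simp add: j_def)
            then show ?thesis by simp
          next
            case False
            then have "c N = 0 \<or> deg_shift N \<noteq> deg_shift N0" using N by (auto simp: S0_def)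
            moreover have "rho \<mu> \<nu> (normal_mon N) g k j = 0" if "deg_shift N \<noteq> deg_shift N0"
              using that by (intro leadingD[OF lN]) (simp add: j_def k_def)
            ultimately show ?thesis by auto
          qed
        qed
      qed (use fin in \<open>auto simp: S1_def S0_def\<close>)
      also have "\<dots> = (\<Sum>N\<in>S1. c N * poly (P N) (of_int m) * l)"
      proof (rule sum.cong[OF refl])
        fix N assume "N \<in> S1"
        then have "deg_shift N = deg_shift N0" "exp_shift N = d" by (auto simp: S1_def S0_def)
        then show "c N * rho \<mu> \<nu> (normal_mon N) g k j = c N * poly (P N) (of_int m) * l"
          using lN[of N] unfolding leading_def k_def j_def by simp
      qed
      finally have "poly Q (of_int m) * l = 0" by (simp add: Q_def poly_sum sum_distrib_right)
      then show ?thesis using m l by (intro exI[of _ m]) simp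
    qed
    \<comment> \<open>\<open>Q\<close> vanishes at arbitrarily large integers, so it would have
      infinitely many roots.\<close>
    have "Q = 0"
    proof (rule ccontr)
      assume "Q \<noteq> 0"
      then have "finite {x. poly Q x = 0}" by (rule poly_roots_finite)
      then have "finite ((of_int :: int \<Rightarrow> complex) -` {x. poly Q x = 0})"
        by (rule finite_vimageI) (simp add: inj_def)
      then obtain b where "\<And>m. poly Q (of_int m) = 0 \<Longrightarrow> m \<le> b"
        by (metis (mono_tags, lifting) Max_ge mem_Collect_eq vimageI)
      then show False using root[of "b + 1"] by force
    qed
    then have "0 = coeff Q \<delta>" by simp
    also have "\<dots> = (\<Sum>N\<in>S1. c N * coeff (P N) \<delta>)" by (simp add: Q_def coeff_sum)
    also have "\<dots> = (\<Sum>N\<in>S2. c N * coeff (P N) \<delta>)"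
    proof (rule sum.mono_neutral_right)
      show "\<forall>N\<in>S1 - S2. c N * coeff (P N) \<delta> = 0"
      proof
        fix N assume "N \<in> S1 - S2"
        then have "growth N < \<delta>" using le_\<delta>[of N] by (auto simp: S2_def)
        moreover have "degree (P N) \<le> growth N" using P[of N] by (simp add: leading_shift_def)
        ultimately show "c N * coeff (P N) \<delta> = 0" by (simp add: coeff_eq_0)
      qed
    qed (use S1 in \<open>auto simp: S2_def\<close>)
    also have "\<dots> = (\<Sum>N\<in>S2. c N * lead_const \<mu> r N)"
    proof (rule sum.cong[OF refl])
      fix N assume "N \<in> S2"
      then have "growth N = \<delta>" by (simp add: S2_def)
      then show "c N * coeff (P N) \<delta> = c N * lead_const \<mu> r N"
        using P[of N] by (simp add: leading_shift_def)
    qed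
    finally show ?thesis by simp
  qed
  have S2_eq: "deg_shift N = deg_shift N0 \<and> exp_shift N = d \<and> growth N = \<delta>" if "N \<in> S2" for N
    using that by (auto simp: S2_def S1_def S0_def)
  have S2_inj: "N = N'" if "N \<in> S2" "N' \<in> S2" "h_exp N = h_exp N'" for N N'
    using that S2_eq by (intro normal_index_eqI) auto
  obtain N1 where N1: "N1 \<in> S2" using S2 by blast
  then have c1: "c N1 \<noteq> 0" by (auto simp: S2_def S1_def S0_def)
  obtain p z k \<epsilon> q where N1_eq: "N1 = (p, z, k, \<epsilon>, q)" by (metis prod_cases5)
  define w where "w = (- 1 :: complex) ^ nat (- z) * 2 ^ of_bool \<epsilon>"
  \<comment> \<open>By \<open>normal_index_eqI\<close> an element of \<open>S2\<close> can differ
    from \<open>N1\<close> only in its power of \<open>uh\<close>; so \<open>w\<close> and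
    \<open>q\<close> are common to all of \<open>S2\<close>.\<close>
  have lc: "lead_const \<mu> r N = w * (\<mu> + 2 * of_int (r + int q)) ^ h_exp N" if N: "N \<in> S2" for N r
  proof -
    obtain p' z' k' \<epsilon>' q' where N_eq: "N = (p', z', k', \<epsilon>', q')" by (metis prod_cases5)
    have "(p', z', k, \<epsilon>', q') = N1"
      using S2_eq[OF N] S2_eq[OF N1] unfolding N1_eq by (intro normal_index_eqI) (auto simp: N_eq)
    then show ?thesis by (simp add: N_eq N1_eq w_def)
  qed
  \<comment> \<open>One coefficient for each element of \<open>S2\<close>, since
    \<open>h_exp\<close> is injective there; \<open>R\<close> will vanish at
    \<open>\<mu> + 2 * r\<close> for every integer \<open>r\<close>.\<close>
  define R where "R = (\<Sum>N\<in>S2. monom (c N) (h_exp N))"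
  have "poly R (\<mu> + 2 * of_int r) = 0" for r :: int
  proof -
    have "w * poly R (\<mu> + 2 * of_int r) = (\<Sum>N\<in>S2. c N * lead_const \<mu> (r - int q) N)"
      by (simp add: R_def poly_sum poly_monom sum_distrib_left lc algebra_simps)
    also have "\<dots> = 0" by (rule lead)
    finally show ?thesis by (simp add: w_def)
  qed
  then have "range (\<lambda>r::int. \<mu> + 2 * of_int r) \<subseteq> {x. poly R x = 0}" by auto
  moreover have "infinite (range (\<lambda>r::int. \<mu> + 2 * of_int r))"
    using finite_imageD[of "\<lambda>r::int. \<mu> + 2 * of_int r" UNIV] infinite_UNIV_int by (auto simp: inj_def)
  ultimately have "R = 0" using poly_roots_finite finite_subset by blast
  then have "0 = coeff R (h_exp N1)" by simp
  also have "\<dots> = (\<Sum>N\<in>S2. if N = N1 then c N else 0)"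
    unfolding R_def coeff_sum by (rule sum.cong) (use S2_inj N1 in \<open>auto simp: coeff_monom\<close>)
  also have "\<dots> = c N1" using N1 S2 by simp
  finally show False using c1 by simp
qed

section \<open>The localized action\<close>

text \<open>Division by \<open>uf\<close> is division by x, that is, a shift of
  \<open>k\<close>.\<close>

lift_definition rho_loc :: "complex \<Rightarrow> complex \<Rightarrow> Uf \<Rightarrow> (int \<Rightarrow> int \<Rightarrow> complex) \<Rightarrow> int \<Rightarrow> int \<Rightarrow> complex"
  is "\<lambda>\<mu> \<nu> (n, u) g k j. rho \<mu> \<nu> u g (k + int n) j"
proof (clarsimp simp: fun_eq_iff)
  fix \<mu> \<nu> a u b v g k j
  assume "loc_rel (a, u) (b, v)"
  then obtain m where "uf ^ (m + b) * u = uf ^ (m + a) * v" by (auto simp: loc_rel_def)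
  then have "rho \<mu> \<nu> (uf ^ (m + b) * u) g (k + int (m + a + b)) j = rho \<mu> \<nu> (uf ^ (m + a) * v) g (k + int (m + a + b)) j"
    by simp
  then show "rho \<mu> \<nu> u g (k + int a) j = rho \<mu> \<nu> v g (k + int b) j"
    by (simp add: rho_mult rho_uf_power algebra_simps)
qed

lemma rho_loc_abs: "rho_loc \<mu> \<nu> (abs_Uf (n, u)) g = (\<lambda>k j. rho \<mu> \<nu> u g (k + int n) j)"
  by (simp add: rho_loc.abs_eq)

lemma rho_loc_Uf_of: "rho_loc \<mu> \<nu> (Uf_of u) g = rho \<mu> \<nu> u g"
  by (simp add: Uf_of.abs_eq rho_loc_abs)

lemma rho_loc_add: "rho_loc \<mu> \<nu> (x + y) g = (\<lambda>k j. rho_loc \<mu> \<nu> x g k j + rho_loc \<mu> \<nu> y g k j)"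
proof -
  obtain n u v where "x = abs_Uf (n, u)" "y = abs_Uf (n, v)" by (rule Uf_common_denominator)
  then show ?thesis by (simp add: Uf_add_eq rho_loc_abs rho_add)
qed

lemma rho_loc_zero: "rho_loc \<mu> \<nu> 0 g = (\<lambda>k j. 0)"
  by (simp add: zero_Uf.abs_eq rho_loc_abs rho_zero)

lemma rho_loc_sum: "rho_loc \<mu> \<nu> (sum f A) g = (\<lambda>k j. \<Sum>i\<in>A. rho_loc \<mu> \<nu> (f i) g k j)"
  by (induction A rule: infinite_finite_induct) (simp_all add: rho_loc_zero rho_loc_add)

text \<open>With the Ore relation \<open>uf ^ m * u = w * uf ^ l\<close> both sides agree after
  \<open>uf ^ m\<close> is applied, and this acts injectively.\<close>

lemma rho_loc_Uf_of_mult: "rho_loc \<mu> \<nu> (Uf_of u * x) g = rho \<mu> \<nu> u (rho_loc \<mu> \<nu> x g)"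
proof -
  obtain l v where x: "x = abs_Uf (l, v)" by (rule Uf_cases)
  obtain m w where mw: "uf ^ m * u = w * uf ^ l" using f_ore by blast
  have "rho \<mu> \<nu> (uf ^ l) (rho_loc \<mu> \<nu> x g) = rho \<mu> \<nu> v g"
    by (simp add: rho_uf_power x rho_loc_abs)
  then have eq: "rho \<mu> \<nu> (uf ^ m * u) (rho_loc \<mu> \<nu> x g) = rho \<mu> \<nu> (w * v) g"
    by (simp add: mw rho_mult)
  have "rho \<mu> \<nu> u (rho_loc \<mu> \<nu> x g) k j = rho \<mu> \<nu> (w * v) g (k + int m) j" for k j
    using arg_cong[OF eq, of "\<lambda>F. F (k + int m) j"]
    by (simp add: rho_mult rho_uf_power)
  then show ?thesis
    by (simp add: x Uf_of.abs_eq Uf_times_eq[OF mw] rho_loc_abs fun_eq_iff)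
qed

lemma rho_loc_mult_Uf_of: "rho_loc \<mu> \<nu> (x * Uf_of u) g = rho_loc \<mu> \<nu> x (rho \<mu> \<nu> u g)"
proof -
  obtain l v where x: "x = abs_Uf (l, v)" by (rule Uf_cases)
  show ?thesis
    by (simp add: x Uf_of.abs_eq Uf_times_eq[where m = 0 and w = v] rho_loc_abs rho_mult)
qed

lemma rho_loc_linear: "rho_loc \<mu> \<nu> x (\<lambda>k j. c * g k j + h k j) = (\<lambda>k j. c * rho_loc \<mu> \<nu> x g k j + rho_loc \<mu> \<nu> x h k j)"
proof -
  obtain l v where x: "x = abs_Uf (l, v)" by (rule Uf_cases)
  show ?thesis by (simp add: x rho_loc_abs rho_linear)
qed

text \<open>Elements of the Verma module give regular functions; the coefficients at \<open>k < 0\<close> describe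
  the quotient \<open>U_(f)/U \<otimes> \<Delta>\<close>.\<close>

definition regular :: "(int \<Rightarrow> int \<Rightarrow> complex) \<Rightarrow> bool" where
  "regular g \<longleftrightarrow> (\<forall>k j. k < 0 \<longrightarrow> g k j = 0)"

definition delta :: "int \<Rightarrow> int \<Rightarrow> complex" where
  "delta k j = of_bool (k = 0 \<and> j = 0)"

text \<open>Derivatives can reach \<open>k < 0\<close> from \<open>k \<ge> 0\<close> only at
  \<open>k = - 1\<close> and \<open>k = - 2\<close>, where their factor \<open>k + 1\<close> or
  \<open>(k + 2) * (k + 1)\<close> is 0.\<close>

lemma rho_ug_regular:
  assumes "regular g"
  shows "regular (rho \<mu> \<nu> (ug a) g)"
proof -
  have "rho \<mu> \<nu> (ug a) g k j = 0" if "k < 0" for k j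
  proof -
    have "k = - 1 \<or> k = - 2 \<or> k < - 2" using that by arith
    then show ?thesis
      using assms by (elim disjE; cases a; simp add: rho_gen regular_def)
  qed
  then show ?thesis by (simp add: regular_def)
qed

lemma rho_regular: "regular g \<Longrightarrow> regular (rho \<mu> \<nu> u g)"
  by (erule rho_stable[rotated 3]) (simp_all add: rho_ug_regular, simp_all add: regular_def)

lemma regular_delta: "regular delta"
  by (simp add: regular_def delta_def)

lemma rho_uea_of:
  "rho \<mu> \<nu> (uea_of x) g = (\<lambda>k j.
      f_coord (part0 x) * g (k - 1) j
    + h_coord (part0 x) * ((\<mu> - 2 * of_int (k + j)) * g k j)
    + e_coord (part0 x) * (\<nu> * of_int (j + 1) * g k (j + 1) + of_int (k + 1) * (\<mu> - of_int (k + 2 * j)) * g (k + 1) j)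
    + f_coord (part1 x) * g k (j - 1)
    + h_coord (part1 x) * (\<nu> * g k j - 2 * of_int (k + 1) * g (k + 1) (j - 1))
    + e_coord (part1 x) * (\<nu> * of_int (k + 1) * g (k + 1) j - of_int ((k + 2) * (k + 1)) * g (k + 2) (j - 1)))"
  by (simp add: rho_def takiff_lift takiff_op.rep_eq)

text \<open>The series 1, here \<open>delta\<close>, is a highest weight vector of weight
  \<open>(\<mu>, \<nu>)\<close>. This makes coefficients respect the balancing relations of the
  Verma module.\<close>

lemma rho_borel_delta:
  "rho \<mu> \<nu> (borel_incl b) delta = (\<lambda>k j. uea_lift (borel_weight \<mu> \<nu>) b * delta k j)"
proof (induction b rule: uea_induct)
  case (gen x)
  have "f_coord (part0 (Rep_borel x)) = 0" "f_coord (part1 (Rep_borel x)) = 0"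
    using Rep_borel[of x] unfolding borel_eq by auto
  moreover have "x * of_int (j + 1) * delta k (j + 1) = 0" "of_int (k + 1) * x * delta (k + 1) j = 0"
    "x * of_int (k + 1) * delta (k + 1) j = 0"
    "(\<mu> - 2 * of_int (k + j)) * delta k j = \<mu> * delta k j" for x k j
    by (auto simp: delta_def add_eq_0_iff)
  moreover have "of_int ((k + 2) * (k + 1)) * delta (k + 2) j = 0" for k j
    by (cases "k = - 2") (auto simp: delta_def)
  ultimately show ?case
    unfolding rho_uea_of borel_incl_hom borel_weight_hom unfolding borel_weight_def
    by (intro ext) (simp only: mult_zero_left mult_zero_right add_0_left add_0_right diff_zero, simp add: algebra_simps)
next
  case (mult u v)
  then show ?case unfolding borel_incl_hom borel_weight_hom rho_mult by (simp only: rho_scale) (simp add: mult_ac)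
qed (simp_all add: borel_incl_hom borel_weight_hom rho_of_cx rho_add distrib_right)

section \<open>Evaluating the tensor products\<close>

definition frag_eval :: "('a \<Rightarrow> complex) \<Rightarrow> ('a \<Rightarrow>\<^sub>0 int) \<Rightarrow> complex" where
  "frag_eval G p = (\<Sum>x\<in>Poly_Mapping.keys p. of_int (Poly_Mapping.lookup p x) * G x)"

lemma frag_eval_superset:
  assumes "finite K" "Poly_Mapping.keys p \<subseteq> K"
  shows "frag_eval G p = (\<Sum>x\<in>K. of_int (Poly_Mapping.lookup p x) * G x)"
  unfolding frag_eval_def
  by (rule sum.mono_neutral_left) (use assms in \<open>auto simp: in_keys_iff\<close>)

lemma frag_eval_diff: "frag_eval G (p - q) = frag_eval G p - frag_eval G q"
proof -
  let ?K = "Poly_Mapping.keys p \<union> Poly_Mapping.keys q"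
  have "Poly_Mapping.keys (p - q) \<subseteq> ?K" by (rule keys_diff)
  then show ?thesis
    by (simp add: frag_eval_superset[of ?K] lookup_minus left_diff_distrib sum_subtractf)
qed

lemma frag_eval_zero [simp]: "frag_eval G 0 = 0"
  by (simp add: frag_eval_def)

lemma frag_eval_add: "frag_eval G (p + q) = frag_eval G p + frag_eval G q"
  using frag_eval_diff[of G "p + q" q] by simp

lemma frag_eval_of [simp]: "frag_eval G (frag_of x) = G x"
  by (simp add: frag_eval_def)

lemma frag_eval_add_span:
  "p \<in> add_span S \<Longrightarrow> (\<And>s. s \<in> S \<Longrightarrow> frag_eval G s = 0) \<Longrightarrow> frag_eval G p = 0"
  by (induction rule: add_span.induct) (simp_all add: frag_eval_diff)

section \<open>Coefficients of elements of a Verma module\<close>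

abbreviation verma_relations :: "complex \<Rightarrow> complex \<Rightarrow> (U \<times> complex \<Rightarrow>\<^sub>0 int) set" where
  "verma_relations \<mu> \<nu> \<equiv> tensor_relations (\<lambda>u b. u * borel_incl b) (weight_module \<mu> \<nu>)"

lemma verma_relationsI:
  "frag_of (u + v, c) - frag_of (u, c) - frag_of (v, c) \<in> verma_relations \<mu> \<nu>"
  "frag_of (u, c + d) - frag_of (u, c) - frag_of (u, d) \<in> verma_relations \<mu> \<nu>"
  "frag_of (u * borel_incl b, c) - frag_of (u, uea_lift (borel_weight \<mu> \<nu>) b * c) \<in> verma_relations \<mu> \<nu>"
  unfolding tensor_relations_def by (rule add_span.base; force simp: weight_module_def)+

definition verma_coeff :: "complex \<Rightarrow> complex \<Rightarrow> int \<Rightarrow> int \<Rightarrow> U \<times> complex \<Rightarrow> complex" where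
  "verma_coeff \<mu> \<nu> k j = (\<lambda>(u, c). c * rho \<mu> \<nu> u delta k j)"

lemma verma_coeff_relations: "p \<in> verma_relations \<mu> \<nu> \<Longrightarrow> frag_eval (verma_coeff \<mu> \<nu> k j) p = 0"
  unfolding tensor_relations_def
  by (erule frag_eval_add_span)
    (auto simp: frag_eval_diff verma_coeff_def weight_module_def rho_add distrib_left distrib_right
      rho_mult rho_borel_delta rho_scale)

text \<open>The representative is arbitrary; \<open>verma_val_coset\<close> shows that the choice
  does not matter.\<close>

definition verma_val :: "complex \<Rightarrow> complex \<Rightarrow> (U \<times> complex \<Rightarrow>\<^sub>0 int) set \<Rightarrow> int \<Rightarrow> int \<Rightarrow> complex" where
  "verma_val \<mu> \<nu> X k j = frag_eval (verma_coeff \<mu> \<nu> k j) (SOME p. p \<in> X)"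

lemma verma_val_coset:
  "verma_val \<mu> \<nu> (p +o verma_relations \<mu> \<nu>) = (\<lambda>k j. frag_eval (verma_coeff \<mu> \<nu> k j) p)"
proof (intro ext)
  fix k j
  have "p \<in> p +o verma_relations \<mu> \<nu>" unfolding tensor_relations_def by (rule mem_coset)
  then have "(SOME q. q \<in> p +o verma_relations \<mu> \<nu>) \<in> p +o verma_relations \<mu> \<nu>" by (rule someI)
  then obtain r where "r \<in> verma_relations \<mu> \<nu>" "(SOME q. q \<in> p +o verma_relations \<mu> \<nu>) = p + r"
    by (auto simp: elt_set_plus_def)
  then show "verma_val \<mu> \<nu> (p +o verma_relations \<mu> \<nu>) k j = frag_eval (verma_coeff \<mu> \<nu> k j) p"
    by (simp add: verma_val_def frag_eval_add verma_coeff_relations)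
qed

lemma Verma_carrierE:
  assumes "X \<in> mcarrier (Verma \<mu> \<nu>)"
  obtains p where "X = p +o verma_relations \<mu> \<nu>"
  using assms by (auto simp: Verma_def tensor_def)

lemma Verma_act:
  "mact (Verma \<mu> \<nu>) u (p +o verma_relations \<mu> \<nu>) = tensor_lmul (*) u p +o verma_relations \<mu> \<nu>"
  unfolding Verma_def by (rule tensor_is_left_module) (simp_all add: algebra_simps)

lemma Verma_zero: "mzero (Verma \<mu> \<nu>) = verma_relations \<mu> \<nu>"
  by (simp add: Verma_def tensor_def)

lemma Verma_madd:
  "madd (Verma \<mu> \<nu>) (p +o verma_relations \<mu> \<nu>) (q +o verma_relations \<mu> \<nu>) = (p + q) +o verma_relations \<mu> \<nu>"
  by (simp add: Verma_def tensor_def) (simp add: tensor_relations_def coset_add)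

lemma verma_val_add:
  "X \<in> mcarrier (Verma \<mu> \<nu>) \<Longrightarrow> Y \<in> mcarrier (Verma \<mu> \<nu>) \<Longrightarrow>
    verma_val \<mu> \<nu> (madd (Verma \<mu> \<nu>) X Y) = (\<lambda>k j. verma_val \<mu> \<nu> X k j + verma_val \<mu> \<nu> Y k j)"
  by (elim Verma_carrierE)
    (simp add: Verma_madd verma_val_coset frag_eval_add)

text \<open>This makes \<open>verma_val\<close> a homomorphism of modules into the formal
  series.\<close>

lemma frag_eval_lmul:
  "(\<lambda>k j. frag_eval (verma_coeff \<mu> \<nu> k j) (tensor_lmul (*) u p)) =
     rho \<mu> \<nu> u (\<lambda>k j. frag_eval (verma_coeff \<mu> \<nu> k j) p)"
proof (rule frag_induction[of p UNIV])
  fix x :: "U \<times> complex"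
  show "(\<lambda>k j. frag_eval (verma_coeff \<mu> \<nu> k j) (tensor_lmul (*) u (frag_of x))) =
     rho \<mu> \<nu> u (\<lambda>k j. frag_eval (verma_coeff \<mu> \<nu> k j) (frag_of x))"
    by (cases x) (simp add: tensor_lmul_def verma_coeff_def rho_mult rho_scale)
next
  fix p q :: "U \<times> complex \<Rightarrow>\<^sub>0 int"
  assume "(\<lambda>k j. frag_eval (verma_coeff \<mu> \<nu> k j) (tensor_lmul (*) u p)) = rho \<mu> \<nu> u (\<lambda>k j. frag_eval (verma_coeff \<mu> \<nu> k j) p)"
    "(\<lambda>k j. frag_eval (verma_coeff \<mu> \<nu> k j) (tensor_lmul (*) u q)) = rho \<mu> \<nu> u (\<lambda>k j. frag_eval (verma_coeff \<mu> \<nu> k j) q)"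
  then show "(\<lambda>k j. frag_eval (verma_coeff \<mu> \<nu> k j) (tensor_lmul (*) u (p - q))) = rho \<mu> \<nu> u (\<lambda>k j. frag_eval (verma_coeff \<mu> \<nu> k j) (p - q))"
    using rho_linear[of \<mu> \<nu> u "- 1" "\<lambda>k j. frag_eval (verma_coeff \<mu> \<nu> k j) q" "\<lambda>k j. frag_eval (verma_coeff \<mu> \<nu> k j) p"]
    by (simp add: tensor_lmul_def frag_extend_diff frag_eval_diff fun_eq_iff)
qed (simp_all add: tensor_lmul_def rho_zero_fn)

lemma verma_val_act:
  "X \<in> mcarrier (Verma \<mu> \<nu>) \<Longrightarrow> verma_val \<mu> \<nu> (mact (Verma \<mu> \<nu>) u X) = rho \<mu> \<nu> u (verma_val \<mu> \<nu> X)"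
  by (elim Verma_carrierE) (simp add: Verma_act verma_val_coset frag_eval_lmul)

lemma verma_val_regular: "X \<in> mcarrier (Verma \<mu> \<nu>) \<Longrightarrow> regular (verma_val \<mu> \<nu> X)"
proof (elim Verma_carrierE)
  fix p assume X: "X = p +o verma_relations \<mu> \<nu>"
  have "regular (rho \<mu> \<nu> u delta)" for u by (rule rho_regular[OF regular_delta])
  then have "verma_coeff \<mu> \<nu> k j x = 0" if "k < 0" for k j x
    using that by (cases x) (simp add: verma_coeff_def regular_def)
  then show "regular (verma_val \<mu> \<nu> X)"
    by (simp add: regular_def X verma_val_coset frag_eval_def)
qed

section \<open>Coefficients of elements of \<open>S_f \<otimes> Verma\<close>\<close>

abbreviation sf_relations :: "complex \<Rightarrow> complex \<Rightarrow> (Sf \<times> (U \<times> complex \<Rightarrow>\<^sub>0 int) set \<Rightarrow>\<^sub>0 int) set" where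
  "sf_relations \<mu> \<nu> \<equiv> tensor_relations Sf_right (Verma \<mu> \<nu>)"

text \<open>Meaningful only for \<open>k < 0\<close>: another representative of \<open>s\<close>
  differs by an element of \<open>U\<close>, which adds a regular series.\<close>

definition sf_coeff :: "complex \<Rightarrow> complex \<Rightarrow> int \<Rightarrow> int \<Rightarrow> Sf \<times> (U \<times> complex \<Rightarrow>\<^sub>0 int) set \<Rightarrow> complex" where
  "sf_coeff \<mu> \<nu> k j = (\<lambda>(s, X). rho_loc \<mu> \<nu> (rep_Sf s) (verma_val \<mu> \<nu> X) k j)"

lemma Sf_cases: obtains x where "s = abs_Sf x"
  using Quotient3_abs_rep[OF Quotient3_Sf, of s] by metis

lemma sf_coeff_abs:
  assumes "k < 0" "X \<in> mcarrier (Verma \<mu> \<nu>)"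
  shows "sf_coeff \<mu> \<nu> k j (abs_Sf x, X) = rho_loc \<mu> \<nu> x (verma_val \<mu> \<nu> X) k j"
proof -
  have "Sf_rel (rep_Sf (abs_Sf x)) x"
    by (rule Quotient3_rep_abs[OF Quotient3_Sf]) (simp add: Sf_rel_def, metis Uf_of_zero rangeI)
  then obtain u where "rep_Sf (abs_Sf x) = Uf_of u + x"
    by (auto simp: Sf_rel_def diff_eq_eq)
  moreover have "regular (rho \<mu> \<nu> u (verma_val \<mu> \<nu> X))"
    using assms by (intro rho_regular verma_val_regular)
  ultimately show ?thesis
    using assms by (simp add: sf_coeff_def rho_loc_add rho_loc_Uf_of regular_def)
qed

lemma sf_coeff_relations:
  assumes "p \<in> sf_relations \<mu> \<nu>" "k < 0"
  shows "frag_eval (sf_coeff \<mu> \<nu> k j) p = 0"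
  using assms(1) unfolding tensor_relations_def
proof (rule frag_eval_add_span)
  have M: "is_left_module (Verma \<mu> \<nu>)" by (rule Verma_is_left_module)
  have car: "madd (Verma \<mu> \<nu>) X Y \<in> mcarrier (Verma \<mu> \<nu>)" "mact (Verma \<mu> \<nu>) u X \<in> mcarrier (Verma \<mu> \<nu>)"
    if "X \<in> mcarrier (Verma \<mu> \<nu>)" "Y \<in> mcarrier (Verma \<mu> \<nu>)" for X Y u
    using M that by (simp_all add: is_left_module_def)
  fix s
  assume "s \<in> {frag_of (a + b, x) - frag_of (a, x) - frag_of (b, x) | a b x. x \<in> mcarrier (Verma \<mu> \<nu>)} \<union>
     {frag_of (a, madd (Verma \<mu> \<nu>) x y) - frag_of (a, x) - frag_of (a, y) | a x y.
        x \<in> mcarrier (Verma \<mu> \<nu>) \<and> y \<in> mcarrier (Verma \<mu> \<nu>)} \<union>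
     {frag_of (Sf_right a r, x) - frag_of (a, mact (Verma \<mu> \<nu>) r x) | a r x. x \<in> mcarrier (Verma \<mu> \<nu>)}"
  then consider a b X where "X \<in> mcarrier (Verma \<mu> \<nu>)" "s = frag_of (a + b, X) - frag_of (a, X) - frag_of (b, X)"
    | a X Y where "X \<in> mcarrier (Verma \<mu> \<nu>)" "Y \<in> mcarrier (Verma \<mu> \<nu>)"
        "s = frag_of (a, madd (Verma \<mu> \<nu>) X Y) - frag_of (a, X) - frag_of (a, Y)"
    | a r X where "X \<in> mcarrier (Verma \<mu> \<nu>)" "s = frag_of (Sf_right a r, X) - frag_of (a, mact (Verma \<mu> \<nu>) r X)"
    by blast
  then show "frag_eval (sf_coeff \<mu> \<nu> k j) s = 0"
  proof cases
    case 1
    obtain x y where "a = abs_Sf x" "b = abs_Sf y" by (metis Sf_cases)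
    then show ?thesis using 1 assms(2)
      by (simp add: frag_eval_diff plus_Sf.abs_eq sf_coeff_abs rho_loc_add)
  next
    case 2
    obtain x where "a = abs_Sf x" by (metis Sf_cases)
    then show ?thesis using 2 assms(2) car rho_loc_linear[of \<mu> \<nu> x 1]
      by (simp add: frag_eval_diff sf_coeff_abs verma_val_add)
  next
    case 3
    obtain x where "a = abs_Sf x" by (metis Sf_cases)
    then show ?thesis using 3 assms(2) car
      by (simp add: frag_eval_diff Sf_right.abs_eq sf_coeff_abs verma_val_act rho_loc_mult_Uf_of)
  qed
qed

section \<open>Annihilators of Verma modules\<close>

lemma coset_zero_iff: "p +o add_span R = add_span R \<longleftrightarrow> p \<in> add_span R"
  using coset_eq_iff[of p R 0] by simp

lemma verma_coset_zero_iff: "p +o verma_relations \<mu> \<nu> = verma_relations \<mu> \<nu> \<longleftrightarrow> p \<in> verma_relations \<mu> \<nu>"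
  unfolding tensor_relations_def by (rule coset_zero_iff)

lemma verma_relations_add: "p \<in> verma_relations \<mu> \<nu> \<Longrightarrow> q \<in> verma_relations \<mu> \<nu> \<Longrightarrow> p + q \<in> verma_relations \<mu> \<nu>"
  and verma_relations_diff: "p \<in> verma_relations \<mu> \<nu> \<Longrightarrow> q \<in> verma_relations \<mu> \<nu> \<Longrightarrow> p - q \<in> verma_relations \<mu> \<nu>"
  and verma_relations_zero: "0 \<in> verma_relations \<mu> \<nu>"
  unfolding tensor_relations_def by (rule add_span_add add_span.diff add_span.zero; assumption)+

text \<open>The left annihilator of the vectors \<open>1 \<otimes> c\<close>, kept at the level of
  relations.\<close>

definition verma_kill :: "complex \<Rightarrow> complex \<Rightarrow> U set" where
  "verma_kill \<mu> \<nu> = {w. \<forall>c. frag_of (w, c) \<in> verma_relations \<mu> \<nu>}"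

lemma verma_kill_add: "v \<in> verma_kill \<mu> \<nu> \<Longrightarrow> w \<in> verma_kill \<mu> \<nu> \<Longrightarrow> v + w \<in> verma_kill \<mu> \<nu>"
proof -
  assume "v \<in> verma_kill \<mu> \<nu>" "w \<in> verma_kill \<mu> \<nu>"
  then have "(frag_of (v + w, c) - frag_of (v, c) - frag_of (w, c)) + (frag_of (v, c) + frag_of (w, c)) \<in> verma_relations \<mu> \<nu>" for c
    by (intro verma_relations_add verma_relationsI) (simp_all add: verma_kill_def)
  then show ?thesis by (simp add: verma_kill_def)
qed

lemma verma_kill_borel:
  assumes "uea_lift (borel_weight \<mu> \<nu>) b = 0"
  shows "u * borel_incl b \<in> verma_kill \<mu> \<nu>"
proof -
  \<comment> \<open>\<open>u \<otimes> 0\<close> is zero, by additivity in the second argument at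
    \<open>0 + 0\<close>.\<close>
  have "0 - (frag_of (u, 0 + 0) - frag_of (u, 0) - frag_of (u, 0)) \<in> verma_relations \<mu> \<nu>"
    by (intro verma_relations_diff verma_relations_zero verma_relationsI)
  then have 0: "frag_of (u, 0) \<in> verma_relations \<mu> \<nu>" by simp
  have "frag_of (u * borel_incl b, c) \<in> verma_relations \<mu> \<nu>" for c
    using verma_relations_add[OF verma_relationsI(3)[of u b c] 0] assms by simp
  then show ?thesis by (simp add: verma_kill_def)
qed

lemma verma_kill_gen:
  "u * ue \<in> verma_kill \<mu> \<nu>" "u * ue_bar \<in> verma_kill \<mu> \<nu>"
  "u * (uh - of_cx \<mu>) \<in> verma_kill \<mu> \<nu>" "u * (uh_bar - of_cx \<nu>) \<in> verma_kill \<mu> \<nu>"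
proof -
  have r: "Rep_borel (Abs_borel t) = t" if "f_coord (part0 t) = 0" "f_coord (part1 t) = 0" for t
    using that by (intro Abs_borel_inverse) (simp only: borel_eq mem_Collect_eq)
  have b: "borel_incl (uea_of (Abs_borel t) + of_cx c) = uea_of t + of_cx c"
    "uea_lift (borel_weight \<mu> \<nu>) (uea_of (Abs_borel t) + of_cx c) =
      \<mu> * h_coord (part0 t) + \<nu> * h_coord (part1 t) + c"
    if "f_coord (part0 t) = 0" "f_coord (part1 t) = 0" for t c
    using that by (simp_all add: borel_incl_hom borel_weight_hom borel_weight_def r)
  have *: "u * (uea_of t + of_cx c) \<in> verma_kill \<mu> \<nu>"
    if "f_coord (part0 t) = 0" "f_coord (part1 t) = 0"
      "\<mu> * h_coord (part0 t) + \<nu> * h_coord (part1 t) + c = 0" for t c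
    using verma_kill_borel[of \<mu> \<nu> "uea_of (Abs_borel t) + of_cx c" u] that by (simp only: b)
  show "u * ue \<in> verma_kill \<mu> \<nu>" "u * ue_bar \<in> verma_kill \<mu> \<nu>"
    using *[of te 0] *[of te_bar 0] by (simp_all add: zero_sl2_def)
  show "u * (uh - of_cx \<mu>) \<in> verma_kill \<mu> \<nu>" "u * (uh_bar - of_cx \<nu>) \<in> verma_kill \<mu> \<nu>"
    using *[of th "- \<mu>"] *[of th_bar "- \<nu>"] by (simp_all add: zero_sl2_def of_cx_uminus)
qed

text \<open>Each difference is a left combination of \<open>ue\<close>, \<open>ue_bar\<close>,
  \<open>uh - of_cx \<mu>\<close> and \<open>uh_bar - of_cx \<nu>\<close>. The 2 in
  \<open>\<mu> + 2\<close> comes from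
  \<open>2 * (ue_bar * uf) = 2 * (uf * ue_bar) + 2 * uh_bar\<close>.\<close>

lemma casimir_verma_kill:
  "u * (casimir - of_cx (\<nu> * (\<mu> + 2))) \<in> verma_kill \<mu> \<nu>"
  "u * (casimir_bar - of_cx (\<nu> ^ 2)) \<in> verma_kill \<mu> \<nu>"
proof -
  have "casimir - of_cx (\<nu> * (\<mu> + 2)) =
      2 * uf_bar * ue + 2 * uf * ue_bar + uh_bar * (uh - of_cx \<mu>) + of_cx (\<mu> + 2) * (uh_bar - of_cx \<nu>)"
    using of_cx_central[of \<mu> uh_bar]
    by (simp add: casimir_eq uea_of_brackets of_cx_add of_cx_mult of_cx_numeral algebra_simps of_cx_central[of \<nu>])
  then have "u * (casimir - of_cx (\<nu> * (\<mu> + 2))) =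
      u * (2 * uf_bar) * ue + u * (2 * uf) * ue_bar + u * uh_bar * (uh - of_cx \<mu>)
        + u * of_cx (\<mu> + 2) * (uh_bar - of_cx \<nu>)"
    by (simp only: distrib_left mult.assoc)
  then show "u * (casimir - of_cx (\<nu> * (\<mu> + 2))) \<in> verma_kill \<mu> \<nu>"
    by (simp only:) (intro verma_kill_add verma_kill_gen)
  have "casimir_bar - of_cx (\<nu> ^ 2) = (uh_bar + of_cx \<nu>) * (uh_bar - of_cx \<nu>) + 4 * uf_bar * ue_bar"
    using of_cx_central[of \<nu> uh_bar]
    by (simp add: casimir_bar_eq of_cx_mult power2_eq_square algebra_simps)
  then have "u * (casimir_bar - of_cx (\<nu> ^ 2)) =
      u * (uh_bar + of_cx \<nu>) * (uh_bar - of_cx \<nu>) + u * (4 * uf_bar) * ue_bar"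
    using distrib_left[of u "(uh_bar + of_cx \<nu>) * (uh_bar - of_cx \<nu>)" "4 * uf_bar * ue_bar"]
    by (simp only: mult.assoc)
  then show "u * (casimir_bar - of_cx (\<nu> ^ 2)) \<in> verma_kill \<mu> \<nu>"
    by (simp only:) (intro verma_kill_add verma_kill_gen)
qed

text \<open>For central \<open>z\<close> one has \<open>z u \<otimes> c = u z \<otimes> c\<close>,
  which is zero by \<open>kill\<close>.\<close>

lemma central_annihilator_Verma:
  assumes z: "z \<in> center" and kill: "\<And>u. u * z \<in> verma_kill \<mu> \<nu>"
  shows "z \<in> annihilator (Verma \<mu> \<nu>)"
proof -
  have "tensor_lmul (*) z p \<in> verma_relations \<mu> \<nu>" for p
  proof (rule frag_induction[of p UNIV])
    fix x :: "U \<times> complex"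
    show "tensor_lmul (*) z (frag_of x) \<in> verma_relations \<mu> \<nu>"
      using kill z by (cases x) (simp add: tensor_lmul_def verma_kill_def center_def)
  qed (simp_all add: tensor_lmul_def frag_extend_diff verma_relations_diff verma_relations_zero)
  then have "mact (Verma \<mu> \<nu>) z X = mzero (Verma \<mu> \<nu>)" if "X \<in> mcarrier (Verma \<mu> \<nu>)" for X
    using that by (elim Verma_carrierE) (simp only: Verma_act Verma_zero verma_coset_zero_iff)
  then show ?thesis by (simp add: annihilator_def)
qed

section \<open>The generating vector and the passage of annihilators to the localization\<close>

definition verma_gen :: "complex \<Rightarrow> complex \<Rightarrow> (U \<times> complex \<Rightarrow>\<^sub>0 int) set" where
  "verma_gen \<mu> \<nu> = frag_of (1, 1) +o verma_relations \<mu> \<nu>"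

lemma verma_coset_carrier: "frag_of (u, c) +o verma_relations \<mu> \<nu> \<in> mcarrier (Verma \<mu> \<nu>)"
  by (auto simp: Verma_def tensor_def weight_module_def)

lemma verma_gen_carrier: "verma_gen \<mu> \<nu> \<in> mcarrier (Verma \<mu> \<nu>)"
  unfolding verma_gen_def by (rule verma_coset_carrier)

lemma verma_val_gen: "verma_val \<mu> \<nu> (verma_gen \<mu> \<nu>) = delta"
  by (simp add: verma_gen_def verma_val_coset verma_coeff_def rho_one)

lemma verma_gen_act: "mact (Verma \<mu> \<nu>) w (verma_gen \<mu> \<nu>) = frag_of (w, 1) +o verma_relations \<mu> \<nu>"
  by (simp add: verma_gen_def Verma_act tensor_lmul_def)

lemma annihilator_Verma_rho:
  assumes "u \<in> annihilator (Verma \<mu> \<nu>)"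
  shows "rho \<mu> \<nu> (u * v) delta = (\<lambda>k j. 0)"
proof -
  have "mact (Verma \<mu> \<nu>) u (frag_of (v, 1) +o verma_relations \<mu> \<nu>) = mzero (Verma \<mu> \<nu>)"
    using assms verma_coset_carrier[of v 1 \<mu> \<nu>] by (simp add: annihilator_def)
  then have "tensor_lmul (*) u (frag_of (v, 1)) +o verma_relations \<mu> \<nu> = verma_relations \<mu> \<nu>"
    by (simp only: Verma_act Verma_zero)
  then have "frag_of (u * v, 1) \<in> verma_relations \<mu> \<nu>"
    unfolding verma_coset_zero_iff by (simp add: tensor_lmul_def)
  from verma_coeff_relations[OF this] show ?thesis by (simp add: verma_coeff_def fun_eq_iff)
qed

text \<open>The annihilator is stable under \<open>ad f\<close>, which is locally nilpotent, so it survives localization.\<close>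

lemma rho_annihilator_loc:
  assumes "\<And>v. rho \<mu> \<nu> (u * v) delta = (\<lambda>k j. 0)"
  shows "rho \<mu> \<nu> u (rho_loc \<mu> \<nu> x delta) = (\<lambda>k j. 0)"
proof -
  obtain K v where x: "x = abs_Uf (K, v)" by (rule Uf_cases)
  obtain n where n: "(ad_f ^^ n) u = 0" using ad_f_nilpotent by blast
  \<comment> \<open>Induction on the denominator exponent \<open>K\<close> and, inside, on the
    nilpotency degree \<open>n\<close>: in \<open>f u g = u f g + ad_f u g\<close> the first term
    has a smaller denominator and the second a smaller \<open>n\<close>.\<close>
  have "rho \<mu> \<nu> u (rho_loc \<mu> \<nu> (abs_Uf (K, v)) delta) = (\<lambda>k j. 0)"
    if "(ad_f ^^ n) u = 0" "\<And>v. rho \<mu> \<nu> (u * v) delta = (\<lambda>k j. 0)" for n u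
    using that
  proof (induction K arbitrary: n u)
    case 0
    then show ?case by (simp add: rho_loc_abs rho_mult)
  next
    case (Suc K)
    note K = Suc.IH
    show ?case using Suc.prems
    proof (induction n arbitrary: u)
      case 0
      then show ?case by (simp add: rho_zero)
    next
      case (Suc n)
      let ?g = "rho_loc \<mu> \<nu> (abs_Uf (Suc K, v)) delta"
      have "rho \<mu> \<nu> (ad_f u * v) delta = (\<lambda>k j. 0)" for v
        using Suc.prems(2)[of v] Suc.prems(2)[of "uf * v"]
        by (simp add: ad_f_def left_diff_distrib mult.assoc rho_diff) (simp add: rho_mult rho_zero_fn)
      moreover have "(ad_f ^^ n) (ad_f u) = 0" using Suc.prems(1) by (simp add: funpow_swap1)
      ultimately have 1: "rho \<mu> \<nu> (ad_f u) ?g = (\<lambda>k j. 0)" by (intro Suc.IH)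
      have "rho \<mu> \<nu> uf ?g = rho_loc \<mu> \<nu> (abs_Uf (K, v)) delta"
        by (simp add: rho_gen rho_loc_abs)
      then have 2: "rho \<mu> \<nu> u (rho \<mu> \<nu> uf ?g) = (\<lambda>k j. 0)" using K[OF Suc.prems] by simp
      have "rho \<mu> \<nu> uf (rho \<mu> \<nu> u ?g) = (\<lambda>k j. 0)"
        using 1 2 by (simp add: ad_f_def rho_diff rho_mult fun_eq_iff)
      \<comment> \<open>\<open>uf\<close> acts as a shift, hence injectively.\<close>
      then have "rho \<mu> \<nu> u ?g (k + 1 - 1) j = 0" for k j unfolding rho_gen by metis
      then show ?case by (simp add: fun_eq_iff)
    qed
  qed
  then show ?thesis unfolding x using n assms by blast
qed

section \<open>Vectors in the completion\<close>

lemma sf_relationsI: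
  "X \<in> mcarrier (Verma \<mu> \<nu>) \<Longrightarrow> frag_of (a + b, X) - frag_of (a, X) - frag_of (b, X) \<in> sf_relations \<mu> \<nu>"
  "X \<in> mcarrier (Verma \<mu> \<nu>) \<Longrightarrow> Y \<in> mcarrier (Verma \<mu> \<nu>) \<Longrightarrow>
    frag_of (a, madd (Verma \<mu> \<nu>) X Y) - frag_of (a, X) - frag_of (a, Y) \<in> sf_relations \<mu> \<nu>"
  "X \<in> mcarrier (Verma \<mu> \<nu>) \<Longrightarrow> frag_of (Sf_right a r, X) - frag_of (a, mact (Verma \<mu> \<nu>) r X) \<in> sf_relations \<mu> \<nu>"
  unfolding tensor_relations_def by (rule add_span.base; blast)+

lemma sf_relations_add: "p \<in> sf_relations \<mu> \<nu> \<Longrightarrow> q \<in> sf_relations \<mu> \<nu> \<Longrightarrow> p + q \<in> sf_relations \<mu> \<nu>"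
  and sf_relations_diff: "p \<in> sf_relations \<mu> \<nu> \<Longrightarrow> q \<in> sf_relations \<mu> \<nu> \<Longrightarrow> p - q \<in> sf_relations \<mu> \<nu>"
  and sf_relations_zero: "0 \<in> sf_relations \<mu> \<nu>"
  unfolding tensor_relations_def by (rule add_span_add add_span.diff add_span.zero; assumption)+

lemma sf_coset_zero_iff: "p +o sf_relations \<mu> \<nu> = sf_relations \<mu> \<nu> \<longleftrightarrow> p \<in> sf_relations \<mu> \<nu>"
  unfolding tensor_relations_def by (rule coset_zero_iff)

lemma Sf_tensor_act:
  "mact (Sf_tensor (Verma \<mu> \<nu>)) u (p +o sf_relations \<mu> \<nu>) = tensor_lmul Sf_left u p +o sf_relations \<mu> \<nu>"
proof -
  have refl: "Sf_rel x x" for x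
    by (simp add: Sf_rel_def) (metis Uf_of_zero rangeI)
  show ?thesis
    unfolding Sf_tensor_def
    by (rule tensor_is_left_module;
        transfer; simp add: Uf_of_add Uf_of_mult Uf_of_one algebra_simps refl)
qed

lemma Sf_tensor_zero: "mzero (Sf_tensor (Verma \<mu> \<nu>)) = sf_relations \<mu> \<nu>"
  by (simp add: Sf_tensor_def tensor_def)

definition sf_frag :: "complex \<Rightarrow> complex \<Rightarrow> Uf \<Rightarrow> Sf \<times> (U \<times> complex \<Rightarrow>\<^sub>0 int) set \<Rightarrow>\<^sub>0 int" where
  "sf_frag \<mu> \<nu> x = frag_of (abs_Sf x, verma_gen \<mu> \<nu>)"

text \<open>All vectors needed have the form \<open>x \<otimes> v\<close> with the highest weight
  vector \<open>v\<close>. Identities between them become memberships in this subset of the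
  localization, which contains \<open>U\<close> and is stable under left multiplication by
  \<open>U\<close>.\<close>

definition loc_ker :: "complex \<Rightarrow> complex \<Rightarrow> Uf set" where
  "loc_ker \<mu> \<nu> = {x. sf_frag \<mu> \<nu> x \<in> sf_relations \<mu> \<nu>}"

lemma lmul_sf_frag: "tensor_lmul Sf_left u (sf_frag \<mu> \<nu> x) = sf_frag \<mu> \<nu> (Uf_of u * x)"
  by (simp add: sf_frag_def tensor_lmul_def Sf_left.abs_eq)

lemma loc_ker_rho:
  assumes "x \<in> loc_ker \<mu> \<nu>" "k < 0"
  shows "rho_loc \<mu> \<nu> x delta k j = 0"
proof -
  have "sf_coeff \<mu> \<nu> k j (abs_Sf x, verma_gen \<mu> \<nu>) = 0"
    using sf_coeff_relations[of "sf_frag \<mu> \<nu> x" \<mu> \<nu> k j] assms by (simp add: loc_ker_def sf_frag_def)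
  then show ?thesis using assms(2) verma_gen_carrier by (simp add: sf_coeff_abs verma_val_gen)
qed

lemma loc_ker_add:
  assumes "x \<in> loc_ker \<mu> \<nu>" "y \<in> loc_ker \<mu> \<nu>"
  shows "x + y \<in> loc_ker \<mu> \<nu>"
proof -
  have "sf_frag \<mu> \<nu> (x + y) - sf_frag \<mu> \<nu> x - sf_frag \<mu> \<nu> y \<in> sf_relations \<mu> \<nu>"
    unfolding sf_frag_def plus_Sf.abs_eq[symmetric] by (intro sf_relationsI verma_gen_carrier)
  from sf_relations_add[OF sf_relations_add[OF this, of "sf_frag \<mu> \<nu> x"], of "sf_frag \<mu> \<nu> y"]
  show ?thesis using assms by (simp add: loc_ker_def algebra_simps)
qed

lemma loc_ker_left: "x \<in> loc_ker \<mu> \<nu> \<Longrightarrow> Uf_of u * x \<in> loc_ker \<mu> \<nu>"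
proof -
  assume x: "x \<in> loc_ker \<mu> \<nu>"
  have "0 +o sf_relations \<mu> \<nu> = sf_relations \<mu> \<nu>" by simp
  then have "mact (Sf_tensor (Verma \<mu> \<nu>)) u (sf_relations \<mu> \<nu>) = sf_relations \<mu> \<nu>"
    using Sf_tensor_act[of \<mu> \<nu> u 0] by (simp add: tensor_lmul_def)
  then have "tensor_lmul Sf_left u (sf_frag \<mu> \<nu> x) +o sf_relations \<mu> \<nu> = sf_relations \<mu> \<nu>"
    using x Sf_tensor_act[of \<mu> \<nu> u "sf_frag \<mu> \<nu> x"] unfolding loc_ker_def mem_Collect_eq
    by (simp only: sf_coset_zero_iff[THEN iffD2])
  then show ?thesis unfolding sf_coset_zero_iff lmul_sf_frag by (simp add: loc_ker_def)
qed

lemma loc_ker_Uf_of: "Uf_of u \<in> loc_ker \<mu> \<nu>"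
proof -
  have "Sf_rel (Uf_of u) 0" by (simp add: Sf_rel_def)
  then have "abs_Sf (Uf_of u) = 0" by (simp add: zero_Sf_def Sf.abs_eq_iff)
  moreover have "0 - (frag_of (0 + 0, verma_gen \<mu> \<nu>) - frag_of (0, verma_gen \<mu> \<nu>) - frag_of (0, verma_gen \<mu> \<nu>)) \<in> sf_relations \<mu> \<nu>"
    by (intro sf_relations_diff sf_relations_zero sf_relationsI verma_gen_carrier)
  ultimately show ?thesis by (simp add: loc_ker_def sf_frag_def)
qed

lemma loc_ker_zero: "0 \<in> loc_ker \<mu> \<nu>"
  using loc_ker_Uf_of[of 0] by (simp add: Uf_of_zero)

lemma loc_ker_sum: "(\<And>i. i \<in> A \<Longrightarrow> f i \<in> loc_ker \<mu> \<nu>) \<Longrightarrow> sum f A \<in> loc_ker \<mu> \<nu>"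
  by (induction A rule: infinite_finite_induct) (simp_all add: loc_ker_zero loc_ker_add)

text \<open>\<open>x w \<otimes> v = x \<otimes> w v\<close> and \<open>w v = 0\<close>.\<close>

lemma loc_ker_right:
  assumes "w \<in> verma_kill \<mu> \<nu>"
  shows "x * Uf_of w \<in> loc_ker \<mu> \<nu>"
proof -
  let ?V = "Verma \<mu> \<nu>"
  have M: "is_left_module ?V" by (rule Verma_is_left_module)
  then have z: "mzero ?V \<in> mcarrier ?V" "madd ?V (mzero ?V) (mzero ?V) = mzero ?V"
    by (simp_all add: is_left_module_def)
  have "0 - (frag_of (abs_Sf x, madd ?V (mzero ?V) (mzero ?V)) - frag_of (abs_Sf x, mzero ?V) - frag_of (abs_Sf x, mzero ?V))
      \<in> sf_relations \<mu> \<nu>"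
    by (intro sf_relations_diff sf_relations_zero sf_relationsI z)
  then have 1: "frag_of (abs_Sf x, mzero ?V) \<in> sf_relations \<mu> \<nu>" using z by simp
  have kill: "mact ?V w (verma_gen \<mu> \<nu>) = mzero ?V"
    unfolding verma_gen_act Verma_zero verma_coset_zero_iff using assms by (simp add: verma_kill_def)
  have "frag_of (Sf_right (abs_Sf x) w, verma_gen \<mu> \<nu>) - frag_of (abs_Sf x, mzero ?V) \<in> sf_relations \<mu> \<nu>"
    using sf_relationsI(3)[OF verma_gen_carrier, of "abs_Sf x" w \<mu> \<nu>] unfolding kill .
  from sf_relations_add[OF this 1] show ?thesis
    by (simp add: loc_ker_def sf_frag_def Sf_right.abs_eq)
qed

section \<open>Finite-dimensional orbits of a single element and membership in
  \<open>EA\<close>\<close>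

lemma left_module_zero:
  assumes "is_left_module M" "x \<in> mcarrier M"
  shows "mact M 0 x = mzero M" "mact M r (mzero M) = mzero M"
proof -
  have cancel: "y = mzero M" if "y \<in> mcarrier M" "madd M y y = y" for y
    using assms(1) that unfolding is_left_module_def by metis
  have c: "mact M 0 x \<in> mcarrier M" "mact M r (mzero M) \<in> mcarrier M" "mzero M \<in> mcarrier M"
    "madd M (mzero M) (mzero M) = mzero M"
    using assms by (simp_all add: is_left_module_def)
  have "mact M (r + s) x = madd M (mact M r x) (mact M s x)" for r s
    using assms by (simp add: is_left_module_def)
  from this[of 0 0] have "mact M 0 x = madd M (mact M 0 x) (mact M 0 x)" by simp
  then show "mact M 0 x = mzero M" by (intro cancel c) simp
  have "mact M r (madd M y z) = madd M (mact M r y) (mact M r z)" if "y \<in> mcarrier M" "z \<in> mcarrier M" for y z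
    using assms(1) that by (simp add: is_left_module_def)
  from this[OF c(3) c(3)] have "mact M r (mzero M) = madd M (mact M r (mzero M)) (mact M r (mzero M))"
    unfolding c(4) .
  then show "mact M r (mzero M) = mzero M" by (intro cancel c) simp
qed

lemma polynomials_in_closed:
  "0 \<in> polynomials_in r" "r ^ i \<in> polynomials_in r"
  "p \<in> polynomials_in r \<Longrightarrow> q \<in> polynomials_in r \<Longrightarrow> p + q \<in> polynomials_in r"
  "p \<in> polynomials_in r \<Longrightarrow> of_cx c * p \<in> polynomials_in r"
proof -
  have I: "(\<Sum>i<n. of_cx (c i) * r ^ i) \<in> polynomials_in r" for c n
    unfolding polynomials_in_def by blast
  show "0 \<in> polynomials_in r" using I[of c 0 for c] by simp
  have "(\<Sum>k<Suc i. of_cx (if k = i then 1 else 0) * r ^ k) = r ^ i"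
    by (simp add: of_cx_one)
  with I[of "\<lambda>k. if k = i then 1 else 0" "Suc i"] show "r ^ i \<in> polynomials_in r" by (simp only:)
  assume "p \<in> polynomials_in r"
  then obtain n c' where p: "p = (\<Sum>i<n. of_cx (c' i) * r ^ i)" unfolding polynomials_in_def by blast
  have "of_cx c * p = (\<Sum>i<n. of_cx (c * c' i) * r ^ i)"
    by (simp add: p sum_distrib_left)
  then show "of_cx c * p \<in> polynomials_in r" by (simp only: I)
  assume "q \<in> polynomials_in r"
  then obtain m d where q: "q = (\<Sum>i<m. of_cx (d i) * r ^ i)" unfolding polynomials_in_def by blast
  \<comment> \<open>Padding with zero coefficients brings both sums to the common length
    \<open>max n m\<close>.\<close>
  have ext: "(\<Sum>i<n. of_cx (c i) * r ^ i) = (\<Sum>i<N. of_cx (if i < n then c i else 0) * r ^ i)" if "n \<le> N" for n N c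
    by (rule sum.mono_neutral_cong_left) (use that in auto)
  have "p + q = (\<Sum>i<max n m. of_cx ((if i < n then c' i else 0) + (if i < m then d i else 0)) * r ^ i)"
    unfolding p q ext[of n "max n m" c', OF max.cobounded1] ext[of m "max n m" d, OF max.cobounded2]
    by (simp add: sum.distrib[symmetric] of_cx_add distrib_right)
  then show "p + q \<in> polynomials_in r" by (simp only: I)
qed

text \<open>The vectors \<open>r ^ i x\<close> with \<open>i < K\<close> span the orbit, as all
  higher powers vanish. Since \<open>finite_dimensional\<close> asks for equality with a span, both
  inclusions are shown.\<close>

lemma nilpotent_finite_dimensional:
  assumes M: "is_left_module M" and x: "x \<in> mcarrier M" and K: "mact M (r ^ K) x = mzero M"
  shows "finite_dimensional M {mact M p x | p. p \<in> polynomials_in r}"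
proof -
  let ?B = "(\<lambda>i. mact M (r ^ i) x) ` {..<K}"
  have act: "mact M (r + s) x = madd M (mact M r x) (mact M s x)" "mact M (r * s) x = mact M r (mact M s x)" for r s
    using M x by (simp_all add: is_left_module_def)
  have "{mact M p x | p. p \<in> polynomials_in r} = complex_span M ?B"
  proof (intro equalityI subsetI)
    fix y assume "y \<in> {mact M p x | p. p \<in> polynomials_in r}"
    then obtain n c where y: "y = mact M (\<Sum>i<n. of_cx (c i) * r ^ i) x" unfolding polynomials_in_def by blast
    have "mact M (\<Sum>i<n. of_cx (c i) * r ^ i) x \<in> complex_span M ?B" for n
    proof (induction n)
      case 0
      then show ?case using left_module_zero(1)[OF M x] by (simp add: complex_span.zero)
    next
      case (Suc n)
      have "mact M (r ^ n) x \<in> complex_span M ?B"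
      proof (cases "n < K")
        case True
        then show ?thesis by (intro complex_span.base) simp
      next
        case False
        then have "mact M (r ^ n) x = mact M (r ^ (n - K)) (mact M (r ^ K) x)"
          by (simp add: act(2)[symmetric] power_add[symmetric])
        then show ?thesis using left_module_zero(2)[OF M x] K by (simp add: complex_span.zero)
      qed
      then show ?case using Suc by (simp add: act complex_span.add complex_span.scale)
    qed
    then show "y \<in> complex_span M ?B" by (simp add: y)
  next
    fix y assume "y \<in> complex_span M ?B"
    then show "y \<in> {mact M p x | p. p \<in> polynomials_in r}"
    proof induction
      case zero
      show ?case using left_module_zero(1)[OF M x] polynomials_in_closed(1)[of r] by force
    next
      case (base y)
      then show ?case using polynomials_in_closed(2)[of r] by blast
    next
      case (add y z)
      then obtain p q where "y = mact M p x" "z = mact M q x" "p \<in> polynomials_in r" "q \<in> polynomials_in r"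
        by blast
      then show ?case using polynomials_in_closed(3)[of p r q] act(1)[of p q] by (metis (mono_tags, lifting) mem_Collect_eq)
    next
      case (scale y c)
      then obtain p where "y = mact M p x" "p \<in> polynomials_in r" by blast
      then show ?case using polynomials_in_closed(4)[of p r c] act(2)[of "of_cx c" p] by (metis (mono_tags, lifting) mem_Collect_eq)
    qed
  qed
  then show ?thesis unfolding finite_dimensional_def by (intro exI[of _ ?B]) simp
qed

text \<open>A sufficient condition for \<open>x \<otimes> v\<close> to lie in
  \<open>EA\<close>.\<close>

definition e_nilpotent :: "complex \<Rightarrow> complex \<Rightarrow> Uf \<Rightarrow> bool" where
  "e_nilpotent \<mu> \<nu> x \<longleftrightarrow> (\<exists>K. Uf_of (ue ^ K) * x \<in> loc_ker \<mu> \<nu>)"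

lemma annihilator_EA_rho:
  assumes u: "u \<in> annihilator (EA (Verma \<mu> \<nu>))" and x: "e_nilpotent \<mu> \<nu> x" and k: "k < 0"
  shows "rho \<mu> \<nu> u (rho_loc \<mu> \<nu> x delta) k j = 0"
proof -
  let ?S = "Sf_tensor (Verma \<mu> \<nu>)"
  define X where "X = sf_frag \<mu> \<nu> x +o sf_relations \<mu> \<nu>"
  have act: "mact ?S w X = mzero ?S \<longleftrightarrow> Uf_of w * x \<in> loc_ker \<mu> \<nu>" for w
    unfolding X_def Sf_tensor_act lmul_sf_frag Sf_tensor_zero sf_coset_zero_iff by (simp add: loc_ker_def)
  have X: "X \<in> mcarrier ?S"
    using verma_gen_carrier unfolding X_def sf_frag_def Sf_tensor_def tensor_def by auto
  obtain K where "Uf_of (ue ^ K) * x \<in> loc_ker \<mu> \<nu>" using x by (auto simp: e_nilpotent_def)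
  then have "finite_dimensional ?S {mact ?S p X | p. p \<in> polynomials_in ue}"
    by (intro nilpotent_finite_dimensional[of _ _ _ K] Sf_tensor_is_left_module X) (simp add: act)
  then have "X \<in> mcarrier (EA (Verma \<mu> \<nu>))" using X by (simp add: EA_def)
  then have "mact ?S u X = mzero ?S" using u by (simp add: annihilator_def EA_def)
  then show ?thesis using loc_ker_rho[of "Uf_of u * x" \<mu> \<nu> k j] k by (simp add: act rho_loc_Uf_of_mult)
qed

lemma Uf_of_center_commute:
  assumes "z \<in> center"
  shows "Uf_of z * x = x * Uf_of z"
proof -
  obtain k u where x: "x = abs_Uf (k, u)" by (rule Uf_cases)
  have "uf ^ k * z = z * uf ^ k" "z * u = u * z" using assms by (simp_all add: center_def)
  then show ?thesis
    by (simp add: x Uf_of.abs_eq Uf_times_eq[where m = k and w = z] Uf_times_eq[where m = 0 and w = u])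
qed

text \<open>\<open>z s \<otimes> X = s z \<otimes> X = s \<otimes> z X = 0\<close> for central
  \<open>z\<close>.\<close>

lemma central_annihilator_Sf_tensor:
  assumes z: "z \<in> center" and ann: "z \<in> annihilator (Verma \<mu> \<nu>)"
  shows "z \<in> annihilator (Sf_tensor (Verma \<mu> \<nu>))"
proof -
  let ?V = "Verma \<mu> \<nu>"
  have "mact (Sf_tensor ?V) z X = mzero (Sf_tensor ?V)" if "X \<in> mcarrier (Sf_tensor ?V)" for X
  proof -
    have "\<exists>p. X = p +o sf_relations \<mu> \<nu> \<and> Poly_Mapping.keys p \<subseteq> UNIV \<times> mcarrier ?V"
      using that unfolding Sf_tensor_def tensor_def left_module.simps mem_Collect_eq .
    then obtain p where X: "X = p +o sf_relations \<mu> \<nu>" and p: "Poly_Mapping.keys p \<subseteq> UNIV \<times> mcarrier ?V"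
      by blast
    have "tensor_lmul Sf_left z p \<in> sf_relations \<mu> \<nu>"
    proof (rule frag_induction[OF p])
      fix y :: "Sf \<times> (U \<times> complex \<Rightarrow>\<^sub>0 int) set"
      assume "y \<in> UNIV \<times> mcarrier ?V"
      then obtain s X where y: "y = (s, X)" "X \<in> mcarrier ?V" by blast
      obtain x where s: "s = abs_Sf x" by (metis Sf_cases)
      have "Sf_left z s = Sf_right s z"
        by (simp add: s Sf_left.abs_eq Sf_right.abs_eq Uf_of_center_commute[OF z])
      moreover have "mact ?V z X = mzero ?V" using ann y(2) by (simp add: annihilator_def)
      moreover have "mzero ?V \<in> mcarrier ?V" "madd ?V (mzero ?V) (mzero ?V) = mzero ?V"
        using Verma_is_left_module[of \<mu> \<nu>] by (simp_all add: is_left_module_def)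
      then have "0 - (frag_of (s, madd ?V (mzero ?V) (mzero ?V)) - frag_of (s, mzero ?V) - frag_of (s, mzero ?V)) \<in> sf_relations \<mu> \<nu>"
        by (intro sf_relations_diff sf_relations_zero sf_relationsI)
      then have "frag_of (s, mzero ?V) \<in> sf_relations \<mu> \<nu>"
        using \<open>madd ?V (mzero ?V) (mzero ?V) = mzero ?V\<close> by simp
      ultimately show "tensor_lmul Sf_left z (frag_of y) \<in> sf_relations \<mu> \<nu>"
        using sf_relations_add[OF sf_relationsI(3)[OF y(2), of s z]] by (fastforce simp: y tensor_lmul_def)
    qed (simp_all add: tensor_lmul_def frag_extend_diff sf_relations_diff sf_relations_zero)
    then show ?thesis by (simp add: X Sf_tensor_act Sf_tensor_zero sf_coset_zero_iff)
  qed
  then show ?thesis by (simp add: annihilator_def)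
qed

section \<open>Highest weight vectors in the completion\<close>

text \<open>Leibniz rule: the iterated commutators of \<open>ue\<close> with \<open>uf_bar\<close>
  are \<open>uh_bar\<close>, \<open>- 2 * ue_bar\<close> and 0. What matters is the right factor
  \<open>ue ^ K\<close>, through which nilpotency passes from \<open>x\<close> to
  \<open>uf_bar * x\<close>.\<close>

lemma ue_uf_bar_power: "ue ^ (K + 2) * uf_bar =
  (uf_bar * ue ^ 2 + of_nat (K + 2) * (uh_bar * ue) - of_nat ((K + 2) * (K + 1)) * ue_bar) * ue ^ K"
proof (induction K)
  case 0
  have "ue * (ue * uf_bar) = uf_bar * (ue * ue) + 2 * (uh_bar * ue) - 2 * ue_bar"
    by (simp add: uea_of_brackets distrib_left uea_of_brackets_assoc mult_2)
  then show ?case by (simp add: power2_eq_square mult.assoc)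
next
  case (Suc K)
  have n: "ue * of_nat m = of_nat m * ue" "ue * (of_nat m * x) = of_nat m * (ue * x)" for m x
    by (metis mult_of_nat_commute mult.assoc)+
  have eq: "ue * (uf_bar * ue ^ 2 + of_nat (K + 2) * (uh_bar * ue) - of_nat ((K + 2) * (K + 1)) * ue_bar) =
      (uf_bar * ue ^ 2 + of_nat (Suc K + 2) * (uh_bar * ue) - of_nat ((Suc K + 2) * (Suc K + 1)) * ue_bar) * ue"
    by (simp add: power2_eq_square mult.assoc uea_of_brackets uea_of_brackets_assoc algebra_simps n mult_2)
  have "ue ^ (Suc K + 2) * uf_bar = ue * (ue ^ (K + 2) * uf_bar)" by (simp add: mult.assoc)
  also have "\<dots> = (ue * (uf_bar * ue ^ 2 + of_nat (K + 2) * (uh_bar * ue) - of_nat ((K + 2) * (K + 1)) * ue_bar)) * ue ^ K"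
    unfolding Suc by (simp only: mult.assoc)
  finally show ?case unfolding eq by (simp only: mult.assoc power_Suc)
qed

lemma e_nilpotent_uf_bar:
  assumes "e_nilpotent \<mu> \<nu> x"
  shows "e_nilpotent \<mu> \<nu> (Uf_of uf_bar * x)"
proof -
  obtain K where K: "Uf_of (ue ^ K) * x \<in> loc_ker \<mu> \<nu>" using assms by (auto simp: e_nilpotent_def)
  have "Uf_of (ue ^ (K + 2)) * (Uf_of uf_bar * x) =
    Uf_of (uf_bar * ue ^ 2 + of_nat (K + 2) * (uh_bar * ue) - of_nat ((K + 2) * (K + 1)) * ue_bar) * (Uf_of (ue ^ K) * x)"
    by (simp only: mult.assoc[symmetric] Uf_of_mult[symmetric] ue_uf_bar_power)
  then show ?thesis unfolding e_nilpotent_def using loc_ker_left[OF K] by metis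
qed

lemma uh_uf_bar_power: "uh * uf_bar ^ k = uf_bar ^ k * (uh - of_nat (2 * k))"
proof (induction k)
  case (Suc k)
  have "uh * uf_bar ^ Suc k = uf_bar * (uh * uf_bar ^ k) - 2 * uf_bar ^ Suc k"
    by (simp add: uea_of_brackets uea_of_brackets_assoc mult.assoc[symmetric] left_diff_distrib)
  then show ?case by (simp add: Suc algebra_simps mult_2 numeral_2_eq_2)
qed simp

text \<open>This is \<open>e f^(- k) = f^(- k - 1) (f e - k h - k (k + 1))\<close> without denominators.\<close>

lemma ue_uf_inverse_power:
  "uf ^ (k + 1) * ue = (uf * ue - of_nat k * uh - of_nat (k * (k + 1))) * uf ^ k"
proof (induction k)
  case (Suc k)
  have n: "uf * of_nat m = of_nat m * uf" "uf * (of_nat m * x) = of_nat m * (uf * x)" for m x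
    by (metis mult_of_nat_commute mult.assoc)+
  have eq: "uf * (uf * ue - of_nat k * uh - of_nat (k * (k + 1))) =
      (uf * ue - of_nat (Suc k) * uh - of_nat (Suc k * (Suc k + 1))) * uf"
    by (simp add: mult.assoc uea_of_brackets uea_of_brackets_assoc algebra_simps n mult_2)
  have "uf ^ (Suc k + 1) * ue = uf * (uf ^ (k + 1) * ue)" by (simp add: mult.assoc)
  also have "\<dots> = (uf * (uf * ue - of_nat k * uh - of_nat (k * (k + 1)))) * uf ^ k"
    unfolding Suc by (simp only: mult.assoc)
  finally show ?case unfolding eq by (simp only: mult.assoc power_Suc)
qed simp

text \<open>The commutator \<open>uh_bar\<close> of \<open>ue\<close> and \<open>uf_bar\<close>
  commutes with \<open>uf_bar\<close>. For \<open>j = 0\<close> the truncated exponent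
  \<open>j - 1\<close> comes with the coefficient 0.\<close>

lemma ue_uf_bar_power_right: "ue * uf_bar ^ j = uf_bar ^ j * ue + of_nat j * (uf_bar ^ (j - 1) * uh_bar)"
proof (induction j)
  case (Suc j)
  have c: "uh_bar * uf_bar ^ j = uf_bar ^ j * uh_bar" for j
    by (rule power_commuting_commutes[symmetric]) (simp add: uea_of_brackets)
  have n: "uf_bar * (of_nat m * x) = of_nat m * (uf_bar * x)" for m x
    by (metis mult_of_nat_commute mult.assoc)
  have "ue * uf_bar ^ Suc j = uf_bar * (ue * uf_bar ^ j) + uf_bar ^ j * uh_bar"
    by (simp add: uea_of_brackets mult.assoc[symmetric] distrib_right) (simp add: mult.assoc c)
  also have "uf_bar * (ue * uf_bar ^ j) = uf_bar ^ Suc j * ue + of_nat j * (uf_bar ^ j * uh_bar)"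
    unfolding Suc by (cases j) (simp_all add: distrib_left mult.assoc n del: of_nat_Suc)
  finally show ?case by (simp add: algebra_simps)
qed simp

section \<open>Monomials x^(- k) y^j and the singular vectors built from them\<close>

definition loc_mon :: "nat \<Rightarrow> nat \<Rightarrow> Uf" where
  "loc_mon k j = abs_Uf (k, uf_bar ^ j)"

text \<open>This is the differential operator of \<open>ue\<close> applied to x^(- k) y^j. It is
  proved in the tensor product itself, since \<open>loc_ker_rho\<close> makes vanishing coefficients
  only a necessary condition for membership in \<open>loc_ker\<close>.\<close>

lemma ue_loc_mon:
  "Uf_of ue * loc_mon k j
     + Uf_of (of_cx (of_nat k * (\<mu> - 2 * of_nat j + of_nat k + 1))) * loc_mon (k + 1) j
     - Uf_of (of_cx (of_nat j * \<nu>)) * loc_mon k (j - 1) \<in> loc_ker \<mu> \<nu>"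
proof -
  have oc: "of_nat n = (of_cx (of_nat n) :: U)" for n
    by (induction n) (simp_all add: of_cx_add of_cx_one)
  let ?w = "uf * ue - of_nat k * uh - of_nat (k * (k + 1))"
  have 1: "Uf_of ue * loc_mon k j = abs_Uf (k + 1, ?w * uf_bar ^ j)"
    using Uf_times_eq[OF ue_uf_inverse_power[of k], of 0 "uf_bar ^ j"]
    by (simp add: loc_mon_def Uf_of.abs_eq)
  have 2: "Uf_of (of_cx c) * abs_Uf (m, u) = abs_Uf (m, of_cx c * u)" for c m u
    by (simp add: Uf_of.abs_eq Uf_times_eq[where m = m and w = "of_cx c"] of_cx_central)
  have 3: "loc_mon k (j - 1) = abs_Uf (k + 1, uf * uf_bar ^ (j - 1))"
    unfolding loc_mon_def by (rule Uf_eqI[where m = 0]) (simp add: mult.assoc[symmetric] power_commutes)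
  have 4: "abs_Uf (m, u) - abs_Uf (m, v) = abs_Uf (m, u - v)" for m u v
    by (metis Uf_add_eq add_diff_cancel_right' diff_add_cancel)
  have 5: "abs_Uf (m, u * w) = abs_Uf (m, u) * Uf_of w" for m u w
    by (simp add: Uf_of.abs_eq Uf_times_eq[where m = 0 and w = u])
  \<comment> \<open>The numerator over the common denominator \<open>uf ^ (k + 1)\<close>: it is a
    left combination of \<open>ue\<close>, \<open>uh_bar - of_cx \<nu>\<close> and
    \<open>uh - of_cx \<mu>\<close>, which kill the highest weight vector.\<close>
  have "?w * uf_bar ^ j + of_cx (of_nat k * (\<mu> - 2 * of_nat j + of_nat k + 1)) * uf_bar ^ j
      - of_cx (of_nat j * \<nu>) * (uf * uf_bar ^ (j - 1)) =
    (uf * uf_bar ^ j) * ue + (of_cx (of_nat j) * (uf * uf_bar ^ (j - 1))) * (uh_bar - of_cx \<nu>)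
      + (of_cx (- of_nat k) * uf_bar ^ j) * (uh - of_cx \<mu>)" (is "?L = ?R")
  proof -
    have c: "uea_of x ^ i * of_cx d = of_cx d * uea_of x ^ i" "uea_of x * of_cx d = of_cx d * uea_of x" for x :: T and i d
      by (simp_all only: of_cx_central)
    have c': "uea_of x ^ i * (of_cx d * y) = of_cx d * (uea_of x ^ i * y)"
      "uea_of x * (of_cx d * y) = of_cx d * (uea_of x * y)" for x :: T and i d y
      by (simp_all only: of_cx_left_commute)
    have "?w * uf_bar ^ j = uf * (ue * uf_bar ^ j) - of_nat k * (uh * uf_bar ^ j) - of_nat (k * (k + 1)) * uf_bar ^ j"
      by (simp only: left_diff_distrib mult.assoc)
    also have "\<dots> = uf * (uf_bar ^ j * ue) + of_cx (of_nat j) * (uf * (uf_bar ^ (j - 1) * uh_bar))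
        - of_cx (of_nat k) * (uf_bar ^ j * uh) + of_cx (of_nat k * (2 * of_nat j)) * uf_bar ^ j
        - of_cx (of_nat k * (of_nat k + 1)) * uf_bar ^ j"
      unfolding uh_uf_bar_power ue_uf_bar_power_right oc
      by (simp add: algebra_simps c c')
    finally have L: "?L = uf * (uf_bar ^ j * ue) + of_cx (of_nat j) * (uf * (uf_bar ^ (j - 1) * uh_bar))
        - of_cx (of_nat k) * (uf_bar ^ j * uh) + of_cx (of_nat k * \<mu>) * uf_bar ^ j
      - of_cx (of_nat j * \<nu>) * (uf * uf_bar ^ (j - 1))"
      by (simp add: distrib_right left_diff_distrib of_cx_add of_cx_diff algebra_simps)
    show ?thesis unfolding L
      by (simp add: right_diff_distrib mult.assoc c c' of_cx_uminus)
  qed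
  then have "Uf_of ue * loc_mon k j
     + Uf_of (of_cx (of_nat k * (\<mu> - 2 * of_nat j + of_nat k + 1))) * loc_mon (k + 1) j
     - Uf_of (of_cx (of_nat j * \<nu>)) * loc_mon k (j - 1) = abs_Uf (k + 1, ?R)"
    unfolding 1 3 unfolding loc_mon_def 2 Uf_add_eq 4 by simp
  also have "\<dots> \<in> loc_ker \<mu> \<nu>"
    unfolding Uf_add_eq[symmetric] 5
    using verma_kill_gen[where u = 1 and \<mu> = \<mu> and \<nu> = \<nu>] by (intro loc_ker_add loc_ker_right) simp_all
  finally show ?thesis .
qed

text \<open>Chosen so that \<open>ue\<close> kills the sum of the terms
  \<open>hw_coeff n \<nu> d q\<close> x^(- d - q) y^q: the coefficient of x^(- d - q - 1) y^q in the
  image gives this recursion. It breaks off after \<open>q = d + n - 1\<close>, where the second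
  factor is 0.\<close>

primrec hw_coeff :: "int \<Rightarrow> complex \<Rightarrow> nat \<Rightarrow> nat \<Rightarrow> complex" where
  "hw_coeff n \<nu> d 0 = 1"
| "hw_coeff n \<nu> d (Suc q) = of_nat (d + q) * of_int (int d + n - 1 - int q) / (\<nu> * of_nat (Suc q)) * hw_coeff n \<nu> d q"

definition hw_vector :: "int \<Rightarrow> complex \<Rightarrow> nat \<Rightarrow> Uf" where
  "hw_vector n \<nu> d = (\<Sum>q\<le>nat (int d + n - 1). Uf_of (of_cx (hw_coeff n \<nu> d q)) * loc_mon (d + q) q)"

text \<open>The second factor of the recursion first vanishes at \<open>q = d + n - 1\<close>, and
  \<open>d \<ge> 1\<close> keeps \<open>d + q\<close> away from 0.\<close>

lemma hw_coeff_nonzero: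
  assumes "\<nu> \<noteq> 0" "d \<ge> 1"
  shows "int q \<le> int d + n - 1 \<Longrightarrow> hw_coeff n \<nu> d q \<noteq> 0"
proof (induction q)
  case (Suc q)
  have "of_int (int d + n - 1 - int q) \<noteq> (0 :: complex)" using Suc.prems unfolding of_int_eq_0_iff by linarith
  moreover have "of_nat (d + q) \<noteq> (0 :: complex)" using assms by (simp del: of_nat_add)
  moreover have "hw_coeff n \<nu> d q \<noteq> 0" using Suc by simp
  ultimately show ?case using assms by (simp del: of_int_diff of_int_add of_nat_add of_nat_Suc)
qed simp

text \<open>By the recursion one of the two terms produced by summand \<open>q\<close> cancels
  against one of summand \<open>q + 1\<close>, so the sum telescopes modulo
  \<open>loc_ker\<close>.\<close>

lemma hw_vector_ker:
  assumes nu: "\<nu> \<noteq> 0" and d: "int d + n \<ge> 1"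
  shows "Uf_of ue * hw_vector n \<nu> d \<in> loc_ker (of_int (n - 2)) \<nu>"
proof -
  let ?\<mu> = "of_int (n - 2) :: complex"
  define M where "M = nat (int d + n - 1)"
  define b where "b = hw_coeff n \<nu> d"
  \<comment> \<open>The part of the image of summand \<open>q\<close> that comes from
    \<open>\<nu> d/dy\<close>; the other part will be \<open>- g (Suc q)\<close>.\<close>
  define g where "g q = Uf_of (of_cx (b q * of_nat q * \<nu>)) * loc_mon (d + q) (q - 1)" for q
  define T where "T q = Uf_of ue * loc_mon (d + q) q
     + Uf_of (of_cx (of_nat (d + q) * (?\<mu> - 2 * of_nat q + of_nat (d + q) + 1))) * loc_mon (d + q + 1) q
     - Uf_of (of_cx (of_nat q * \<nu>)) * loc_mon (d + q) (q - 1)" for q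
  have T: "T q \<in> loc_ker ?\<mu> \<nu>" for q unfolding T_def by (rule ue_loc_mon)
  have b_Suc: "b (Suc q) * of_nat (Suc q) * \<nu> = b q * (of_nat (d + q) * of_int (int d + n - 1 - int q))" for q
    using nu by (simp add: b_def del: of_nat_Suc of_nat_add of_int_diff of_int_add) 
  have wt: "?\<mu> - 2 * of_nat q + of_nat (d + q) + 1 = of_int (int d + n - 1 - int q)" for q
    by simp
  have Uc: "Uf_of (of_cx c) * (Uf_of (of_cx c') * x) = Uf_of (of_cx (c * c')) * x" for c c' x
    by (simp add: mult.assoc[symmetric] Uf_of_mult[symmetric] of_cx_mult)
  have step: "Uf_of ue * (Uf_of (of_cx (b q)) * loc_mon (d + q) q) = Uf_of (of_cx (b q)) * T q + (g q - g (Suc q))" for q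
  proof -
    have "Uf_of ue * (Uf_of (of_cx (b q)) * loc_mon (d + q) q) = Uf_of (of_cx (b q)) * (Uf_of ue * loc_mon (d + q) q)"
      by (simp add: mult.assoc[symmetric] Uf_of_mult[symmetric] of_cx_central)
    moreover have "g (Suc q) = Uf_of (of_cx (b q)) *
        (Uf_of (of_cx (of_nat (d + q) * (?\<mu> - 2 * of_nat q + of_nat (d + q) + 1))) * loc_mon (d + q + 1) q)"
      unfolding g_def Uc b_Suc wt by simp
    moreover have "g q = Uf_of (of_cx (b q)) * (Uf_of (of_cx (of_nat q * \<nu>)) * loc_mon (d + q) (q - 1))"
      unfolding g_def Uc by (simp add: mult.assoc)
    ultimately show ?thesis
      unfolding T_def by (simp only: distrib_left right_diff_distrib) simp
  qed
  \<comment> \<open>The recursion gives 0 after the last summand, so both ends of the telescoping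
    sum vanish.\<close>
  have "(of_int (int d + n - 1 - int M) :: complex) = 0" using d by (simp add: M_def)
  then have z: "b (Suc M) * of_nat (Suc M) * \<nu> = 0" unfolding b_Suc by simp
  have "g (Suc M) = 0" unfolding g_def by (simp only: z of_cx_zero Uf_of_zero mult_zero_left)
  moreover have "g 0 = 0" by (simp add: g_def Uf_of_zero)
  ultimately have "(\<Sum>q\<le>M. g q - g (Suc q)) = 0" by (simp add: sum_telescope)
  then have "Uf_of ue * hw_vector n \<nu> d = (\<Sum>q\<le>M. Uf_of (of_cx (b q)) * T q)"
    unfolding hw_vector_def sum_distrib_left M_def[symmetric] b_def[symmetric]
    by (simp add: step sum.distrib)
  then show ?thesis using T by (simp add: loc_ker_sum loc_ker_left)
qed

lemma rho_loc_mon: "rho_loc \<mu> \<nu> (loc_mon m q) delta = (\<lambda>k j. delta (k + int m) (j - int q))"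
  by (simp add: loc_mon_def rho_loc_abs rho_uf_bar_power)

lemma hw_vector_leading:
  assumes d: "int d + n \<ge> 1"
  shows "leading (int d) (int d + n - 1) (hw_coeff n \<nu> d (nat (int d + n - 1)))
    (rho_loc \<mu> \<nu> (hw_vector n \<nu> d) delta)"
proof -
  define M where "M = nat (int d + n - 1)"
  have M: "int d + n - 1 = int M" using d by (simp add: M_def)
  have eq: "rho_loc \<mu> \<nu> (hw_vector n \<nu> d) delta =
      (\<lambda>k j. \<Sum>q\<le>M. hw_coeff n \<nu> d q * delta (k + int (d + q)) (j - int q))"
    by (simp add: hw_vector_def rho_loc_sum rho_loc_Uf_of_mult rho_of_cx rho_loc_mon M_def)
  show ?thesis
    unfolding eq M nat_int
  proof (rule leadingI)
    fix k j assume "\<not> (k + j = - int d \<and> j \<le> int M)"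
    then show "(\<Sum>q\<le>M. hw_coeff n \<nu> d q * delta (k + int (d + q)) (j - int q)) = 0"
      by (intro sum.neutral) (auto simp: delta_def)
  next
    have "(\<Sum>q\<le>M. hw_coeff n \<nu> d q * delta (- int d - int M + int (d + q)) (int M - int q)) =
        (\<Sum>q\<in>{M}. hw_coeff n \<nu> d q * delta (- int d - int M + int (d + q)) (int M - int q))"
      by (rule sum.mono_neutral_right) (auto simp: delta_def)
    also have "\<dots> = hw_coeff n \<nu> d M" by (simp add: delta_def)
    finally show "(\<Sum>q\<le>M. hw_coeff n \<nu> d q * delta (- int d - int M + int (d + q)) (int M - int q)) = hw_coeff n \<nu> d M" .
  qed
qed

text \<open>Each multiplication by \<open>uf_bar\<close> raises the total degree and the top
  y-exponent by 1 and preserves \<open>e_nilpotent\<close>. This makes the two numbers independent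
  of each other.\<close>

lemma hw_vector_shift:
  assumes nu: "\<nu> \<noteq> 0" and d: "int d + n \<ge> 1" "d \<ge> 1"
  shows "\<exists>x l. e_nilpotent (of_int (n - 2)) \<nu> x \<and> l \<noteq> 0 \<and>
    leading (int d - int a) (int d + n - 1 + int a) l (rho_loc (of_int (n - 2)) \<nu> x delta)"
proof (induction a)
  case 0
  have "e_nilpotent (of_int (n - 2)) \<nu> (hw_vector n \<nu> d)"
    unfolding e_nilpotent_def using hw_vector_ker[OF nu d(1)] by (intro exI[of _ 1]) simp
  moreover have "hw_coeff n \<nu> d (nat (int d + n - 1)) \<noteq> 0"
    using d by (intro hw_coeff_nonzero[OF nu d(2)]) simp
  moreover have "leading (int d - int 0) (int d + n - 1 + int 0) (hw_coeff n \<nu> d (nat (int d + n - 1)))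
      (rho_loc (of_int (n - 2)) \<nu> (hw_vector n \<nu> d) delta)"
    using hw_vector_leading[OF d(1)] by (simp del: of_int_diff)
  ultimately show ?case by blast
next
  case (Suc a)
  then obtain x l where x: "e_nilpotent (of_int (n - 2)) \<nu> x" "l \<noteq> 0"
    "leading (int d - int a) (int d + n - 1 + int a) l (rho_loc (of_int (n - 2)) \<nu> x delta)" by blast
  show ?case
    using e_nilpotent_uf_bar[OF x(1)] x(2) leading_gen(2)[OF x(3), of "of_int (n - 2)" \<nu>]
    by (intro exI[of _ "Uf_of uf_bar * x"] exI[of _ l]) (simp add: rho_loc_Uf_of_mult algebra_simps)
qed

lemma normal_mon_faithful:
  assumes nu: "\<nu> \<noteq> 0" and S: "finite S" "N0 \<in> S"
    and zero: "\<And>x k j. e_nilpotent (of_int (n - 2)) \<nu> x \<Longrightarrow> k < 0 \<Longrightarrow>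
      (\<Sum>N\<in>S. c N * rho (of_int (n - 2)) \<nu> (normal_mon N) (rho_loc (of_int (n - 2)) \<nu> x delta) k j) = 0"
  shows "c N0 = 0"
proof (rule normal_mon_independent[OF S(1) _ S(2)])
  fix r a :: int
  \<comment> \<open>With \<open>d = r + i\<close> and \<open>i\<close> factors \<open>uf_bar\<close>
    the total degree is \<open>- r\<close>, while the top exponent \<open>r + 2 i + n - 1\<close> is
    at least \<open>a\<close>.\<close>
  define i where "i = nat (\<bar>a\<bar> + \<bar>r\<bar> + \<bar>n\<bar> + 1)"
  define d where "d = nat (r + int i)"
  have d: "int d = r + int i" "int d + n \<ge> 1" "d \<ge> 1" unfolding d_def i_def by auto
  obtain x l where x: "e_nilpotent (of_int (n - 2)) \<nu> x" "l \<noteq> 0"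
    "leading (int d - int i) (int d + n - 1 + int i) l (rho_loc (of_int (n - 2)) \<nu> x delta)"
    using hw_vector_shift[OF nu d(2,3)] by blast
  moreover have "int d + n - 1 + int i \<ge> a" unfolding d(1) i_def by auto
  moreover have "int d - int i = r" using d(1) by simp
  ultimately show "\<exists>m\<ge>a. \<exists>l g. l \<noteq> 0 \<and> leading r m l g \<and>
      (\<forall>k<0. \<forall>j. (\<Sum>N\<in>S. c N * rho (of_int (n - 2)) \<nu> (normal_mon N) g k j) = 0)"
    using zero[OF x(1)] by blast
qed

section \<open>The central ideal\<close>

lemma left_ideal_zero: "0 \<in> left_ideal K"
  and left_ideal_add: "x \<in> left_ideal K \<Longrightarrow> y \<in> left_ideal K \<Longrightarrow> x + y \<in> left_ideal K"
  and left_ideal_diff: "x \<in> left_ideal K \<Longrightarrow> y \<in> left_ideal K \<Longrightarrow> x - y \<in> left_ideal K"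
  unfolding left_ideal_def by (rule add_span.zero add_span_add add_span.diff; assumption)+

lemma left_ideal_sum: "(\<And>i. i \<in> A \<Longrightarrow> f i \<in> left_ideal K) \<Longrightarrow> sum f A \<in> left_ideal K"
  by (induction A rule: infinite_finite_induct) (simp_all add: left_ideal_zero left_ideal_add)

lemma left_ideal_gen: "z \<in> K \<Longrightarrow> u * z \<in> left_ideal K"
  unfolding left_ideal_def by (rule add_span.base) blast

lemma left_ideal_base: "z \<in> K \<Longrightarrow> z \<in> left_ideal K"
  using left_ideal_gen[of z K 1] by simp

lemma left_ideal_least:
  assumes "x \<in> left_ideal K" "0 \<in> I" "\<And>x y. x \<in> I \<Longrightarrow> y \<in> I \<Longrightarrow> x - y \<in> I" "\<And>u z. z \<in> K \<Longrightarrow> u * z \<in> I"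
  shows "x \<in> I"
  using assms(1) unfolding left_ideal_def by induction (use assms in auto)

lemma left_ideal_mult: "x \<in> left_ideal K \<Longrightarrow> u * x \<in> left_ideal K"
proof -
  assume "x \<in> left_ideal K"
  then have "x \<in> {x. u * x \<in> left_ideal K}"
    by (rule left_ideal_least)
      (simp_all add: left_ideal_zero right_diff_distrib left_ideal_diff mult.assoc[symmetric] left_ideal_gen)
  then show ?thesis by simp
qed

lemma annihilator_left_ideal:
  assumes M: "is_left_module M" and K: "K \<subseteq> annihilator M"
  shows "left_ideal K \<subseteq> annihilator M"
proof
  fix x assume "x \<in> left_ideal K"
  then show "x \<in> annihilator M"
  proof (rule left_ideal_least)
    show "0 \<in> annihilator M" using left_module_zero(1)[OF M] by (simp add: annihilator_def)
    show "u * z \<in> annihilator M" if "z \<in> K" for u z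
    proof -
      have "mact M (u * z) y = mact M u (mact M z y)" if "y \<in> mcarrier M" for y
        using M that by (simp add: is_left_module_def)
      then show ?thesis using that K left_module_zero(2)[OF M] by (auto simp: annihilator_def)
    qed
    fix x y assume x: "x \<in> annihilator M" and y: "y \<in> annihilator M"
    \<comment> \<open>The module record has no subtraction, so the claim is read off from
      \<open>(x - y) m + y m = x m\<close>.\<close>
    have "mact M (x - y) m = mzero M" if m: "m \<in> mcarrier M" for m
    proof -
      have act: "mact M (r + s) m = madd M (mact M r m) (mact M s m)" "mact M r m \<in> mcarrier M" for r s
        using M m by (simp_all add: is_left_module_def)
      have 1: "madd M a (mzero M) = a" if "a \<in> mcarrier M" for a
        using M that unfolding is_left_module_def by metis
      have "mact M (x - y) m = madd M (mact M (x - y) m) (mact M y m)"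
        using y m 1[OF act(2)] by (simp add: annihilator_def)
      also have "\<dots> = mact M x m" by (simp add: act(1)[symmetric])
      finally show ?thesis using x m by (simp add: annihilator_def)
    qed
    then show "x - y \<in> annihilator M" by (simp add: annihilator_def)
  qed
qed

text \<open>Two explicit generators suffice for computations;
  \<open>char_ideal_eq_central_kernel\<close> identifies the ideal with the one generated by the
  kernel of the character.\<close>

definition char_ideal :: "complex \<Rightarrow> complex \<Rightarrow> U set" where
  "char_ideal a b = left_ideal {casimir - of_cx a, casimir_bar - of_cx b}"

lemma center_closed:
  fixes z w :: "'a::complex_algebra_1"
  shows "z \<in> center \<Longrightarrow> w \<in> center \<Longrightarrow> z + w \<in> center"
  "z \<in> center \<Longrightarrow> w \<in> center \<Longrightarrow> z - w \<in> center"
  "z \<in> center \<Longrightarrow> w \<in> center \<Longrightarrow> z * w \<in> center"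
  "of_cx c \<in> (center :: 'a set)"
proof -
  show "of_cx c \<in> (center :: 'a set)" by (simp only: center_def mem_Collect_eq of_cx_central) simp
  assume "z \<in> center" "w \<in> center"
  then have z: "z * x = x * z" "w * x = x * w" for x by (simp_all add: center_def)
  show "z + w \<in> center" "z - w \<in> center"
    by (simp_all add: center_def distrib_left distrib_right left_diff_distrib right_diff_distrib z)
  have "z * w * x = x * (z * w)" for x
    by (simp only: mult.assoc z(2)[of x]) (simp only: mult.assoc[symmetric] z(1)[of x])
  then show "z * w \<in> center" by (simp add: center_def)
qed

lemma center_power: "(z :: 'a::complex_algebra_1) \<in> center \<Longrightarrow> z ^ n \<in> center"
  using center_closed(4)[of 1, where 'a = 'a] by (induction n) (simp_all add: of_cx_one center_closed)

lemma mult_diff_of_cx: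
  "x * y - of_cx (a * b) = x * (y - of_cx b) + of_cx b * (x - of_cx a :: 'a::complex_algebra_1)"
proof -
  have "of_cx b * x = x * of_cx b" "of_cx b * of_cx a = (of_cx (a * b) :: 'a)"
    by (rule of_cx_central) (simp only: of_cx_mult[symmetric] mult.commute)
  then show ?thesis by (simp only: right_diff_distrib) simp
qed

lemma char_ideal_mult_diff:
  assumes "x - of_cx a \<in> char_ideal c d" "y - of_cx b \<in> char_ideal c d"
  shows "x * y - of_cx (a * b) \<in> char_ideal c d"
  unfolding mult_diff_of_cx using assms unfolding char_ideal_def by (intro left_ideal_add left_ideal_mult)

lemma char_ideal_casimir_power:
  "casimir ^ i * casimir_bar ^ j - of_cx (a ^ i * b ^ j) \<in> char_ideal a b"
proof -
  have 0: "1 - of_cx 1 \<in> char_ideal a b" by (simp add: char_ideal_def left_ideal_zero of_cx_one)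
  have "casimir - of_cx a \<in> char_ideal a b" "casimir_bar - of_cx b \<in> char_ideal a b"
    by (simp_all add: char_ideal_def left_ideal_base)
  then have "casimir ^ i - of_cx (a ^ i) \<in> char_ideal a b" "casimir_bar ^ j - of_cx (b ^ j) \<in> char_ideal a b"
    using 0 by (induction i) (simp_all add: char_ideal_mult_diff, induction j, simp_all add: char_ideal_mult_diff)
  then show ?thesis by (rule char_ideal_mult_diff)
qed

lemma char_ideal_casimir_mon:
  "casimir_mon (N, i, j) - of_cx (a ^ i * b ^ j) * normal_mon N \<in> char_ideal a b"
proof -
  have "casimir_mon (N, i, j) - of_cx (a ^ i * b ^ j) * normal_mon N =
      normal_mon N * (casimir ^ i * casimir_bar ^ j - of_cx (a ^ i * b ^ j))"
    by (simp only: casimir_mon.simps right_diff_distrib of_cx_central)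
  then show ?thesis using char_ideal_casimir_power left_ideal_mult unfolding char_ideal_def by metis
qed

definition eval_poly2 :: "nat \<Rightarrow> (nat \<Rightarrow> nat \<Rightarrow> complex) \<Rightarrow> complex \<Rightarrow> complex \<Rightarrow> complex" where
  "eval_poly2 B c a b = (\<Sum>i<B. \<Sum>j<B. c i j * (a ^ i * b ^ j))"

lemma rho_casimir_power: "rho \<mu> \<nu> (casimir ^ i * casimir_bar ^ j) g =
    (\<lambda>k l. (\<nu> * (\<mu> + 2)) ^ i * (\<nu> ^ 2) ^ j * g k l)"
proof -
  have 1: "rho \<mu> \<nu> (casimir_bar ^ j) g = (\<lambda>k l. (\<nu> ^ 2) ^ j * g k l)" for g
    by (induction j arbitrary: g) (simp_all add: rho_one rho_mult rho_casimir_bar mult.assoc)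
  have 2: "rho \<mu> \<nu> (casimir ^ i) g = (\<lambda>k l. (\<nu> * (\<mu> + 2)) ^ i * g k l)" for g
    by (induction i arbitrary: g) (simp_all add: rho_one rho_mult rho_casimir mult.assoc)
  show ?thesis by (simp add: rho_mult 1 2 mult.assoc)
qed

text \<open>The Casimir elements act by scalars, so every element acts as a combination of normal
  monomials whose coefficients are values of the polynomials \<open>c N\<close> at one
  point.\<close>

lemma rho_normal_form:
  "rho \<mu> \<nu> (\<Sum>N\<in>S. \<Sum>i<B. \<Sum>j<B. of_cx (c N i j) * casimir_mon (N, i, j)) g k l =
     (\<Sum>N\<in>S. eval_poly2 B (c N) (\<nu> * (\<mu> + 2)) (\<nu> ^ 2) * rho \<mu> \<nu> (normal_mon N) g k l)"
proof -
  have "rho \<mu> \<nu> (casimir_mon (N, i, j)) g k l = (\<nu> * (\<mu> + 2)) ^ i * (\<nu> ^ 2) ^ j * rho \<mu> \<nu> (normal_mon N) g k l" for N i j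
    unfolding casimir_mon.simps rho_mult[of _ _ "normal_mon N"] rho_casimir_power rho_scale ..
  then show ?thesis
    by (simp only: rho_sum rho_mult[of _ _ "of_cx _"] rho_of_cx eval_poly2_def sum_distrib_right mult.assoc)
qed

lemma char_ideal_normal_form:
  "(\<Sum>N\<in>S. \<Sum>i<B. \<Sum>j<B. of_cx (c N i j) * casimir_mon (N, i, j))
     - (\<Sum>N\<in>S. of_cx (eval_poly2 B (c N) a b) * normal_mon N) \<in> char_ideal a b"
proof -
  have "(\<Sum>N\<in>S. \<Sum>i<B. \<Sum>j<B. of_cx (c N i j) * casimir_mon (N, i, j))
     - (\<Sum>N\<in>S. of_cx (eval_poly2 B (c N) a b) * normal_mon N) =
    (\<Sum>N\<in>S. \<Sum>i<B. \<Sum>j<B. of_cx (c N i j) * (casimir_mon (N, i, j) - of_cx (a ^ i * b ^ j) * normal_mon N))"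
    by (simp only: eval_poly2_def of_cx_sum sum_distrib_right sum_subtractf[symmetric] right_diff_distrib
        of_cx_mult mult.assoc)
  also have "\<dots> \<in> char_ideal a b"
    using char_ideal_casimir_mon unfolding char_ideal_def by (intro left_ideal_sum left_ideal_mult)
  finally show ?thesis .
qed

text \<open>Modulo the ideal, \<open>u\<close> is the combination of normal monomials with the same
  coefficients by which it acts; these vanish by \<open>normal_mon_faithful\<close>.\<close>

lemma annihilating_in_char_ideal:
  assumes nu: "\<nu> \<noteq> 0"
    and zero: "\<And>x k j. e_nilpotent (of_int (n - 2)) \<nu> x \<Longrightarrow> k < 0 \<Longrightarrow>
      rho (of_int (n - 2)) \<nu> u (rho_loc (of_int (n - 2)) \<nu> x delta) k j = 0"
  shows "u \<in> char_ideal (of_int n * \<nu>) (\<nu> ^ 2)"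
proof -
  obtain S B c where S: "finite S" and u: "u = (\<Sum>N\<in>S. \<Sum>i<B. \<Sum>j<B. of_cx (c N i j) * casimir_mon (N, i, j))"
    by (rule uea_normal_form[of u])
  have a: "\<nu> * (of_int (n - 2) + 2) = of_int n * \<nu>" by simp
  have "eval_poly2 B (c N) (of_int n * \<nu>) (\<nu> ^ 2) = 0" if "N \<in> S" for N
    using zero unfolding u rho_normal_form a by (rule normal_mon_faithful[OF nu S that])
  then have "(\<Sum>N\<in>S. of_cx (eval_poly2 B (c N) (of_int n * \<nu>) (\<nu> ^ 2)) * normal_mon N) = 0"
    by (simp add: sum.neutral)
  then show ?thesis using char_ideal_normal_form[of c B S "of_int n * \<nu>" "\<nu> ^ 2"] unfolding u by simp
qed

section \<open>The center\<close>

text \<open>\<open>z\<close> preserves the \<open>uh\<close>-weight of the series 1, and among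
  series with nonnegative exponents only the constants have this weight.\<close>

lemma center_rho_delta:
  assumes "z \<in> center"
  shows "rho \<mu> \<nu> z delta = (\<lambda>k j. rho \<mu> \<nu> z delta 0 0 * delta k j)"
proof -
  \<comment> \<open>Support in the quadrant of nonnegative exponents, where \<open>k + j = 0\<close>
    forces \<open>k = 0\<close> and \<open>j = 0\<close>.\<close>
  define Q where "Q g \<longleftrightarrow> (\<forall>k j. k < 0 \<or> j < 0 \<longrightarrow> g k j = 0)" for g :: "int \<Rightarrow> int \<Rightarrow> complex"
  have Q: "Q (rho \<mu> \<nu> z delta)"
  proof (rule rho_stable)
    fix a g assume g: "Q g"
    have "rho \<mu> \<nu> (ug a) g k j = 0" if "j < 0" for k j
    proof -
      have "j = - 1 \<or> j < - 1" using that by arith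
      then show ?thesis using g by (elim disjE; cases a; simp add: rho_gen Q_def)
    qed
    moreover have "regular (rho \<mu> \<nu> (ug a) g)"
      by (rule rho_ug_regular) (use g in \<open>simp add: Q_def regular_def\<close>)
    ultimately show "Q (rho \<mu> \<nu> (ug a) g)" by (auto simp: Q_def regular_def)
  qed (auto simp: Q_def delta_def)
  have "rho \<mu> \<nu> (uh * z) delta = rho \<mu> \<nu> (z * uh) delta" using assms by (simp add: center_def)
  moreover have "rho \<mu> \<nu> uh delta = (\<lambda>k j. \<mu> * delta k j)"
    by (auto simp: rho_gen delta_def fun_eq_iff)
  ultimately have eq: "rho \<mu> \<nu> uh (rho \<mu> \<nu> z delta) = (\<lambda>k j. \<mu> * rho \<mu> \<nu> z delta k j)"
    by (simp add: rho_mult rho_scale)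
  have w: "of_int (k + j) * rho \<mu> \<nu> z delta k j = 0" for k j
  proof -
    have "(\<mu> - 2 * of_int (k + j)) * rho \<mu> \<nu> z delta k j = \<mu> * rho \<mu> \<nu> z delta k j"
      using eq[THEN fun_cong, THEN fun_cong, of k j] unfolding rho_gen .
    then have "2 * (of_int (k + j) * rho \<mu> \<nu> z delta k j) = 0"
      by (simp only: left_diff_distrib mult.assoc diff_eq_eq) simp
    then show ?thesis by (metis mult_eq_0_iff zero_neq_numeral)
  qed
  show ?thesis
  proof (intro ext)
    fix k j
    show "rho \<mu> \<nu> z delta k j = rho \<mu> \<nu> z delta 0 0 * delta k j"
    proof (cases "k = 0 \<and> j = 0")
      case False
      have "rho \<mu> \<nu> z delta k j = 0"
      proof (cases "k + j = 0")
        case True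
        then have "k < 0 \<or> j < 0" using False by linarith
        then show ?thesis using Q unfolding Q_def by blast
      next
        case False
        then have "of_int (k + j) \<noteq> (0 :: complex)" unfolding of_int_eq_0_iff .
        then show ?thesis using w[of k j] by (metis mult_eq_0_iff)
      qed
      then show ?thesis using False by (auto simp: delta_def)
    qed (simp add: delta_def)
  qed
qed

lemma center_rho_loc:
  assumes "z \<in> center"
  shows "rho \<mu> \<nu> z (rho_loc \<mu> \<nu> x delta) = (\<lambda>k j. rho \<mu> \<nu> z delta 0 0 * rho_loc \<mu> \<nu> x delta k j)"
proof -
  have "rho \<mu> \<nu> z (rho_loc \<mu> \<nu> x delta) = rho_loc \<mu> \<nu> x (rho \<mu> \<nu> z delta)"
    by (simp only: rho_loc_Uf_of_mult[symmetric] rho_loc_mult_Uf_of[symmetric] Uf_of_center_commute[OF assms])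
  also have "\<dots> = rho_loc \<mu> \<nu> x (\<lambda>k j. rho \<mu> \<nu> z delta 0 0 * delta k j + 0 * delta k j)"
    by (subst center_rho_delta[OF assms]) simp
  also have "\<dots> = (\<lambda>k j. rho \<mu> \<nu> z delta 0 0 * rho_loc \<mu> \<nu> x delta k j + rho_loc \<mu> \<nu> x (\<lambda>k j. 0 * delta k j) k j)"
    by (rule rho_loc_linear)
  also have "rho_loc \<mu> \<nu> x (\<lambda>k j. 0 * delta k j) = (\<lambda>k j. 0)"
    using rho_loc_linear[of \<mu> \<nu> x "- 1" "\<lambda>k j. 0" "\<lambda>k j. 0"] by (simp add: fun_eq_iff)
  finally show ?thesis by simp
qed

text \<open>The points \<open>(n * \<nu>, \<nu> ^ 2)\<close> are Zariski dense: for fixed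
  \<open>\<nu>\<close> there are infinitely many \<open>n\<close>, and every nonzero number is a
  square \<open>\<nu> ^ 2\<close>.\<close>

lemma eval_poly2_eq_0:
  assumes "\<And>(n::int) \<nu>. \<nu> \<noteq> 0 \<Longrightarrow> eval_poly2 B c (of_int n * \<nu>) (\<nu> ^ 2) = 0" and "i < B" "j < B"
  shows "c i j = 0"
proof -
  define Q where "Q = (\<Sum>j<B. monom (c i j) j)"
  have "poly Q w = 0" if "w \<noteq> 0" for w
  proof -
    define \<nu> where "\<nu> = csqrt w"
    have nu: "\<nu> \<noteq> 0" "\<nu> ^ 2 = w" using that by (simp_all add: \<nu>_def)
    define P where "P = (\<Sum>i<B. monom (\<nu> ^ i * (\<Sum>j<B. c i j * w ^ j)) i)"
    have "poly P (of_int n) = 0" for n :: int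
    proof -
      have "poly P (of_int n) = eval_poly2 B c (of_int n * \<nu>) (\<nu> ^ 2)"
        unfolding P_def eval_poly2_def nu(2) poly_sum poly_monom
        by (rule sum.cong[OF refl]) (simp add: sum_distrib_left sum_distrib_right power_mult_distrib mult_ac)
      then show ?thesis using assms(1)[OF nu(1)] by simp
    qed
    then have "range (of_int :: int \<Rightarrow> complex) \<subseteq> {x. poly P x = 0}" by auto
    moreover have "infinite (range (of_int :: int \<Rightarrow> complex))"
      using finite_imageD[of "of_int :: int \<Rightarrow> complex" UNIV] infinite_UNIV_int by (auto simp: inj_def)
    ultimately have "P = 0" using poly_roots_finite finite_subset by blast
    then have "0 = coeff P i" by simp
    also have "\<dots> = \<nu> ^ i * (\<Sum>j<B. c i j * w ^ j)"
      using assms(2) by (simp add: P_def coeff_sum coeff_monom)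
    finally show ?thesis using nu(1) by (simp add: Q_def poly_sum poly_monom)
  qed
  then have "UNIV - {0} \<subseteq> {x. poly Q x = 0}" by auto
  moreover have "infinite (UNIV - {0 :: complex})" by (simp add: infinite_UNIV_char_0)
  ultimately have "Q = 0" using poly_roots_finite finite_subset by blast
  then have "0 = coeff Q j" by simp
  also have "\<dots> = c i j" using assms(3) by (simp add: Q_def coeff_sum coeff_monom)
  finally show ?thesis by simp
qed

text \<open>After subtraction of the scalar by which \<open>z\<close> acts, faithfulness makes the
  coefficient polynomials of all nontrivial normal monomials vanish at the points
  \<open>(n * \<nu>, \<nu> ^ 2)\<close>, hence identically.\<close>

lemma center_polynomial:
  assumes z: "z \<in> center"
  obtains B c where "z = (\<Sum>i<B. \<Sum>j<B. of_cx (c i j) * (casimir ^ i * casimir_bar ^ j))"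
proof -
  let ?N1 = "(0, 0, 0, False, 0) :: normal_index"
  obtain S B c where S: "finite S" "?N1 \<in> S"
    and z_eq: "z = (\<Sum>N\<in>S. \<Sum>i<B. \<Sum>j<B. of_cx (c N i j) * casimir_mon (N, i, j))"
    by (rule uea_normal_form[of z])
  have N1: "normal_mon ?N1 = 1" by simp
  have zero: "eval_poly2 B (c N) (of_int n * \<nu>) (\<nu> ^ 2) = 0" if N: "N \<in> S" "N \<noteq> ?N1" and nu: "\<nu> \<noteq> 0" for N n \<nu>
  proof -
    let ?\<mu> = "of_int (n - 2) :: complex"
    define s where "s = rho ?\<mu> \<nu> z delta 0 0"
    \<comment> \<open>The coefficients of \<open>z - s\<close>: the scalar is subtracted at the
      trivial monomial.\<close>
    define g where "g N = eval_poly2 B (c N) (\<nu> * (?\<mu> + 2)) (\<nu> ^ 2) - (if N = ?N1 then s else 0)" for N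
    have "(\<Sum>N\<in>S. g N * rho ?\<mu> \<nu> (normal_mon N) G k j) = 0"
      if G: "G = rho_loc ?\<mu> \<nu> x delta" for x k j G
    proof -
      have "(\<Sum>N\<in>S. g N * rho ?\<mu> \<nu> (normal_mon N) G k j) =
          rho ?\<mu> \<nu> z G k j - (\<Sum>N\<in>S. (if N = ?N1 then s else 0) * rho ?\<mu> \<nu> (normal_mon N) G k j)"
        unfolding z_eq rho_normal_form by (simp only: g_def left_diff_distrib sum_subtractf)
      also have "(\<Sum>N\<in>S. (if N = ?N1 then s else 0) * rho ?\<mu> \<nu> (normal_mon N) G k j) =
          (\<Sum>N\<in>S. if N = ?N1 then s * G k j else 0)"
        by (rule sum.cong) (use N1 in \<open>auto simp: rho_one\<close>)
      also have "\<dots> = s * G k j" using S by simp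
      also have "rho ?\<mu> \<nu> z G k j = s * G k j"
        unfolding G center_rho_loc[OF z] s_def ..
      finally show ?thesis by simp
    qed
    then have "g N = 0" by (intro normal_mon_faithful[OF nu S(1) N(1)]) blast
    then show ?thesis using N(2) by (simp add: g_def mult.commute)
  qed
  have "z = (\<Sum>N\<in>{?N1}. \<Sum>i<B. \<Sum>j<B. of_cx (c N i j) * casimir_mon (N, i, j))"
    unfolding z_eq
  proof (rule sum.mono_neutral_right)
    show "\<forall>N\<in>S - {?N1}. (\<Sum>i<B. \<Sum>j<B. of_cx (c N i j) * casimir_mon (N, i, j)) = 0"
    proof
      fix N assume "N \<in> S - {?N1}"
      then have "c N i j = 0" if "i < B" "j < B" for i j
        using that zero by (intro eval_poly2_eq_0[of B "c N"]) auto
      then show "(\<Sum>i<B. \<Sum>j<B. of_cx (c N i j) * casimir_mon (N, i, j)) = 0"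
        by (intro sum.neutral ballI) simp
    qed
  qed (use S in auto)
  then have "z = (\<Sum>i<B. \<Sum>j<B. of_cx (c ?N1 i j) * (casimir ^ i * casimir_bar ^ j))" by simp
  then show thesis by (rule that)
qed

lemma char_ideal_center:
  "(\<Sum>i<B. \<Sum>j<B. of_cx (c i j) * (casimir ^ i * casimir_bar ^ j)) - of_cx (eval_poly2 B c a b) \<in> char_ideal a b"
proof -
  have "(\<Sum>i<B. \<Sum>j<B. of_cx (c i j) * (casimir ^ i * casimir_bar ^ j)) - of_cx (eval_poly2 B c a b) =
    (\<Sum>i<B. \<Sum>j<B. of_cx (c i j) * (casimir ^ i * casimir_bar ^ j - of_cx (a ^ i * b ^ j)))"
    by (simp only: eval_poly2_def of_cx_sum sum_subtractf[symmetric] right_diff_distrib of_cx_mult)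
  then show ?thesis
    using char_ideal_casimir_power unfolding char_ideal_def by (simp only:) (intro left_ideal_sum left_ideal_mult)
qed

section \<open>Central characters\<close>

text \<open>The character is the scalar by which a central element acts on the highest weight
  vector.\<close>

lemma central_character_exists: "\<exists>\<chi>. central_character (\<nu> * (\<mu> + 2)) (\<nu> ^ 2) \<chi>"
proof
  let ?\<chi> = "\<lambda>z. rho \<mu> \<nu> z delta 0 0"
  have d: "delta 0 0 = 1" by (simp add: delta_def)
  have "?\<chi> (z * w) = ?\<chi> z * ?\<chi> w" if z: "z \<in> center" "w \<in> center" for z w
    unfolding rho_mult by (subst center_rho_delta[OF z(2)]) (simp add: rho_scale)
  then show "central_character (\<nu> * (\<mu> + 2)) (\<nu> ^ 2) ?\<chi>"
    by (simp add: central_character_def rho_add rho_of_cx rho_casimir rho_casimir_bar d)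
qed

lemma central_character_eval:
  assumes chi: "central_character a b \<chi>"
  shows "\<chi> (\<Sum>i<B. \<Sum>j<B. of_cx (c i j) * (casimir ^ i * casimir_bar ^ j)) = eval_poly2 B c a b"
proof -
  have add: "\<chi> (z + w) = \<chi> z + \<chi> w" and mult: "\<chi> (z * w) = \<chi> z * \<chi> w" if "z \<in> center" "w \<in> center" for z w
    using chi that by (simp_all add: central_character_def)
  have const: "\<chi> (of_cx c) = c" and cas: "\<chi> casimir = a" "\<chi> casimir_bar = b" for c
    using chi by (simp_all add: central_character_def)
  have zc: "(0 :: U) \<in> center" using center_closed(4)[of 0] by simp
  have z: "\<chi> 0 = 0" using const[of 0] by simp
  have pow: "\<chi> (z ^ n) = \<chi> z ^ n" if "z \<in> center" for z n
    using that const[of 1] by (induction n) (simp_all add: of_cx_one mult center_power)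
  \<comment> \<open>Membership in the center is carried through the induction, because
    \<open>\<chi>\<close> is known to be additive only there.\<close>
  have "sum f A \<in> center \<and> \<chi> (sum f A) = (\<Sum>i\<in>A. \<chi> (f i))" if "\<And>i. f i \<in> center" for f :: "nat \<Rightarrow> U" and A
    by (induction A rule: infinite_finite_induct) (simp_all add: zc z that add center_closed)
  then have sum: "sum f A \<in> center" "\<chi> (sum f A) = (\<Sum>i\<in>A. \<chi> (f i))" if "\<And>i. f i \<in> center" for f :: "nat \<Rightarrow> U" and A
    using that by blast+
  show ?thesis
    unfolding eval_poly2_def
    by (simp add: sum mult pow const cas casimir_center center_closed center_power)
qed

text \<open>A kernel element is a polynomial in the two Casimir elements, congruent modulo
  \<open>char_ideal\<close> to its value under \<open>\<chi>\<close>, which is 0. Conversely both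
  generators lie in the kernel.\<close>

lemma char_ideal_eq_central_kernel:
  assumes chi: "central_character a b \<chi>"
  shows "left_ideal (central_kernel \<chi>) = char_ideal a b"
proof (intro equalityI subsetI)
  fix x assume "x \<in> left_ideal (central_kernel \<chi>)"
  then show "x \<in> char_ideal a b"
  proof (rule left_ideal_least)
    fix u z assume "z \<in> central_kernel \<chi>"
    then have z: "z \<in> center" "\<chi> z = 0" by (simp_all add: central_kernel_def)
    obtain B c where zp: "z = (\<Sum>i<B. \<Sum>j<B. of_cx (c i j) * (casimir ^ i * casimir_bar ^ j))"
      using z(1) by (rule center_polynomial)
    then have "eval_poly2 B c a b = 0" using central_character_eval[OF chi, of c B] z(2) by simp
    then have "z \<in> char_ideal a b" using char_ideal_center[of c B a b] zp by simp
    then show "u * z \<in> char_ideal a b" unfolding char_ideal_def by (rule left_ideal_mult)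
  qed (simp_all add: char_ideal_def left_ideal_zero left_ideal_diff)
next
  have diff: "\<chi> (z - of_cx d) = \<chi> z - d" if "z \<in> center" for z d
  proof -
    have "\<chi> (z + of_cx (- d)) = \<chi> z + \<chi> (of_cx (- d))"
      using chi that center_closed(4) unfolding central_character_def by blast
    then show ?thesis using chi by (simp add: of_cx_uminus[symmetric] central_character_def) (simp add: of_cx_uminus)
  qed
  have "casimir - of_cx a \<in> central_kernel \<chi>" "casimir_bar - of_cx b \<in> central_kernel \<chi>"
    using chi casimir_center by (simp_all add: central_kernel_def center_closed diff) (simp_all add: central_character_def)
  then have "left_ideal {casimir - of_cx a, casimir_bar - of_cx b} \<subseteq> left_ideal (central_kernel \<chi>)"
    by (auto elim!: left_ideal_least intro: left_ideal_zero left_ideal_diff left_ideal_gen)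
  then show "x \<in> left_ideal (central_kernel \<chi>)" if "x \<in> char_ideal a b" for x
    using that unfolding char_ideal_def by blast
qed

text \<open>Central factors move to the right, so the two-sided ideal generated by the central
  elements stays inside; conversely the two generators are themselves central.\<close>

lemma char_ideal_centrally_generated: "centrally_generated (char_ideal a b)"
  unfolding centrally_generated_def
proof (intro equalityI subsetI)
  fix x assume "x \<in> char_ideal a b"
  then show "x \<in> two_sided_ideal (char_ideal a b \<inter> center)"
    unfolding char_ideal_def
  proof (rule left_ideal_least)
    fix u z assume "z \<in> {casimir - of_cx a, casimir_bar - of_cx b}"
    then have "z \<in> left_ideal {casimir - of_cx a, casimir_bar - of_cx b} \<inter> center"
      using casimir_center by (auto intro: left_ideal_base center_closed)
    then show "u * z \<in> two_sided_ideal (left_ideal {casimir - of_cx a, casimir_bar - of_cx b} \<inter> center)"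
      by (intro two_sided_ideal_mult two_sided_ideal_base)
  qed (auto simp: two_sided_ideal_def intro: add_span.zero add_span.diff)
next
  fix x assume "x \<in> two_sided_ideal (char_ideal a b \<inter> center)"
  then show "x \<in> char_ideal a b"
    unfolding two_sided_ideal_def
  proof induction
    case (base x)
    then obtain u s v where x: "x = u * s * v" and s: "s \<in> char_ideal a b" "s \<in> center" by blast
    have "s * v = v * s" using s(2) by (simp add: center_def)
    then have "x = (u * v) * s" by (simp add: x mult.assoc)
    then show ?case using s(1) left_ideal_mult unfolding char_ideal_def by blast
  qed (simp_all add: char_ideal_def left_ideal_zero left_ideal_diff)
qed

section \<open>The annihilators\<close>

lemma casimir_annihilates:
  "{casimir - of_cx (of_int n * \<nu>), casimir_bar - of_cx (\<nu> ^ 2)} \<subseteq>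
     annihilator (Verma (of_int (n - 2)) \<nu>) \<inter> center"
proof -
  have a: "\<nu> * (of_int (n - 2) + 2) = of_int n * \<nu>" by simp
  show ?thesis
    using casimir_center casimir_verma_kill[where \<mu> = "of_int (n - 2)" and \<nu> = \<nu>] unfolding a
    by (auto intro!: central_annihilator_Verma center_closed)
qed

text \<open>By \<open>rho_annihilator_loc\<close> an annihilating element kills the whole localized
  orbit of \<open>delta\<close>, in particular the vectors tested in
  \<open>annihilating_in_char_ideal\<close>.\<close>

lemma annihilator_Verma:
  assumes "\<nu> \<noteq> 0"
  shows "annihilator (Verma (of_int (n - 2)) \<nu>) = char_ideal (of_int n * \<nu>) (\<nu> ^ 2)"
proof (intro equalityI)
  show "annihilator (Verma (of_int (n - 2)) \<nu>) \<subseteq> char_ideal (of_int n * \<nu>) (\<nu> ^ 2)"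
    using rho_annihilator_loc[OF annihilator_Verma_rho]
    by (intro subsetI annihilating_in_char_ideal[OF assms]) simp
  show "char_ideal (of_int n * \<nu>) (\<nu> ^ 2) \<subseteq> annihilator (Verma (of_int (n - 2)) \<nu>)"
    unfolding char_ideal_def using casimir_annihilates[of n \<nu>]
    by (intro annihilator_left_ideal Verma_is_left_module) blast
qed

text \<open>The generators of the ideal kill all of \<open>S_f \<otimes> Verma\<close>, hence its
  submodule \<open>EA\<close>; the other inclusion tests \<open>u\<close> on
  \<open>e_nilpotent\<close> vectors, which lie in \<open>EA\<close>.\<close>

lemma annihilator_V_module:
  assumes "\<nu> \<noteq> 0"
  shows "annihilator (V_module n \<nu>) = char_ideal (of_int n * \<nu>) (\<nu> ^ 2)"
proof (intro equalityI)
  show "annihilator (V_module n \<nu>) \<subseteq> char_ideal (of_int n * \<nu>) (\<nu> ^ 2)"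
    unfolding V_module_def using annihilator_EA_rho
    by (intro subsetI annihilating_in_char_ideal[OF assms]) blast
  let ?V = "Verma (of_int (n - 2)) \<nu>"
  have "{casimir - of_cx (of_int n * \<nu>), casimir_bar - of_cx (\<nu> ^ 2)} \<subseteq> annihilator (Sf_tensor ?V)"
    using casimir_annihilates[of n \<nu>] central_annihilator_Sf_tensor by blast
  then have "char_ideal (of_int n * \<nu>) (\<nu> ^ 2) \<subseteq> annihilator (Sf_tensor ?V)"
    unfolding char_ideal_def by (rule annihilator_left_ideal[OF Sf_tensor_is_left_module])
  also have "\<dots> \<subseteq> annihilator (V_module n \<nu>)"
    by (auto simp: V_module_def EA_def annihilator_def)
  finally show "char_ideal (of_int n * \<nu>) (\<nu> ^ 2) \<subseteq> annihilator (V_module n \<nu>)" .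
qed

theorem theorem37:
  fixes n :: int and lam2 :: complex
  assumes "lam2 \<noteq> 0"
  shows "annihilator (V_module n lam2) = annihilator (Verma (of_int (n - 2)) lam2)
    \<and> annihilator (Verma (of_int (n - 2)) lam2) = annihilator (Verma (of_int (- n - 2)) (- lam2))
    \<and> centrally_generated (annihilator (V_module n lam2))
    \<and> (\<exists>\<chi>. central_character (of_int n * lam2) (lam2 ^ 2) \<chi>)
    \<and> (\<forall>\<chi>. central_character (of_int n * lam2) (lam2 ^ 2) \<chi> \<longrightarrow>
          annihilator (V_module n lam2) = left_ideal (central_kernel \<chi>))"
proof -
  have V: "annihilator (V_module n lam2) = char_ideal (of_int n * lam2) (lam2 ^ 2)"
    and D: "annihilator (Verma (of_int (n - 2)) lam2) = char_ideal (of_int n * lam2) (lam2 ^ 2)"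
    using assms by (rule annihilator_V_module annihilator_Verma)+
  \<comment> \<open>Replacing \<open>(n, lam2)\<close> by \<open>(- n, - lam2)\<close> changes
    neither \<open>n * lam2\<close> nor \<open>lam2 ^ 2\<close>.\<close>
  have D': "annihilator (Verma (of_int (- n - 2)) (- lam2)) = char_ideal (of_int n * lam2) (lam2 ^ 2)"
    using annihilator_Verma[of "- lam2" "- n"] assms by simp
  have "\<exists>\<chi>. central_character (of_int n * lam2) (lam2 ^ 2) \<chi>"
    using central_character_exists[of lam2 "of_int n - 2"] by (simp add: mult.commute)
  then show ?thesis
    unfolding V D D' by (simp add: char_ideal_centrally_generated char_ideal_eq_central_kernel)
qed

end
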